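(* Let $0<\epsilon<1$ and $0<\delta<1$. There is a streaming algorithm for insertion-only streams $p_1,\dots,p_m\in[n]$ that outputs at each time $t$ a value $\hat F_2^{(t)}$ such that \[\Pr\big(|\hat F_2^{(t)}-F_2^{(t)}|\le\epsilon F_2\ \text{ for all }0\le t\le m\big)\ge1-\delta.\] The algorithm uses $O(\frac{1}{\epsilon^2}\log\frac1\delta)$ words of storage and has $O(\frac1{\epsilon^2}\log\frac1\delta)$ update time.
   Context: $f^{(t)}_j=\#\{i\le t:p_i=j\}$, $F_2^{(t)}=\sum_j(f^{(t)}_j)^2$, and $F_2=F_2^{(m)}$ is the second moment of the whole stream. A word has at least $\log_2\max\{n,m\}$ bits. *)

theory Defs
  imports "HOL-Probability.Probability"
begin

section \<open>Frequencies and the second moment\<close>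

text \<open>A stream is a function \<open>p\<close> of which the values \<open>p 1, \<dots>, p m\<close> matter.\<close>

definition freq :: "(nat \<Rightarrow> nat) \<Rightarrow> nat \<Rightarrow> nat \<Rightarrow> nat" where
  "freq p t j = card {i \<in> {1..t}. p i = j}"

definition F2 :: "nat \<Rightarrow> (nat \<Rightarrow> nat) \<Rightarrow> nat \<Rightarrow> nat" where
  "F2 n p t = (\<Sum>j\<in>{1..n}. (freq p t j)\<^sup>2)"


section \<open>Word RAM\<close>

text \<open>
  The memory is a list of words of \<open>w\<close> bits, each a natural number below \<open>2 ^ w\<close>. Its length never
  changes: reading outside it gives 0 and writing outside it has no effect, so its length is an
  honest bound on the number of words that a computation uses.
\<close>

type_synonym mem = "nat list"

definition rd :: "mem \<Rightarrow> nat \<Rightarrow> nat" where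
  "rd M a = (if a < length M then M ! a else 0)"

text \<open>Immediate operand, direct addressing, indirect addressing.\<close>

datatype opnd = Imm nat | Cell nat | Ref nat

fun val :: "nat \<Rightarrow> mem \<Rightarrow> opnd \<Rightarrow> nat" where
  "val w M (Imm k) = take_bit w k"
| "val w M (Cell a) = rd M a"
| "val w M (Ref a) = rd M (rd M a)"

datatype dest = To_Cell nat | To_Ref nat

fun addr :: "mem \<Rightarrow> dest \<Rightarrow> nat" where
  "addr M (To_Cell a) = a"
| "addr M (To_Ref a) = rd M a"

text \<open>
  \<open>Mul_Hi\<close> is the high word of the two-word product; \<open>Div hi lo d\<close> and \<open>Mod hi lo d\<close> divide the
  two-word number \<open>hi * 2 ^ w + lo\<close> by the word \<open>d\<close>, the quotient being cut to its low word.
\<close>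

datatype rhs =
    Val opnd
  | Add opnd opnd | Sub opnd opnd | Mul opnd opnd | Mul_Hi opnd opnd
  | Div opnd opnd opnd | Mod opnd opnd opnd
  | And opnd opnd | Or opnd opnd | Xor opnd opnd | Shl opnd opnd | Shr opnd opnd
  | Less opnd opnd | Equal opnd opnd

fun rhs_val :: "nat \<Rightarrow> mem \<Rightarrow> rhs \<Rightarrow> nat" where
  "rhs_val w M (Val x) = val w M x"
| "rhs_val w M (Add x y) = take_bit w (val w M x + val w M y)"
| "rhs_val w M (Sub x y) = take_bit w (val w M x + 2 ^ w - val w M y)"
| "rhs_val w M (Mul x y) = take_bit w (val w M x * val w M y)"
| "rhs_val w M (Mul_Hi x y) = take_bit w (drop_bit w (val w M x * val w M y))"
| "rhs_val w M (Div h l d) = take_bit w ((val w M h * 2 ^ w + val w M l) div val w M d)"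
| "rhs_val w M (Mod h l d) = take_bit w ((val w M h * 2 ^ w + val w M l) mod val w M d)"
| "rhs_val w M (And x y) = Bit_Operations.and (val w M x) (val w M y)"
| "rhs_val w M (Or x y) = Bit_Operations.or (val w M x) (val w M y)"
| "rhs_val w M (Xor x y) = Bit_Operations.xor (val w M x) (val w M y)"
| "rhs_val w M (Shl x y) = take_bit w (push_bit (val w M y) (val w M x))"
| "rhs_val w M (Shr x y) = drop_bit (val w M y) (val w M x)"
| "rhs_val w M (Less x y) = of_bool (val w M x < val w M y)"
| "rhs_val w M (Equal x y) = of_bool (val w M x = val w M y)"

datatype com =
    Skip
  | Set dest rhs
  | Seq com com
  | If opnd com com
  | While opnd com

text \<open>
  \<open>exec w c M k M'\<close>: with words of \<open>w\<close> bits, the program \<open>c\<close> started in the memory \<open>M\<close> terminates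
  after exactly \<open>k\<close> steps in the memory \<open>M'\<close>. A condition holds iff its word is not 0.
\<close>

inductive exec :: "nat \<Rightarrow> com \<Rightarrow> mem \<Rightarrow> nat \<Rightarrow> mem \<Rightarrow> bool" for w where
  Skip: "exec w Skip M 1 M"
| Set: "exec w (Set d e) M 1 (M[addr M d := rhs_val w M e])"
| Seq: "exec w c1 M1 k1 M2 \<Longrightarrow> exec w c2 M2 k2 M3 \<Longrightarrow> exec w (Seq c1 c2) M1 (k1 + k2) M3"
| If_True: "val w M b \<noteq> 0 \<Longrightarrow> exec w c1 M k M' \<Longrightarrow> exec w (If b c1 c2) M (Suc k) M'"
| If_False: "val w M b = 0 \<Longrightarrow> exec w c2 M k M' \<Longrightarrow> exec w (If b c1 c2) M (Suc k) M'"
| While_False: "val w M b = 0 \<Longrightarrow> exec w (While b c) M 1 M"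
| While_True: "val w M1 b \<noteq> 0 \<Longrightarrow> exec w c M1 k1 M2 \<Longrightarrow> exec w (While b c) M2 k2 M3
    \<Longrightarrow> exec w (While b c) M1 (Suc (k1 + k2)) M3"

primrec code_len :: "com \<Rightarrow> nat" where
  "code_len Skip = 1"
| "code_len (Set d e) = 1"
| "code_len (Seq c1 c2) = code_len c1 + code_len c2"
| "code_len (If b c1 c2) = Suc (code_len c1 + code_len c2)"
| "code_len (While b c) = Suc (code_len c)"


section \<open>Streaming algorithms\<close>

text \<open>
  The memory initially holds independent uniformly random words, so that every random bit an
  algorithm ever uses is stored and paid for. The program \<open>init\<close> runs once before the stream begins.
  For each stream item, the item is placed in cell 0 and the program \<open>update\<close> runs. Whenever one of
  these two programs has ended, the output of that time is found in the memory as a quotient of two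
  natural numbers, each spread in base \<open>2 ^ w\<close> over the listed cells, least significant word first.
  Thus the computation of the output is part of the update.
\<close>

record stream_alg =
  mem_size :: nat
  init :: com
  update :: com
  out_num :: "nat list"
  out_den :: "nat list"

text \<open>
  An algorithm may depend on the accuracy, the failure probability, the universe and the word size.
  Its code is therefore charged as storage too, so that no advice comes for free.
\<close>

definition storage :: "stream_alg \<Rightarrow> nat" where
  "storage A = mem_size A + code_len (init A) + code_len (update A)
     + length (out_num A) + length (out_den A)"

definition random_mem :: "nat \<Rightarrow> stream_alg \<Rightarrow> mem pmf" where
  "random_mem w A = replicate_pmf (mem_size A) (pmf_of_set {..<2 ^ w})"

definition out_val :: "nat \<Rightarrow> stream_alg \<Rightarrow> mem \<Rightarrow> real" where
  "out_val w A M = real (horner_sum (rd M) (2 ^ w) (out_num A))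
     / real (horner_sum (rd M) (2 ^ w) (out_den A))"

text \<open>
  The items \<open>1, \<dots>, n\<close> are encoded by the words \<open>0, \<dots>, n - 1\<close>, since \<open>n\<close> itself is not a word if
  \<open>n = 2 ^ w\<close>.
\<close>

definition feed :: "nat \<Rightarrow> mem \<Rightarrow> mem" where
  "feed j M = M[0 := j - 1]"

text \<open>
  \<open>state_at w A p M0 t M\<close>: from the initial (random) memory \<open>M0\<close>, the algorithm has reached the
  memory \<open>M\<close> after processing \<open>p 1, \<dots>, p t\<close>.
\<close>

inductive state_at :: "nat \<Rightarrow> stream_alg \<Rightarrow> (nat \<Rightarrow> nat) \<Rightarrow> mem \<Rightarrow> nat \<Rightarrow> mem \<Rightarrow> bool"
  for w A p M0 where
  start: "exec w (init A) M0 k M \<Longrightarrow> state_at w A p M0 0 M"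
| step: "state_at w A p M0 t M \<Longrightarrow> exec w (update A) (feed (p (Suc t)) M) k M'
    \<Longrightarrow> state_at w A p M0 (Suc t) M'"

text \<open>Worst case over the random words, too; the initialisation has to terminate.\<close>

definition update_time_le :: "nat \<Rightarrow> stream_alg \<Rightarrow> (nat \<Rightarrow> nat) \<Rightarrow> nat \<Rightarrow> real \<Rightarrow> bool" where
  "update_time_le w A p m T \<longleftrightarrow>
     (\<forall>M0 \<in> set_pmf (random_mem w A).
        (\<exists>M. state_at w A p M0 0 M) \<and>
        (\<forall>t<m. \<forall>M. state_at w A p M0 t M \<longrightarrow>
           (\<exists>k M'. exec w (update A) (feed (p (Suc t)) M) k M' \<and> real k \<le> T)))"

definition tracks_F2 :: "nat \<Rightarrow> stream_alg \<Rightarrow> nat \<Rightarrow> (nat \<Rightarrow> nat) \<Rightarrow> nat \<Rightarrow> real \<Rightarrow> mem \<Rightarrow> bool" where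
  "tracks_F2 w A n p m \<epsilon> M0 \<longleftrightarrow>
     (\<forall>t\<le>m. \<exists>M. state_at w A p M0 t M \<and>
        \<bar>out_val w A M - real (F2 n p t)\<bar> \<le> \<epsilon> * real (F2 n p m))"

text \<open>
  The argument of the Landau symbol. For \<open>\<delta> \<le> 1 / 2\<close> the maximum is just \<open>log 2 (1 / \<delta>)\<close>. As
  \<open>\<delta>\<close> tends to 1, the logarithm tends to 0 and cannot serve as a bound on a number of words.
\<close>

definition cost :: "real \<Rightarrow> real \<Rightarrow> real" where
  "cost \<epsilon> \<delta> = 1 / \<epsilon>\<^sup>2 * max 1 (log 2 (1 / \<delta>))"


section \<open>The machine is deterministic\<close>

inductive_cases exec_SkipE: "exec w Skip M k M'"
inductive_cases exec_SetE: "exec w (Set d e) M k M'"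
inductive_cases exec_SeqE: "exec w (Seq c1 c2) M k M'"
inductive_cases exec_IfE: "exec w (If b c1 c2) M k M'"
inductive_cases exec_WhileE: "exec w (While b c) M k M'"

lemma exec_deterministic:
  "exec w c M k M' \<Longrightarrow> exec w c M l M'' \<Longrightarrow> l = k \<and> M'' = M'"
proof (induction arbitrary: l M'' rule: exec.induct)
  case (Skip M)
  then show ?case by (elim exec_SkipE) simp
next
  case (Set d e M)
  then show ?case by (elim exec_SetE) simp
next
  case (Seq c1 M1 k1 M2 c2 k2 M3)
  from Seq.prems obtain l1 l2 N where
    "exec w c1 M1 l1 N" "exec w c2 N l2 M''" "l = l1 + l2"
    by (elim exec_SeqE)
  with Seq.IH show ?case by metis
next
  case (If_True M b c1 k M' c2)
  from If_True.prems If_True.hyps obtain l1 where "exec w c1 M l1 M''" "l = Suc l1"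
    by (elim exec_IfE) auto
  with If_True.IH show ?case by metis
next
  case (If_False M b c2 k M' c1)
  from If_False.prems If_False.hyps obtain l1 where "exec w c2 M l1 M''" "l = Suc l1"
    by (elim exec_IfE) auto
  with If_False.IH show ?case by metis
next
  case (While_False M b c)
  from While_False.prems show ?case
    by (rule exec_WhileE) (use While_False.hyps in simp_all)
next
  case (While_True M1 b c k1 M2 k2 M3)
  from While_True.prems obtain l1 l2 N where
    "exec w c M1 l1 N" "exec w (While b c) N l2 M''" "l = Suc (l1 + l2)"
    by (rule exec_WhileE) (use While_True.hyps(1) in simp_all)
  with While_True.IH show ?case by metis
qed

inductive_cases state_at_0E: "state_at w A p M0 0 M"
inductive_cases state_at_SucE: "state_at w A p M0 (Suc t) M"

lemma state_at_deterministic: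
  "state_at w A p M0 t M \<Longrightarrow> state_at w A p M0 t M' \<Longrightarrow> M' = M"
proof (induction arbitrary: M' rule: state_at.induct)
  case (start k M)
  from start.prems obtain l where "exec w (init A) M0 l M'" by (elim state_at_0E)
  with start.hyps show ?case using exec_deterministic by metis
next
  case (step t M k M1)
  from step.prems obtain l N where "state_at w A p M0 t N"
    "exec w (update A) (feed (p (Suc t)) N) l M'" by (elim state_at_SucE)
  with step.IH step.hyps(2) show ?case using exec_deterministic by metis
qed

end

theory Submission
  imports Defs
begin

text \<open>
  A row is an AMS counter \<open>Z = (\<Sum>j. s j * f j)\<close> with random signs \<open>s\<close>, and a group averages \<open>Z\<^sup>2\<close> over
  \<open>k = O(1 / \<epsilon>\<^sup>2)\<close> rows. The error \<open>X t\<close> of a group at time \<open>t\<close> is a homogeneous quadratic form in the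
  signs. As the frequencies only grow, \<open>X t - X s\<close> has variance at most \<open>(\<mu> t - \<mu> s) / 9\<close> for a monotone
  \<open>\<mu> = O(F2\<^sup>2 / k)\<close>; if the signs are eight-wise independent, Bonami's inequality bounds its fourth
  moment by \<open>(\<mu> t - \<mu> s)\<^sup>2\<close>, and halving \<open>\<mu>\<close> recursively gives the same bound, up to a constant, for
  the maximum of \<open>\<bar>X t\<bar>\<close> over all times, without a logarithmic loss. So a group is accurate at all times
  with probability \<open>15 / 16\<close>, and most of \<open>R = O(log (1 / \<delta>))\<close> groups are with probability \<open>1 - \<delta>\<close>.

  The signs are the top bits of the values of random polynomials of degree 7 modulo \<open>2 ^ (8 * w)\<close>, which
  are exactly eight-wise independent on words: adding a suitable polynomial flips one chosen sign and
  keeps seven others.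

  Computing a median of the groups would cost more than \<open>O(R)\<close>. Since the root of the second moment grows
  by at most 1 in a step, a counter \<open>v\<close> with \<open>v / S \<approx> sqrt F2\<close>, \<open>S = O(1 / \<epsilon>)\<close>, can follow the groups by
  majority votes, \<open>2 * S\<close> per item.

  If the word size is so small that \<open>2 ^ w\<close> is below the cost, then all frequencies are counted exactly.
\<close>

section \<open>Maximal inequalities and low-degree polynomials of signs\<close>

text \<open>The fourth moment is what removes the logarithm. With second moments the budgets of the
  two halves add up to the whole, so every level of the halving contributes equally. Squared budgets
  of the halves are a quarter each, so the levels form a geometric series. The modulus is a power of
  two because the memory supplies uniform bits: the coefficients are exactly uniform, and reduction
  is the loss of the last carry. The price is a ring with zero divisors, where interpolation fails:
  a product of seven differences of words can absorb \<open>7 * w\<close> factors of 2, and the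
  eighth word of the modulus leaves room for the sign bit. All loops are unrolled. Since code is
  charged as storage, its length bounds both space and time, and only programs with branches but
  without loops have to be analysed. The error is measured against the final moment, which never
  decreases; so a counter that only rises can follow it.\<close>

lemma integrable_finite_pmf:
  fixes f :: "'a \<Rightarrow> real"
  assumes "finite (set_pmf D)"
  shows "integrable (measure_pmf D) f"
  using assms by (rule integrable_measure_pmf_finite)

text \<open>Convexity of the fourth power with weights 1/4 and 3/4, tight at
  \<open>b = 3 * a\<close>. The uneven weights serve the recursion below, which needs
  \<open>1 / 4 + (64 / 27) / 4 < 1\<close>.\<close>

lemma pow4_add_le:
  fixes a b :: real
  assumes "0 \<le> a" "0 \<le> b"
  shows "(a + b) ^ 4 \<le> 64 * a ^ 4 + 64 / 27 * b ^ 4"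
proof -
  have "27 * (64 * a ^ 4 + 64 / 27 * b ^ 4 - (a + b) ^ 4)
      = (3 * a - b)\<^sup>2 * (189 * a\<^sup>2 + 114 * a * b + 37 * b\<^sup>2)"
    by (simp add: power2_eq_square power4_eq_xxxx algebra_simps)
  also have "\<dots> \<ge> 0" using assms by simp
  finally show ?thesis by simp
qed

text \<open>Time is cut where \<open>\<mu>\<close> has gained half. Each piece has at most a quarter
  of the squared budget, and a quarter of \<open>1 + 64 / 27\<close> is less than 1, so one constant
  survives all levels of the recursion; it has to be at least \<open>64 / (1 - 91 / 108)\<close>,
  about 406.6.\<close>

lemma maximal_inequality:
  fixes X :: "nat \<Rightarrow> 'a \<Rightarrow> real" and \<mu> :: "nat \<Rightarrow> real"
  assumes fin: "finite (set_pmf D)"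
    and mono: "\<And>s t. s \<le> t \<Longrightarrow> \<mu> s \<le> \<mu> t"
    and incr: "\<And>s t. s \<le> t \<Longrightarrow>
      measure_pmf.expectation D (\<lambda>\<omega>. (X t \<omega> - X s \<omega>) ^ 4) \<le> (\<mu> t - \<mu> s)\<^sup>2"
    and "s \<le> t"
  shows "measure_pmf.expectation D (\<lambda>\<omega>. (MAX u\<in>{s..t}. \<bar>X u \<omega> - X s \<omega>\<bar>) ^ 4)
    \<le> 408 * (\<mu> t - \<mu> s)\<^sup>2"
  using \<open>s \<le> t\<close>
proof (induction "t - s" arbitrary: s t rule: less_induct)
  case less
  let ?E = "measure_pmf.expectation D"
  define M where "M s t \<omega> = (MAX u\<in>{s..t}. \<bar>X u \<omega> - X s \<omega>\<bar>)" for s t \<omega>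
  have M0: "0 \<le> M s t \<omega>" if "s \<le> t" for s t \<omega>
    unfolding M_def using that by (subst Max_ge_iff) auto
  have Mu: "\<bar>X u \<omega> - X s \<omega>\<bar> \<le> M s t \<omega>" if "s \<le> u" "u \<le> t" for s t u \<omega>
    unfolding M_def using that by (intro Max_ge) auto
  have int: "integrable (measure_pmf D) f" for f :: "'a \<Rightarrow> real"
    using fin by (rule integrable_finite_pmf)
  show ?case
  proof (cases "s = t")
    case True
    then show ?thesis by simp
  next
    case False
    define d where "d = \<mu> t - \<mu> s"
    have d0: "0 \<le> d" using mono less.prems by (simp add: d_def)
    define P where "P u \<longleftrightarrow> s < u \<and> u \<le> t \<and> d / 2 \<le> \<mu> u - \<mu> s" for u
    have Pt: "P t" using False less.prems d0 by (simp add: P_def d_def)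
    \<comment> \<open>\<open>\<mu>\<close> may jump by more than \<open>d / 2\<close> between
      \<open>u - 1\<close> and \<open>u\<close>. Therefore the pieces are \<open>{s..u - 1}\<close>
      and \<open>{u..t}\<close>, and the jump enters only through \<open>X u - X s\<close>, whose
      budget is all of \<open>d\<close>.\<close>
    define u where "u = (LEAST u. P u)"
    have Pu: "P u" unfolding u_def using Pt by (rule LeastI)
    have ut: "s < u" "u \<le> t" "d / 2 \<le> \<mu> u - \<mu> s" using Pu by (auto simp: P_def)
    have left: "\<mu> (u - 1) - \<mu> s \<le> d / 2"
    proof (cases "u - 1 = s")
      case True then show ?thesis using d0 by simp
    next
      case False
      have "\<not> P (u - 1)" unfolding u_def using ut(1) u_def by (intro not_less_Least) auto
      then show ?thesis using False ut by (auto simp: P_def)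
    qed
    have right: "\<mu> t - \<mu> u \<le> d / 2" using ut by (simp add: d_def)
    have left': "?E (\<lambda>\<omega>. M s (u - 1) \<omega> ^ 4) \<le> 408 * (d / 2)\<^sup>2"
    proof -
      have "?E (\<lambda>\<omega>. M s (u - 1) \<omega> ^ 4) \<le> 408 * (\<mu> (u - 1) - \<mu> s)\<^sup>2"
        unfolding M_def using ut less.prems by (intro less.hyps) auto
      also have "(\<mu> (u - 1) - \<mu> s)\<^sup>2 \<le> (d / 2)\<^sup>2"
        using left mono[of s "u - 1"] ut by (intro power_mono) auto
      finally show ?thesis by simp
    qed
    have right': "?E (\<lambda>\<omega>. M u t \<omega> ^ 4) \<le> 408 * (d / 2)\<^sup>2"
    proof -
      have "?E (\<lambda>\<omega>. M u t \<omega> ^ 4) \<le> 408 * (\<mu> t - \<mu> u)\<^sup>2"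
        unfolding M_def using ut less.prems by (intro less.hyps) auto
      also have "(\<mu> t - \<mu> u)\<^sup>2 \<le> (d / 2)\<^sup>2"
        using right mono[of u t] ut by (intro power_mono) auto
      finally show ?thesis by simp
    qed
    have mid: "?E (\<lambda>\<omega>. (X u \<omega> - X s \<omega>) ^ 4) \<le> d\<^sup>2"
    proof -
      have "?E (\<lambda>\<omega>. (X u \<omega> - X s \<omega>) ^ 4) \<le> (\<mu> u - \<mu> s)\<^sup>2"
        using ut by (intro incr) auto
      also have "\<dots> \<le> d\<^sup>2"
        using mono[of s u] mono[of u t] ut by (intro power_mono) (auto simp: d_def)
      finally show ?thesis .
    qed
    \<comment> \<open>The maximum is attained either left of \<open>u\<close>, where the left piece
      alone bounds it, or from \<open>u\<close> on, where it is reached through \<open>X u\<close>.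
      Only the second case pays for splitting a fourth power, so the left piece keeps coefficient
      1.\<close>
    have split: "M s t \<omega> ^ 4 \<le> M s (u - 1) \<omega> ^ 4 + (64 * (X u \<omega> - X s \<omega>) ^ 4 + 64 / 27 * M u t \<omega> ^ 4)"
      (is "_ \<le> ?rhs") for \<omega>
    proof -
      have nl: "0 \<le> M s (u - 1) \<omega> ^ 4" "0 \<le> (X u \<omega> - X s \<omega>) ^ 4" "0 \<le> M u t \<omega> ^ 4"
        by (auto intro!: zero_le_even_power)
      have "\<exists>q\<in>{s..t}. M s t \<omega> = \<bar>X q \<omega> - X s \<omega>\<bar>"
      proof -
        have "M s t \<omega> \<in> (\<lambda>u. \<bar>X u \<omega> - X s \<omega>\<bar>) ` {s..t}"
          unfolding M_def using less.prems by (intro Max_in) auto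
        then show ?thesis by auto
      qed
      then obtain q where q: "s \<le> q" "q \<le> t" "M s t \<omega> = \<bar>X q \<omega> - X s \<omega>\<bar>" by auto
      show ?thesis
      proof (cases "q < u")
        case True
        then have "M s t \<omega> \<le> M s (u - 1) \<omega>" using Mu[of s q "u - 1"] q by auto
        then have "M s t \<omega> ^ 4 \<le> M s (u - 1) \<omega> ^ 4" using M0 less.prems by (intro power_mono) auto
        then show ?thesis using nl by linarith
      next
        case False
        then have "M s t \<omega> \<le> \<bar>X u \<omega> - X s \<omega>\<bar> + M u t \<omega>"
          using Mu[of u q t \<omega>] q by auto
        then have "M s t \<omega> ^ 4 \<le> (\<bar>X u \<omega> - X s \<omega>\<bar> + M u t \<omega>) ^ 4"
          using M0 less.prems by (intro power_mono) auto
        also have "\<dots> \<le> 64 * \<bar>X u \<omega> - X s \<omega>\<bar> ^ 4 + 64 / 27 * M u t \<omega> ^ 4"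
          using M0 ut by (intro pow4_add_le) auto
        finally show ?thesis using nl(1) unfolding power_even_abs[OF even_numeral] by linarith
      qed
    qed
    have "?E (\<lambda>\<omega>. M s t \<omega> ^ 4) \<le> ?E (\<lambda>\<omega>. M s (u - 1) \<omega> ^ 4 +
        (64 * (X u \<omega> - X s \<omega>) ^ 4 + 64 / 27 * M u t \<omega> ^ 4))"
      by (intro integral_mono int split)
    also have "\<dots> = ?E (\<lambda>\<omega>. M s (u - 1) \<omega> ^ 4) +
        (64 * ?E (\<lambda>\<omega>. (X u \<omega> - X s \<omega>) ^ 4) + 64 / 27 * ?E (\<lambda>\<omega>. M u t \<omega> ^ 4))"
      by (simp add: Bochner_Integration.integral_add int del: integral_mult_right_zero)
    also have "\<dots> \<le> 408 * d\<^sup>2"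
    proof -
      \<comment> \<open>The sum is \<open>408 / 4 + 64 + (64 / 27) * (408 / 4)\<close>, about
        407.8.\<close>
      have "(d / 2)\<^sup>2 = d\<^sup>2 / 4" by (simp add: power_divide)
      then show ?thesis using left' right' mid zero_le_power2[of d] by linarith
    qed
    finally show ?thesis by (simp add: M_def d_def)
  qed
qed

section \<open>Fourth moments of low-degree polynomials in eight-wise independent signs\<close>

lemma expectation_cauchy_schwarz:
  fixes f g :: "'a \<Rightarrow> real"
  assumes fin: "finite (set_pmf D)"
  shows "(measure_pmf.expectation D (\<lambda>\<omega>. f \<omega> * g \<omega>))\<^sup>2
    \<le> measure_pmf.expectation D (\<lambda>\<omega>. (f \<omega>)\<^sup>2) * measure_pmf.expectation D (\<lambda>\<omega>. (g \<omega>)\<^sup>2)"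
proof -
  have e: "measure_pmf.expectation D h = (\<Sum>\<omega>\<in>set_pmf D. pmf D \<omega> * h \<omega>)" for h :: "'a \<Rightarrow> real"
    using fin by (subst integral_measure_pmf[of "set_pmf D"]) auto
  have "(\<Sum>\<omega>\<in>set_pmf D. (sqrt (pmf D \<omega>) * f \<omega>) * (sqrt (pmf D \<omega>) * g \<omega>))\<^sup>2
    \<le> (\<Sum>\<omega>\<in>set_pmf D. (sqrt (pmf D \<omega>) * f \<omega>)\<^sup>2) * (\<Sum>\<omega>\<in>set_pmf D. (sqrt (pmf D \<omega>) * g \<omega>)\<^sup>2)"
    by (rule Cauchy_Schwarz_ineq_sum)
  moreover have "sqrt (pmf D \<omega>) * f \<omega> * (sqrt (pmf D \<omega>) * g \<omega>) = pmf D \<omega> * (f \<omega> * g \<omega>)" for \<omega>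
    by simp
  ultimately show ?thesis by (simp add: e power_mult_distrib)
qed

text \<open>Eight is what Bonami's inequality consumes in degree 2: the fourth power of a quadratic
  form multiplies four characters of at most two signs each.\<close>

locale signs =
  fixes D :: "'a pmf" and \<sigma> :: "'a \<Rightarrow> 'v \<Rightarrow> real" and U :: "'v set"
  assumes finD: "finite (set_pmf D)"
    and sq: "\<sigma> \<omega> v * \<sigma> \<omega> v = 1"
    and indep: "J \<subseteq> U \<Longrightarrow> finite J \<Longrightarrow> J \<noteq> {} \<Longrightarrow> card J \<le> 8 \<Longrightarrow>
      measure_pmf.expectation D (\<lambda>\<omega>. \<Prod>v\<in>J. \<sigma> \<omega> v) = 0"
begin

abbreviation E :: "('a \<Rightarrow> real) \<Rightarrow> real" where
  "E \<equiv> measure_pmf.expectation D"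

text \<open>The Walsh characters; as signs square to 1, products of characters are characters
  again.\<close>

definition chi :: "'v set \<Rightarrow> 'a \<Rightarrow> real" where
  "chi J \<omega> = (\<Prod>v\<in>J. \<sigma> \<omega> v)"

lemma integrable_D: "integrable (measure_pmf D) (f :: 'a \<Rightarrow> real)"
  using finD by (rule integrable_finite_pmf)

lemma E_add: "E (\<lambda>\<omega>. f \<omega> + g \<omega>) = E f + E g"
  by (intro Bochner_Integration.integral_add integrable_D)

lemma E_sum: "E (\<lambda>\<omega>. \<Sum>x\<in>T. f x \<omega>) = (\<Sum>x\<in>T. E (f x))"
  by (intro Bochner_Integration.integral_sum integrable_D)

lemma E_chi: "J \<subseteq> U \<Longrightarrow> finite J \<Longrightarrow> J \<noteq> {} \<Longrightarrow> card J \<le> 8 \<Longrightarrow> E (chi J) = 0"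
  using indep unfolding chi_def[abs_def] by blast

lemma chi_insert: "finite J \<Longrightarrow> v \<notin> J \<Longrightarrow> chi (insert v J) \<omega> = \<sigma> \<omega> v * chi J \<omega>"
  by (simp add: chi_def)

lemma chi_mult:
  assumes "finite J" "finite K"
  shows "chi J \<omega> * chi K \<omega> = chi ((J - K) \<union> (K - J)) \<omega>"
proof -
  have J: "chi J \<omega> = chi (J - K) \<omega> * chi (J \<inter> K) \<omega>"
    unfolding chi_def using assms by (subst prod.union_disjoint[symmetric]) (auto intro!: prod.cong)
  have K: "chi K \<omega> = chi (K - J) \<omega> * chi (J \<inter> K) \<omega>"
    unfolding chi_def using assms by (subst prod.union_disjoint[symmetric]) (auto intro!: prod.cong)
  have "chi (J \<inter> K) \<omega> * chi (J \<inter> K) \<omega> = 1"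
    unfolding chi_def by (simp add: prod.distrib[symmetric] sq)
  then have "chi J \<omega> * chi K \<omega> = chi (J - K) \<omega> * chi (K - J) \<omega>"
    by (simp add: J K algebra_simps)
  also have "\<dots> = chi ((J - K) \<union> (K - J)) \<omega>"
    unfolding chi_def using assms by (subst prod.union_disjoint) auto
  finally show ?thesis .
qed

text \<open>Multilinear polynomials of degree at most \<open>d\<close> in the signs indexed by
  \<open>V\<close>. Generating them one character at a time makes each closure property an induction
  and avoids families of coefficients.\<close>

inductive pol :: "'v set \<Rightarrow> nat \<Rightarrow> ('a \<Rightarrow> real) \<Rightarrow> bool" for V d where
  zero: "pol V d (\<lambda>_. 0)"
| add: "J \<subseteq> V \<Longrightarrow> finite J \<Longrightarrow> card J \<le> d \<Longrightarrow> pol V d f \<Longrightarrow> pol V d (\<lambda>\<omega>. c * chi J \<omega> + f \<omega>)"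

lemma pol_plus: "pol V d f \<Longrightarrow> pol V d g \<Longrightarrow> pol V d (\<lambda>\<omega>. f \<omega> + g \<omega>)"
proof (induction rule: pol.induct)
  case (add J f c)
  then show ?case using pol.add[of J V d "\<lambda>\<omega>. f \<omega> + g \<omega>" c] by (simp add: add.assoc)
qed simp

lemma pol_mult_chi:
  "pol V d f \<Longrightarrow> J \<subseteq> V \<Longrightarrow> finite J \<Longrightarrow> card J \<le> e \<Longrightarrow> pol V (d + e) (\<lambda>\<omega>. c * chi J \<omega> * f \<omega>)"
proof (induction rule: pol.induct)
  case zero
  then show ?case by (simp add: pol.zero)
next
  case (add K f b)
  let ?S = "(J - K) \<union> (K - J)"
  have "card ?S \<le> card (J \<union> K)" using add by (intro card_mono) auto
  also have "\<dots> \<le> d + e" using add card_Un_le[of J K] by linarith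
  finally have "pol V (d + e) (\<lambda>\<omega>. c * b * chi ?S \<omega> + c * chi J \<omega> * f \<omega>)"
    using add by (intro pol.add) auto
  moreover have "c * chi J \<omega> * (b * chi K \<omega> + f \<omega>) = c * b * chi ?S \<omega> + c * chi J \<omega> * f \<omega>" for \<omega>
    using add by (simp add: chi_mult[symmetric] algebra_simps)
  ultimately show ?case by simp
qed

lemma pol_mult: "pol V d f \<Longrightarrow> pol V e g \<Longrightarrow> pol V (d + e) (\<lambda>\<omega>. f \<omega> * g \<omega>)"
proof (induction rule: pol.induct)
  case zero
  then show ?case by (simp add: pol.zero)
next
  case (add J f c)
  have "pol V (e + d) (\<lambda>\<omega>. c * chi J \<omega> * g \<omega>)"
    using add by (intro pol_mult_chi) auto
  then have "pol V (d + e) (\<lambda>\<omega>. c * chi J \<omega> * g \<omega> + f \<omega> * g \<omega>)"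
    using add by (intro pol_plus) (auto simp: add.commute)
  then show ?case by (simp add: algebra_simps)
qed

lemma pol_sum:
  assumes "finite T" "\<And>x. x \<in> T \<Longrightarrow> J x \<subseteq> V \<and> finite (J x) \<and> card (J x) \<le> d"
  shows "pol V d (\<lambda>\<omega>. \<Sum>x\<in>T. c x * chi (J x) \<omega>)"
  using assms
proof (induction T rule: finite_induct)
  case (insert x F)
  then show ?case by (simp add: pol.add)
qed (simp add: pol.zero)

lemma pol_0_const: "pol V 0 f \<Longrightarrow> \<exists>c. f = (\<lambda>_. c)"
proof (induction rule: pol.induct)
  case (add J f c)
  then show ?case by (auto simp: chi_def)
qed blast

lemma pol_empty_const: "pol {} d f \<Longrightarrow> \<exists>c. f = (\<lambda>_. c)"
proof (induction rule: pol.induct)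
  case (add J f c)
  then show ?case by (auto simp: chi_def)
qed blast

text \<open>Characters containing \<open>v\<close> lose it and go to \<open>h\<close>, the others go
  to \<open>g\<close>. The lower degree of \<open>h\<close> is what lets the factor
  \<open>9 ^ d\<close> of \<open>bonami\<close> close.\<close>

lemma pol_split:
  "pol (insert v V) (Suc d) f \<Longrightarrow> v \<notin> V \<Longrightarrow>
    \<exists>g h. pol V (Suc d) g \<and> pol V d h \<and> f = (\<lambda>\<omega>. g \<omega> + \<sigma> \<omega> v * h \<omega>)"
proof (induction rule: pol.induct)
  case zero
  then show ?case by (intro exI[of _ "\<lambda>_. 0"]) (auto intro: pol.zero)
next
  case (add J f c)
  then obtain g h where gh: "pol V (Suc d) g" "pol V d h" "f = (\<lambda>\<omega>. g \<omega> + \<sigma> \<omega> v * h \<omega>)" by auto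
  show ?case
  proof (cases "v \<in> J")
    case True
    then have "chi J \<omega> = \<sigma> \<omega> v * chi (J - {v}) \<omega>" for \<omega>
      using add chi_insert[of "J - {v}" v] by (simp add: insert_absorb)
    moreover have "pol V d (\<lambda>\<omega>. c * chi (J - {v}) \<omega> + h \<omega>)"
      using add True gh by (intro pol.add) auto
    ultimately show ?thesis using gh
      by (intro exI[of _ g] exI[of _ "\<lambda>\<omega>. c * chi (J - {v}) \<omega> + h \<omega>"]) (auto simp: algebra_simps)
  next
    case False
    then have "pol V (Suc d) (\<lambda>\<omega>. c * chi J \<omega> + g \<omega>)"
      using add gh by (intro pol.add) auto
    then show ?thesis using gh
      by (intro exI[of _ "\<lambda>\<omega>. c * chi J \<omega> + g \<omega>"] exI[of _ h]) auto
  qed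
qed

text \<open>Multiplication by an absent sign turns every character of \<open>f\<close>, even the
  constant one, into a nonempty one of at most \<open>d + 1 \<le> 8\<close> signs, and these have
  mean 0.\<close>

lemma E_fresh:
  "pol V d f \<Longrightarrow> insert v V \<subseteq> U \<Longrightarrow> v \<notin> V \<Longrightarrow> d < 8 \<Longrightarrow> E (\<lambda>\<omega>. \<sigma> \<omega> v * f \<omega>) = 0"
proof (induction rule: pol.induct)
  case (add J f c)
  have "E (\<lambda>\<omega>. \<sigma> \<omega> v * (c * chi J \<omega> + f \<omega>)) = E (\<lambda>\<omega>. c * chi (insert v J) \<omega> + \<sigma> \<omega> v * f \<omega>)"
    using add by (subst chi_insert) (auto simp: algebra_simps)
  also have "\<dots> = c * E (chi (insert v J)) + E (\<lambda>\<omega>. \<sigma> \<omega> v * f \<omega>)"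
    by (simp add: E_add)
  also have "E (chi (insert v J)) = 0"
    using add by (intro E_chi) (auto simp: card_insert_if)
  finally show ?case using add by simp
qed simp

text \<open>Bonami's argument: split off one sign \<open>x\<close>, so that \<open>f = g + x h\<close>; the odd powers of \<open>x\<close> vanish
  in the fourth moment and the mixed term is bounded by the Cauchy-Schwarz inequality.\<close>

lemma bonami:
  assumes "finite V" "V \<subseteq> U" "pol V d f" "d \<le> 2"
  shows "E (\<lambda>\<omega>. f \<omega> ^ 4) \<le> 9 ^ d * (E (\<lambda>\<omega>. (f \<omega>)\<^sup>2))\<^sup>2"
  using assms
proof (induction V arbitrary: d f rule: finite_induct)
  case empty
  then obtain c where c: "f = (\<lambda>_. c)" using pol_empty_const by blast
  have "1 * c ^ 4 \<le> 9 ^ d * c ^ 4" by (intro mult_right_mono) auto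
  then show ?case by (simp add: c power_mult[symmetric])
next
  case (insert v V)
  show ?case
  proof (cases d)
    case 0
    then obtain c where c: "f = (\<lambda>_. c)" using pol_0_const insert.prems by blast
    show ?thesis by (simp add: c 0 power_mult[symmetric])
  next
    case (Suc d')
    then obtain g h where gh: "pol V d g" "pol V d' h" "f = (\<lambda>\<omega>. g \<omega> + \<sigma> \<omega> v * h \<omega>)"
      using insert.prems insert.hyps pol_split[of v V d' f] by auto
    have fresh: "E (\<lambda>\<omega>. \<sigma> \<omega> v * q \<omega>) = 0" if "pol V e q" "e < 8" for e q
      using E_fresh[OF that(1), of v] that insert.prems insert.hyps by auto
    define a b where "a = E (\<lambda>\<omega>. (g \<omega>)\<^sup>2)" and "b = E (\<lambda>\<omega>. (h \<omega>)\<^sup>2)"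
    have ab: "0 \<le> a" "0 \<le> b" by (auto simp: a_def b_def)
    have "E (\<lambda>\<omega>. \<sigma> \<omega> v * (g \<omega> * h \<omega>)) = 0"
      using Suc insert.prems insert.hyps by (intro fresh[of "d + d'"] pol_mult gh) auto
    moreover have "(f \<omega>)\<^sup>2 = (g \<omega>)\<^sup>2 + (2 * (\<sigma> \<omega> v * (g \<omega> * h \<omega>)) + (h \<omega>)\<^sup>2)" for \<omega>
    proof -
      have "(g \<omega> + x * h \<omega>)\<^sup>2 = (g \<omega>)\<^sup>2 + (2 * (x * (g \<omega> * h \<omega>)) + (h \<omega>)\<^sup>2 * (x * x))" for x
        by (simp add: power2_eq_square algebra_simps)
      from this[of "\<sigma> \<omega> v"] show ?thesis by (simp only: gh(3) sq mult_1_right)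
    qed
    ultimately have f2: "E (\<lambda>\<omega>. (f \<omega>)\<^sup>2) = a + b"
      by (simp add: E_add a_def b_def)
    \<comment> \<open>The most demanding term: for \<open>d = 2\<close> and \<open>d' = 1\<close>
      the polynomial has degree \<open>3 * d + d' = 7\<close>, and with the sign at \<open>v\<close>
      all of the eight-wise independence is used.\<close>
    have "E (\<lambda>\<omega>. \<sigma> \<omega> v * (g \<omega> * g \<omega> * (g \<omega> * h \<omega>))) = 0"
      using Suc insert.prems insert.hyps by (intro fresh[of "(d + d) + (d + d')"] pol_mult gh) auto
    moreover have "E (\<lambda>\<omega>. \<sigma> \<omega> v * (g \<omega> * h \<omega> * (h \<omega> * h \<omega>))) = 0"
      using Suc insert.prems insert.hyps by (intro fresh[of "(d + d') + (d' + d')"] pol_mult gh) auto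
    moreover have "f \<omega> ^ 4 = g \<omega> ^ 4 + (4 * (\<sigma> \<omega> v * (g \<omega> * g \<omega> * (g \<omega> * h \<omega>)))
        + (6 * ((g \<omega>)\<^sup>2 * (h \<omega>)\<^sup>2) + (4 * (\<sigma> \<omega> v * (g \<omega> * h \<omega> * (h \<omega> * h \<omega>))) + h \<omega> ^ 4)))" for \<omega>
    proof -
      have "(g \<omega> + x * h \<omega>) ^ 4 = g \<omega> ^ 4 + (4 * (x * (g \<omega> * g \<omega> * (g \<omega> * h \<omega>)))
        + (6 * ((g \<omega>)\<^sup>2 * (h \<omega>)\<^sup>2) * (x * x) + (4 * (x * (g \<omega> * h \<omega> * (h \<omega> * h \<omega>))) * (x * x) + h \<omega> ^ 4 * (x * x) * (x * x))))" for x
        by (simp add: power2_eq_square power4_eq_xxxx algebra_simps)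
      from this[of "\<sigma> \<omega> v"] show ?thesis by (simp only: gh(3) sq mult_1_right)
    qed
    ultimately have f4: "E (\<lambda>\<omega>. f \<omega> ^ 4) = E (\<lambda>\<omega>. g \<omega> ^ 4) + (6 * E (\<lambda>\<omega>. (g \<omega>)\<^sup>2 * (h \<omega>)\<^sup>2) + E (\<lambda>\<omega>. h \<omega> ^ 4))"
      by (simp add: E_add)
    have g4: "E (\<lambda>\<omega>. g \<omega> ^ 4) \<le> 9 ^ d * a\<^sup>2"
      unfolding a_def using insert.prems gh by (intro insert.IH) auto
    have h4: "E (\<lambda>\<omega>. h \<omega> ^ 4) \<le> 9 ^ d' * b\<^sup>2"
      unfolding b_def using insert.prems gh Suc by (intro insert.IH) auto
    have "(E (\<lambda>\<omega>. (g \<omega>)\<^sup>2 * (h \<omega>)\<^sup>2))\<^sup>2 \<le> E (\<lambda>\<omega>. g \<omega> ^ 4) * E (\<lambda>\<omega>. h \<omega> ^ 4)"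
      using expectation_cauchy_schwarz[OF finD, of "\<lambda>\<omega>. (g \<omega>)\<^sup>2" "\<lambda>\<omega>. (h \<omega>)\<^sup>2"]
      by (simp add: power_mult[symmetric])
    also have "\<dots> \<le> (9 ^ d * a\<^sup>2) * (9 ^ d' * b\<^sup>2)"
      by (intro mult_mono g4 h4) (auto intro!: integral_nonneg_AE)
    also have "\<dots> = (3 * 9 ^ d' * a * b)\<^sup>2"
    proof -
      have "(9 * q * a\<^sup>2) * (q * b\<^sup>2) = (3 * q * a * b)\<^sup>2" for q
        by (simp add: power_mult_distrib) (simp add: power2_eq_square)
      then show ?thesis by (simp only: Suc power_Suc)
    qed
    finally have gh4: "E (\<lambda>\<omega>. (g \<omega>)\<^sup>2 * (h \<omega>)\<^sup>2) \<le> 3 * 9 ^ d' * a * b"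
      by (rule power2_le_imp_le) (intro mult_nonneg_nonneg ab, simp_all)
    have "E (\<lambda>\<omega>. f \<omega> ^ 4) \<le> 9 ^ d * a\<^sup>2 + (6 * (3 * 9 ^ d' * a * b) + 9 ^ d' * b\<^sup>2)"
      unfolding f4 using g4 h4 gh4 by linarith
    also have "\<dots> \<le> 9 ^ d * a\<^sup>2 + (6 * (3 * 9 ^ d' * a * b) + 9 ^ d * b\<^sup>2)"
      by (simp add: Suc)
    \<comment> \<open>The mixed terms match because \<open>6 * 3 * 9 ^ d' = 2 * 9 ^ d\<close>; the
      base 9 is the solution of \<open>6 * sqrt c = 2 * c\<close>.\<close>
    also have "\<dots> = 9 ^ d * (a + b)\<^sup>2"
      by (simp add: Suc power2_eq_square algebra_simps)
    finally show ?thesis by (simp add: f2)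
  qed
qed

text \<open>Distinct sets have a nonempty symmetric difference of at most eight elements, so their
  characters are orthogonal; injectivity of \<open>J\<close> excludes coinciding characters.\<close>

lemma E_square_sum:
  assumes T: "finite T" "inj_on J T"
    and J: "\<And>x. x \<in> T \<Longrightarrow> J x \<subseteq> U \<and> finite (J x) \<and> card (J x) \<le> 4"
  shows "E (\<lambda>\<omega>. (\<Sum>x\<in>T. c x * chi (J x) \<omega>)\<^sup>2) = (\<Sum>x\<in>T. (c x)\<^sup>2)"
proof -
  have orth: "E (\<lambda>\<omega>. chi (J x) \<omega> * chi (J y) \<omega>) = of_bool (x = y)" if "x \<in> T" "y \<in> T" for x y
  proof (cases "x = y")
    case True
    then show ?thesis using J[OF that(1)] by (simp add: chi_mult) (simp add: chi_def)
  next
    case False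
    let ?S = "(J x - J y) \<union> (J y - J x)"
    have "J x \<noteq> J y" using T(2) that False by (auto dest: inj_onD)
    moreover have "card ?S \<le> card (J x \<union> J y)" using J that by (intro card_mono) auto
    then have "card ?S \<le> 8"
      using card_Un_le[of "J x" "J y"] J[OF that(1)] J[OF that(2)] by linarith
    ultimately have "E (chi ?S) = 0" using J that by (intro E_chi) auto
    then show ?thesis using False J that by (simp add: chi_mult)
  qed
  have "E (\<lambda>\<omega>. (\<Sum>x\<in>T. c x * chi (J x) \<omega>)\<^sup>2)
      = E (\<lambda>\<omega>. \<Sum>x\<in>T. \<Sum>y\<in>T. c x * c y * (chi (J x) \<omega> * chi (J y) \<omega>))"
    by (simp add: power2_eq_square sum_product algebra_simps)
  also have "\<dots> = (\<Sum>x\<in>T. \<Sum>y\<in>T. c x * c y * of_bool (x = y))"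
    unfolding E_sum by (intro sum.cong refl) (simp add: orth)
  also have "\<dots> = (\<Sum>x\<in>T. (c x)\<^sup>2)"
    using T by (simp add: power2_eq_square of_bool_def if_distrib cong: if_cong)
  finally show ?thesis .
qed

end

section \<open>Tracking with averaged sign sketches\<close>

lemma square_sum_pairs:
  fixes y :: "nat \<Rightarrow> real"
  assumes "finite A"
  shows "(\<Sum>j\<in>A. y j)\<^sup>2 = (\<Sum>j\<in>A. (y j)\<^sup>2) + 2 * (\<Sum>(j, l)\<in>{(j, l) \<in> A \<times> A. j < l}. y j * y l)"
  using assms
proof (induction A rule: finite_linorder_max_induct)
  case (insert b A)
  have eq: "{(j, l) \<in> insert b A \<times> insert b A. j < l} = {(j, l) \<in> A \<times> A. j < l} \<union> A \<times> {b}"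
    using insert.hyps by auto
  have "finite {(j, l) \<in> A \<times> A. j < l}"
    using insert.hyps by (auto intro: finite_subset[of _ "A \<times> A"])
  then have "(\<Sum>(j, l)\<in>{(j, l) \<in> insert b A \<times> insert b A. j < l}. y j * y l)
      = (\<Sum>(j, l)\<in>{(j, l) \<in> A \<times> A. j < l}. y j * y l) + (\<Sum>(j, l)\<in>A \<times> {b}. y j * y l)"
    unfolding eq using insert.hyps by (intro sum.union_disjoint) auto
  also have "(\<Sum>(j, l)\<in>A \<times> {b}. y j * y l) = (\<Sum>j\<in>A. y j) * y b"
    by (simp add: sum.cartesian_product[symmetric] sum_distrib_right)
  finally have pairs: "(\<Sum>(j, l)\<in>{(j, l) \<in> insert b A \<times> insert b A. j < l}. y j * y l)
      = (\<Sum>(j, l)\<in>{(j, l) \<in> A \<times> A. j < l}. y j * y l) + (\<Sum>j\<in>A. y j) * y b" .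
  have "b \<notin> A" using insert.hyps by auto
  then have "(\<Sum>j\<in>insert b A. y j)\<^sup>2 = (y b)\<^sup>2 + (\<Sum>j\<in>A. y j)\<^sup>2 + 2 * y b * (\<Sum>j\<in>A. y j)"
    using insert.hyps by (simp add: power2_sum)
  with \<open>b \<notin> A\<close> show ?case
    unfolding pairs insert.IH using insert.hyps by (simp add: distrib_left)
qed simp

text \<open>Replaces the squared increments in a variance by the increment of one monotone function,
  which is how \<open>\<mu>\<close> arises.\<close>

lemma sq_diff_le_diff_sq:
  fixes a b :: real
  assumes "0 \<le> a" "a \<le> b"
  shows "(b - a)\<^sup>2 \<le> b\<^sup>2 - a\<^sup>2"
proof -
  have "b\<^sup>2 - a\<^sup>2 - (b - a)\<^sup>2 = 2 * a * (b - a)" by (simp add: power2_eq_square algebra_simps)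
  also have "\<dots> \<ge> 0" using assms by simp
  finally show ?thesis by simp
qed

locale ams = signs D \<sigma> "{..<k} \<times> A"
  for D :: "'a pmf" and \<sigma> :: "'a \<Rightarrow> nat \<times> nat \<Rightarrow> real" and k :: nat and A :: "nat set" +
  fixes f :: "nat \<Rightarrow> nat \<Rightarrow> real"
  assumes finA: "finite A" and k_pos: "0 < k"
    and f_0: "f 0 j = 0" and f_mono: "s \<le> t \<Longrightarrow> f s j \<le> f t j"
begin

definition F :: "nat \<Rightarrow> real" where
  "F t = (\<Sum>j\<in>A. (f t j)\<^sup>2)"

definition X :: "nat \<Rightarrow> 'a \<Rightarrow> real" where
  "X t \<omega> = (\<Sum>i<k. (\<Sum>j\<in>A. f t j * \<sigma> \<omega> (i, j))\<^sup>2) / real k - F t"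

definition PR :: "(nat \<times> nat) set" where
  "PR = {(j, l) \<in> A \<times> A. j < l}"

text \<open>The factor is \<open>9 * 4\<close>: the variance of an increment of \<open>X\<close> is
  \<open>4 / k\<close> times a sum of squared increments over the pairs, and Bonami's factor in
  degree 2 is \<open>9\<^sup>2\<close>.\<close>

definition \<mu> :: "nat \<Rightarrow> real" where
  "\<mu> t = 36 / real k * (\<Sum>(j, l)\<in>PR. (f t j * f t l)\<^sup>2)"

lemma finPR: "finite PR"
  unfolding PR_def using finA by (auto intro: finite_subset[of _ "A \<times> A"])

lemma f_nonneg: "0 \<le> f t j"
  using f_mono[of 0 t j] by (simp add: f_0)

lemma ff_mono: "s \<le> t \<Longrightarrow> f s j * f s l \<le> f t j * f t l"
  by (intro mult_mono f_mono f_nonneg)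

lemma \<mu>_mono: "s \<le> t \<Longrightarrow> \<mu> s \<le> \<mu> t"
proof -
  assume "s \<le> t"
  then have "(f s j * f s l)\<^sup>2 \<le> (f t j * f t l)\<^sup>2" for j l
    by (intro power_mono ff_mono mult_nonneg_nonneg f_nonneg)
  then show ?thesis unfolding \<mu>_def by (intro mult_left_mono sum_mono) auto
qed

text \<open>The diagonal terms carry squared signs and add up to \<open>F t\<close>, which the
  centring removes; only characters of exactly two signs of one row remain.\<close>

lemma X_eq: "X t \<omega> = (\<Sum>(i, j, l)\<in>{..<k} \<times> PR. 2 / real k * (f t j * f t l) * chi {(i, j), (i, l)} \<omega>)"
proof -
  have row: "(\<Sum>j\<in>A. f t j * \<sigma> \<omega> (i, j))\<^sup>2
      = F t + 2 * (\<Sum>(j, l)\<in>PR. f t j * f t l * chi {(i, j), (i, l)} \<omega>)" for i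
  proof -
    have "(\<Sum>j\<in>A. (f t j * \<sigma> \<omega> (i, j))\<^sup>2) = F t"
      unfolding F_def power_mult_distrib by (simp add: power2_eq_square[of "\<sigma> _ _"] sq)
    moreover have "(\<Sum>(j, l)\<in>PR. f t j * \<sigma> \<omega> (i, j) * (f t l * \<sigma> \<omega> (i, l)))
        = (\<Sum>(j, l)\<in>PR. f t j * f t l * chi {(i, j), (i, l)} \<omega>)"
      by (intro sum.cong) (auto simp: PR_def chi_def)
    ultimately show ?thesis
      unfolding square_sum_pairs[OF finA] PR_def by simp
  qed
  have "X t \<omega> = (\<Sum>i<k. 2 * (\<Sum>(j, l)\<in>PR. f t j * f t l * chi {(i, j), (i, l)} \<omega>)) / real k"
    unfolding X_def row using k_pos by (simp add: sum.distrib add_divide_distrib)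
  also have "\<dots> = (\<Sum>i<k. \<Sum>(j, l)\<in>PR. 2 / real k * (f t j * f t l) * chi {(i, j), (i, l)} \<omega>)"
    by (simp add: sum_divide_distrib sum_distrib_left case_prod_unfold mult.assoc)
  also have "\<dots> = (\<Sum>(i, j, l)\<in>{..<k} \<times> PR. 2 / real k * (f t j * f t l) * chi {(i, j), (i, l)} \<omega>)"
    by (simp add: sum.cartesian_product case_prod_unfold)
  finally show ?thesis .
qed

lemma X_0: "X 0 \<omega> = 0"
  by (simp add: X_def F_def f_0)

lemma X_increment:
  assumes "s \<le> t"
  shows "E (\<lambda>\<omega>. (X t \<omega> - X s \<omega>) ^ 4) \<le> (\<mu> t - \<mu> s)\<^sup>2"
proof -
  define c :: "nat \<times> nat \<times> nat \<Rightarrow> real"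
    where "c = (\<lambda>(i, j, l). 2 / real k * (f t j * f t l - f s j * f s l))"
  define J :: "nat \<times> nat \<times> nat \<Rightarrow> (nat \<times> nat) set" where "J = (\<lambda>(i, j, l). {(i, j), (i, l)})"
  let ?T = "{..<k} \<times> PR"
  have diff: "X t \<omega> - X s \<omega> = (\<Sum>x\<in>?T. c x * chi (J x) \<omega>)" for \<omega>
    unfolding X_eq sum_subtractf[symmetric]
    by (intro sum.cong) (auto simp: c_def J_def algebra_simps)
  have fT: "finite ?T" using finPR by simp
  have Jx: "J x \<subseteq> {..<k} \<times> A \<and> finite (J x) \<and> card (J x) \<le> 2" if "x \<in> ?T" for x
    using that by (auto simp: J_def PR_def card_insert_if)
  \<comment> \<open>The condition \<open>j < l\<close> in \<open>PR\<close> orders the pair, so the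
    two-element set determines the triple.\<close>
  have inj: "inj_on J ?T"
    by (auto simp: inj_on_def J_def PR_def doubleton_eq_iff)
  have "E (\<lambda>\<omega>. (X t \<omega> - X s \<omega>) ^ 4) \<le> 9 ^ 2 * (E (\<lambda>\<omega>. (X t \<omega> - X s \<omega>)\<^sup>2))\<^sup>2"
    unfolding diff using finA fT Jx by (intro bonami[of "{..<k} \<times> A"] pol_sum) auto
  also have "E (\<lambda>\<omega>. (X t \<omega> - X s \<omega>)\<^sup>2) = (\<Sum>x\<in>?T. (c x)\<^sup>2)"
    unfolding diff using fT inj Jx by (intro E_square_sum) force+
  also have "(\<Sum>x\<in>?T. (c x)\<^sup>2) = 4 / real k * (\<Sum>(j, l)\<in>PR. (f t j * f t l - f s j * f s l)\<^sup>2)"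
  proof -
    have c2: "(c (i, j, l))\<^sup>2 = (2 / real k)\<^sup>2 * (f t j * f t l - f s j * f s l)\<^sup>2" for i j l
      by (simp only: c_def prod.case power_mult_distrib)
    have "(\<Sum>x\<in>?T. (c x)\<^sup>2) = (\<Sum>i<k. \<Sum>(j, l)\<in>PR. (c (i, j, l))\<^sup>2)"
      by (simp add: sum.cartesian_product case_prod_unfold)
    also have "\<dots> = real k * ((2 / real k)\<^sup>2 * (\<Sum>(j, l)\<in>PR. (f t j * f t l - f s j * f s l)\<^sup>2))"
      unfolding c2 by (simp add: sum_distrib_left case_prod_unfold)
    finally show ?thesis using k_pos by (simp add: power2_eq_square field_simps)
  qed
  also have "9\<^sup>2 * (4 / real k * (\<Sum>(j, l)\<in>PR. (f t j * f t l - f s j * f s l)\<^sup>2))\<^sup>2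
      = (36 / real k * (\<Sum>(j, l)\<in>PR. (f t j * f t l - f s j * f s l)\<^sup>2))\<^sup>2"
    by (simp add: power_mult_distrib power_divide)
  also have "\<dots> \<le> (\<mu> t - \<mu> s)\<^sup>2"
  proof (intro power_mono)
    have "\<mu> t - \<mu> s = 36 / real k * (\<Sum>(j, l)\<in>PR. (f t j * f t l)\<^sup>2 - (f s j * f s l)\<^sup>2)"
      by (simp add: \<mu>_def case_prod_unfold sum_subtractf right_diff_distrib diff_divide_distrib)
    moreover have "(\<Sum>(j, l)\<in>PR. (f t j * f t l - f s j * f s l)\<^sup>2)
        \<le> (\<Sum>(j, l)\<in>PR. (f t j * f t l)\<^sup>2 - (f s j * f s l)\<^sup>2)"
      unfolding case_prod_unfold
      by (intro sum_mono sq_diff_le_diff_sq ff_mono mult_nonneg_nonneg f_nonneg assms)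
    ultimately show "36 / real k * (\<Sum>(j, l)\<in>PR. (f t j * f t l - f s j * f s l)\<^sup>2) \<le> \<mu> t - \<mu> s"
      by (simp add: mult_left_mono divide_right_mono)
  qed (auto simp: case_prod_unfold intro!: sum_nonneg divide_nonneg_nonneg)
  finally show ?thesis .
qed

text \<open>The square of \<open>F t\<close> contains each pair twice, which halves 36 to
  18.\<close>

lemma \<mu>_total: "\<mu> t - \<mu> 0 \<le> 18 / real k * (F t)\<^sup>2"
proof -
  have "(F t)\<^sup>2 = (\<Sum>j\<in>A. ((f t j)\<^sup>2)\<^sup>2) + 2 * (\<Sum>(j, l)\<in>PR. (f t j)\<^sup>2 * (f t l)\<^sup>2)"
    unfolding F_def PR_def by (rule square_sum_pairs[OF finA])
  moreover have "(\<Sum>j\<in>A. ((f t j)\<^sup>2)\<^sup>2) \<ge> 0" by (intro sum_nonneg) simp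
  ultimately have "2 * (\<Sum>(j, l)\<in>PR. (f t j * f t l)\<^sup>2) \<le> (F t)\<^sup>2"
    by (simp add: power_mult_distrib)
  then have "18 / real k * (2 * (\<Sum>(j, l)\<in>PR. (f t j * f t l)\<^sup>2)) \<le> 18 / real k * (F t)\<^sup>2"
    by (intro mult_left_mono) auto
  then show ?thesis by (simp add: \<mu>_def f_0)
qed

text \<open>Markov's inequality for the fourth power of the maximum, with
  \<open>132192 = 408 * 18\<^sup>2\<close>. For \<open>k\<close> of order
  \<open>1 / \<epsilon>\<^sup>2\<close> the bound is a constant, whatever the length of the
  stream.\<close>

lemma tracking:
  assumes "0 < F m" "0 < \<epsilon>"
  shows "measure_pmf.prob D {\<omega>. \<exists>t\<le>m. \<epsilon> * F m < \<bar>X t \<omega>\<bar>} \<le> 132192 / (\<epsilon> ^ 4 * (real k)\<^sup>2)"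
proof -
  define M where "M \<omega> = (MAX u\<in>{0..m}. \<bar>X u \<omega> - X 0 \<omega>\<bar>)" for \<omega>
  have pos: "0 < (\<epsilon> * F m) ^ 4" using assms by simp
  have "{\<omega>. \<exists>t\<le>m. \<epsilon> * F m < \<bar>X t \<omega>\<bar>} \<subseteq> {\<omega> \<in> space (measure_pmf D). (\<epsilon> * F m) ^ 4 \<le> M \<omega> ^ 4}"
  proof clarsimp
    fix \<omega> t assume t: "t \<le> m" "\<epsilon> * F m < \<bar>X t \<omega>\<bar>"
    have "\<bar>X t \<omega>\<bar> \<le> M \<omega>" unfolding M_def using t by (intro Max_ge) (auto simp: X_0)
    then show "(\<epsilon> * F m) ^ 4 \<le> M \<omega> ^ 4" using t assms by (intro power_mono) auto
  qed
  then have "measure_pmf.prob D {\<omega>. \<exists>t\<le>m. \<epsilon> * F m < \<bar>X t \<omega>\<bar>}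
      \<le> measure_pmf.prob D {\<omega> \<in> space (measure_pmf D). (\<epsilon> * F m) ^ 4 \<le> M \<omega> ^ 4}"
    by (intro measure_pmf.finite_measure_mono) auto
  also have "\<dots> \<le> E (\<lambda>\<omega>. M \<omega> ^ 4) / (\<epsilon> * F m) ^ 4"
    using pos by (intro integral_Markov_inequality_measure[where A = "{}"] integrable_D) auto
  also have "\<dots> \<le> (132192 / (real k)\<^sup>2 * F m ^ 4) / (\<epsilon> * F m) ^ 4"
  proof (intro divide_right_mono)
    have "E (\<lambda>\<omega>. M \<omega> ^ 4) \<le> 408 * (\<mu> m - \<mu> 0)\<^sup>2"
      unfolding M_def by (intro maximal_inequality finD \<mu>_mono X_increment) auto
    also have "\<dots> \<le> 408 * (18 / real k * (F m)\<^sup>2)\<^sup>2"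
      using \<mu>_total[of m] \<mu>_mono[of 0 m] by (intro mult_left_mono power_mono) auto
    also have "\<dots> = 132192 / (real k)\<^sup>2 * F m ^ 4"
      by (simp add: power_mult_distrib power_divide power_mult[symmetric])
    finally show "E (\<lambda>\<omega>. M \<omega> ^ 4) \<le> 132192 / (real k)\<^sup>2 * F m ^ 4" .
  qed (use pos in simp)
  also have "\<dots> = 132192 / (\<epsilon> ^ 4 * (real k)\<^sup>2)"
    using assms by (simp add: power_mult_distrib field_simps)
  finally show ?thesis .
qed

end

section \<open>Uniform words and eight-wise independent signs\<close>

lemma replicate_pmf_Suc_pair:
  "replicate_pmf (Suc n) p = map_pmf (\<lambda>(x, xs). x # xs) (pair_pmf p (replicate_pmf n p))"
  by (simp add: pair_pmf_def map_bind_pmf)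

lemma replicate_pmf_add_pair:
  "replicate_pmf (m + n) p = map_pmf (\<lambda>(xs, ys). xs @ ys) (pair_pmf (replicate_pmf m p) (replicate_pmf n p))"
  by (simp add: replicate_pmf_distrib pair_pmf_def map_bind_pmf)

lemma replicate_pmf_map: "replicate_pmf n (map_pmf f p) = map_pmf (map f) (replicate_pmf n p)"
  by (induction n) (simp_all add: map_bind_pmf bind_map_pmf)

lemma finite_set_replicate_pmf: "finite (set_pmf p) \<Longrightarrow> finite (set_pmf (replicate_pmf n p))"
  by (simp add: set_replicate_pmf finite_lists_length_eq lists_eq_set Collect_conj_eq[symmetric])

definition chunks :: "nat \<Rightarrow> nat \<Rightarrow> 'a list \<Rightarrow> 'a list list" where
  "chunks r c xs = map (\<lambda>i. take c (drop (i * c) xs)) [0..<r]"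

lemma length_chunks [simp]: "length (chunks r c xs) = r"
  by (simp add: chunks_def)

lemma chunks_nth:
  assumes "length xs = r * c" "i < r" "j < c"
  shows "chunks r c xs ! i ! j = xs ! (i * c + j)"
proof -
  have "i * c + c \<le> r * c"
    using mult_le_mono1[of "Suc i" r c] assms by simp
  then show ?thesis using assms by (simp add: chunks_def add.commute)
qed

lemma length_chunks_nth:
  assumes "length xs = r * c" "i < r"
  shows "length (chunks r c xs ! i) = c"
proof -
  have "i * c + c \<le> r * c"
    using mult_le_mono1[of "Suc i" r c] assms by simp
  then show ?thesis using assms by (simp add: chunks_def)
qed

lemma chunks_append:
  assumes "length xs = c"
  shows "chunks (Suc r) c (xs @ ys) = xs # chunks r c ys"
  using assms unfolding chunks_def by (simp add: map_upt_Suc del: upt_Suc)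

text \<open>Consecutive blocks of independent words are independent. Three nested uses turn the raw
  memory into groups, rows and coefficients.\<close>

lemma chunks_pmf:
  "map_pmf (chunks r c) (replicate_pmf (r * c) p) = replicate_pmf r (replicate_pmf c p)"
proof (induction r)
  case 0
  then show ?case by (simp add: chunks_def)
next
  case (Suc r)
  have "map_pmf (chunks (Suc r) c) (replicate_pmf (c + r * c) p)
      = map_pmf (\<lambda>(xs, ys). chunks (Suc r) c (xs @ ys)) (pair_pmf (replicate_pmf c p) (replicate_pmf (r * c) p))"
    unfolding replicate_pmf_add_pair by (simp add: pmf.map_comp o_def case_prod_unfold)
  also have "\<dots> = map_pmf (\<lambda>(xs, ys). xs # chunks r c ys) (pair_pmf (replicate_pmf c p) (replicate_pmf (r * c) p))"
    by (intro map_pmf_cong refl) (auto simp: chunks_append set_replicate_pmf)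
  also have "\<dots> = map_pmf (\<lambda>(x, xs). x # xs)
      (pair_pmf (replicate_pmf c p) (map_pmf (chunks r c) (replicate_pmf (r * c) p)))"
    by (simp add: pair_map_pmf2 pmf.map_comp o_def case_prod_unfold)
  also have "\<dots> = replicate_pmf (Suc r) (replicate_pmf c p)"
    unfolding Suc replicate_pmf_Suc_pair by simp
  finally show ?case by simp
qed

lemma pmf_pair_eq: "pmf (pair_pmf p q) z = pmf p (fst z) * pmf q (snd z)"
  by (cases z) (simp add: pmf_pair)

lemma expectation_pair_prod:
  fixes f :: "'a \<Rightarrow> real" and g :: "'b \<Rightarrow> real"
  assumes "finite (set_pmf p)" "finite (set_pmf q)"
  shows "measure_pmf.expectation (pair_pmf p q) (\<lambda>(x, y). f x * g y)
    = measure_pmf.expectation p f * measure_pmf.expectation q g"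
proof -
  have "measure_pmf.expectation (pair_pmf p q) (\<lambda>(x, y). f x * g y)
      = (\<Sum>z\<in>set_pmf p \<times> set_pmf q. pmf (pair_pmf p q) z * (case z of (x, y) \<Rightarrow> f x * g y))"
    using assms by (subst integral_measure_pmf[of "set_pmf p \<times> set_pmf q"]) auto
  also have "\<dots> = (\<Sum>x\<in>set_pmf p. pmf p x * f x) * (\<Sum>y\<in>set_pmf q. pmf q y * g y)"
    by (simp add: sum_product sum.cartesian_product case_prod_unfold pmf_pair_eq algebra_simps)
  also have "(\<Sum>x\<in>set_pmf p. pmf p x * f x) = measure_pmf.expectation p f"
    using assms by (subst integral_measure_pmf[of "set_pmf p"]) auto
  also have "(\<Sum>x\<in>set_pmf q. pmf q x * g x) = measure_pmf.expectation q g"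
    using assms by (subst integral_measure_pmf[of "set_pmf q"]) auto
  finally show ?thesis .
qed

lemma expectation_replicate_prod:
  fixes f :: "nat \<Rightarrow> 'a \<Rightarrow> real"
  assumes "finite (set_pmf p)"
  shows "measure_pmf.expectation (replicate_pmf r p) (\<lambda>xs. \<Prod>i<r. f i (xs ! i))
    = (\<Prod>i<r. measure_pmf.expectation p (f i))"
proof (induction r arbitrary: f)
  case (Suc r)
  have "measure_pmf.expectation (replicate_pmf (Suc r) p) (\<lambda>xs. \<Prod>i<Suc r. f i (xs ! i))
      = measure_pmf.expectation (pair_pmf p (replicate_pmf r p))
          (\<lambda>(x, xs). f 0 x * (\<Prod>i<r. f (Suc i) (xs ! i)))"
    unfolding replicate_pmf_Suc_pair integral_map_pmf
    by (simp add: prod.lessThan_Suc_shift case_prod_unfold del: prod.lessThan_Suc)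
  also have "\<dots> = measure_pmf.expectation p (f 0) * (\<Prod>i<r. measure_pmf.expectation p (f (Suc i)))"
    unfolding Suc[symmetric] by (intro expectation_pair_prod finite_set_replicate_pmf assms)
  also have "\<dots> = (\<Prod>i<Suc r. measure_pmf.expectation p (f i))"
    by (simp add: prod.lessThan_Suc_shift del: prod.lessThan_Suc)
  finally show ?case .
qed simp

text \<open>Markov's inequality for a product of weights, 16 for a bad and 1 for a good sample. The
  mean weight is at most \<open>1 + 15 / 16 < 2\<close>, while a bad half forces the product up to
  \<open>4 ^ r\<close>. Ties count as failure, so otherwise the good samples are a strict
  majority.\<close>

lemma majority_tail:
  assumes fin: "finite (set_pmf p)" and bad: "measure_pmf.prob p Bad \<le> 1 / 16"
  shows "measure_pmf.prob (replicate_pmf r p) {xs. r \<le> 2 * card {i. i < r \<and> xs ! i \<in> Bad}} \<le> 1 / 2 ^ r"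
proof -
  let ?q = "replicate_pmf r p"
  define f :: "'a \<Rightarrow> real" where "f x = (if x \<in> Bad then 16 else 1)" for x
  have f_eq: "f x = 1 + 15 * indicator Bad x" for x by (simp add: f_def)
  have fq: "finite (set_pmf ?q)" by (rule finite_set_replicate_pmf[OF fin])
  have Ef: "measure_pmf.expectation p f \<le> 2" "0 \<le> measure_pmf.expectation p f"
  proof -
    have "measure_pmf.expectation p f = 1 + 15 * measure_pmf.prob p Bad"
      unfolding f_eq by (simp add: integrable_finite_pmf[OF fin])
    then show "measure_pmf.expectation p f \<le> 2" "0 \<le> measure_pmf.expectation p f"
      using bad by (simp_all add: add_nonneg_nonneg)
  qed
  have prod_f: "(\<Prod>i<r. f (xs ! i)) = 4 ^ (2 * card {i. i < r \<and> xs ! i \<in> Bad})" for xs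
  proof -
    have "(\<Prod>i<r. f (xs ! i)) = (\<Prod>i\<in>{..<r}. if i \<in> {i. i < r \<and> xs ! i \<in> Bad} then 16 else 1)"
      by (intro prod.cong) (auto simp: f_def)
    also have "\<dots> = (\<Prod>i\<in>{..<r} \<inter> {i. i < r \<and> xs ! i \<in> Bad}. 16)"
      by (subst prod.inter_restrict) auto
    also have "{..<r} \<inter> {i. i < r \<and> xs ! i \<in> Bad} = {i. i < r \<and> xs ! i \<in> Bad}" by auto
    finally show ?thesis by (simp add: power_mult)
  qed
  have "measure_pmf.prob ?q {xs. r \<le> 2 * card {i. i < r \<and> xs ! i \<in> Bad}}
      \<le> measure_pmf.prob ?q {xs \<in> space (measure_pmf ?q). 4 ^ r \<le> (\<Prod>i<r. f (xs ! i))}"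
    unfolding prod_f by (intro measure_pmf.finite_measure_mono) (auto intro: power_increasing)
  also have "\<dots> \<le> measure_pmf.expectation ?q (\<lambda>xs. \<Prod>i<r. f (xs ! i)) / 4 ^ r"
    by (intro integral_Markov_inequality_measure[where A = "{}"] integrable_finite_pmf fq)
      (auto simp: f_def intro!: prod_nonneg)
  also have "\<dots> = measure_pmf.expectation p f ^ r / 4 ^ r"
    using expectation_replicate_prod[OF fin, of r "\<lambda>_. f"] by simp
  also have "\<dots> \<le> 2 ^ r / 4 ^ r"
    using Ef by (intro divide_right_mono power_mono) auto
  also have "\<dots> = 1 / 2 ^ r" by (simp add: power_divide[symmetric] power_one_over)
  finally show ?thesis .
qed

section \<open>Exactly uniform residues and their translations\<close>

lemma pair_pmf_of_set:
  assumes "finite A" "A \<noteq> {}" "finite B" "B \<noteq> {}"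
  shows "pair_pmf (pmf_of_set A) (pmf_of_set B) = pmf_of_set (A \<times> B)"
  using assms by (intro pmf_eqI) (auto simp: pmf_pair_eq indicator_def card_cartesian_product)

lemma horner_pmf:
  assumes "0 < (B::nat)"
  shows "map_pmf (horner_sum id B) (replicate_pmf L (pmf_of_set {..<B})) = pmf_of_set {..<B ^ L}"
proof (induction L)
  case 0
  have "{..<B ^ 0} = {0}" by auto
  then show ?case by (simp add: pmf_of_set_singleton)
next
  case (Suc L)
  let ?h = "\<lambda>(x, y). x + B * y"
  have ne: "{..<B} \<noteq> {}" "{..<B ^ L} \<noteq> {}" using assms by (auto simp: lessThan_empty_iff)
  have inj: "inj_on ?h ({..<B} \<times> {..<B ^ L})"
  proof (rule inj_onI, clarsimp)
    fix x y x' y' assume *: "x < B" "x' < B" "x + B * y = x' + B * y'"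
    then have "(x + B * y) mod B = (x' + B * y') mod B" "(x + B * y) div B = (x' + B * y') div B" by auto
    then show "x = x' \<and> y = y'" using *(1,2) by simp
  qed
  have img: "?h ` ({..<B} \<times> {..<B ^ L}) = {..<B ^ Suc L}"
  proof (intro equalityI subsetI)
    fix z assume "z \<in> ?h ` ({..<B} \<times> {..<B ^ L})"
    then obtain x y where "z = x + B * y" "x < B" "y < B ^ L" by auto
    moreover from this have "B * Suc y \<le> B * B ^ L" by (intro mult_le_mono) auto
    ultimately show "z \<in> {..<B ^ Suc L}" by simp
  next
    fix z assume "z \<in> {..<B ^ Suc L}"
    then have "z mod B < B" "z div B < B ^ L" using assms by (auto simp: less_mult_imp_div_less mult.commute)
    then show "z \<in> ?h ` ({..<B} \<times> {..<B ^ L})" by (intro image_eqI[of _ _ "(z mod B, z div B)"]) auto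
  qed
  have "map_pmf (horner_sum id B) (replicate_pmf (Suc L) (pmf_of_set {..<B}))
      = map_pmf ?h (pair_pmf (pmf_of_set {..<B}) (map_pmf (horner_sum id B) (replicate_pmf L (pmf_of_set {..<B}))))"
    unfolding replicate_pmf_Suc_pair by (simp add: pair_map_pmf2 pmf.map_comp o_def case_prod_unfold)
  also have "\<dots> = map_pmf ?h (pmf_of_set ({..<B} \<times> {..<B ^ L}))"
    unfolding Suc using ne by (subst pair_pmf_of_set) auto
  also have "\<dots> = pmf_of_set {..<B ^ Suc L}"
    using inj ne by (subst map_pmf_of_set_inj) (auto simp: img simp del: power_Suc)
  finally show ?case .
qed

lemma translate_pmf:
  assumes "0 < (Q::nat)"
  shows "map_pmf (\<lambda>x. (x + b) mod Q) (pmf_of_set {..<Q}) = pmf_of_set {..<Q}"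
proof -
  have inj: "inj_on (\<lambda>x. (x + b) mod Q) {..<Q}"
  proof (rule inj_onI)
    fix x y assume *: "x \<in> {..<Q}" "y \<in> {..<Q}" "(x + b) mod Q = (y + b) mod Q"
    then have "\<exists>q1 q2. x + Q * q1 = y + Q * q2" unfolding nat_mod_eq_iff by (simp add: add.commute add.left_commute)
    then have "x mod Q = y mod Q" unfolding nat_mod_eq_iff .
    then show "x = y" using * by simp
  qed
  moreover have "(\<lambda>x. (x + b) mod Q) ` {..<Q} = {..<Q}"
    using assms inj by (intro endo_inj_surj) auto
  ultimately show ?thesis using assms by (subst map_pmf_of_set_inj) (auto simp: lessThan_empty_iff)
qed

text \<open>Adds the polynomial with coefficients \<open>bs\<close> to the one with coefficients
  \<open>cs\<close>; this is the measure-preserving map behind the sign flip.\<close>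

definition shift :: "nat \<Rightarrow> nat list \<Rightarrow> nat list \<Rightarrow> nat list" where
  "shift Q bs cs = map2 (\<lambda>b c. (c + b) mod Q) bs cs"

lemma shift_pmf:
  assumes "0 < Q"
  shows "map_pmf (shift Q bs) (replicate_pmf (length bs) (pmf_of_set {..<Q}))
    = replicate_pmf (length bs) (pmf_of_set {..<Q})"
proof (induction bs)
  case Nil
  then show ?case by (simp add: shift_def)
next
  case (Cons b bs)
  let ?u = "pmf_of_set {..<Q}"
  have "map_pmf (shift Q (b # bs)) (replicate_pmf (Suc (length bs)) ?u)
    = map_pmf (\<lambda>(x, xs). x # xs) (map_pmf (\<lambda>(x, xs). ((x + b) mod Q, shift Q bs xs))
        (pair_pmf ?u (replicate_pmf (length bs) ?u)))"
    unfolding replicate_pmf_Suc_pair by (simp add: pmf.map_comp o_def case_prod_unfold shift_def)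
  also have "map_pmf (\<lambda>(x, xs). ((x + b) mod Q, shift Q bs xs)) (pair_pmf ?u (replicate_pmf (length bs) ?u))
    = pair_pmf (map_pmf (\<lambda>x. (x + b) mod Q) ?u) (map_pmf (shift Q bs) (replicate_pmf (length bs) ?u))"
    by (simp add: pair_map_pmf1 pair_map_pmf2 pmf.map_comp o_def case_prod_unfold)
  also have "\<dots> = pair_pmf ?u (replicate_pmf (length bs) ?u)"
    unfolding Cons translate_pmf[OF assms] by simp
  finally show ?case by (simp only: replicate_pmf_Suc_pair list.size add_0_right plus_1_eq_Suc add_Suc_right)
qed


section \<open>Eight-wise independence of polynomial signs modulo a power of two\<close>

definition hash_sign :: "nat \<Rightarrow> nat list \<Rightarrow> nat \<Rightarrow> int" where
  "hash_sign w cs x = (if horner_sum id x cs mod 2 ^ (8 * w) < 2 ^ (8 * w - 1) then 1 else - 1)"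

lemma hash_sign_sq: "hash_sign w cs x * hash_sign w cs x = 1"
  by (simp add: hash_sign_def)

lemma horner_shift:
  "length bs = length cs \<Longrightarrow>
    horner_sum id x (shift Q bs cs) mod Q = (horner_sum id x cs + horner_sum id x bs) mod Q"
proof (induction bs cs rule: list_induct2)
  case (Cons b bs c cs)
  have mul: "(a + x * (h mod Q)) mod Q = (a + x * h) mod Q" for a h
    by (metis mod_add_right_eq mod_mult_right_eq)
  have "horner_sum id x (shift Q (b # bs) (c # cs)) mod Q
      = ((c + b) mod Q + x * (horner_sum id x (shift Q bs cs) mod Q)) mod Q"
    unfolding mul by (simp add: shift_def mod_simps)
  also have "\<dots> = ((c + b) + x * (horner_sum id x cs + horner_sum id x bs)) mod Q"
    unfolding Cons mul by (simp add: mod_simps)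
  also have "(c + b) + x * (horner_sum id x cs + horner_sum id x bs)
      = horner_sum id x (c # cs) + horner_sum id x (b # bs)"
    by (simp add: algebra_simps)
  finally show ?case .
qed (simp add: shift_def)

text \<open>Adding half of the modulus to a residue flips its top bit, with or without
  wraparound.\<close>

lemma hash_sign_flip:
  assumes "length bs = length cs" "1 \<le> w" "horner_sum id x bs mod 2 ^ (8 * w) = 2 ^ (8 * w - 1)"
  shows "hash_sign w (shift (2 ^ (8 * w)) bs cs) x = - hash_sign w cs x"
proof -
  define H :: nat where "H = 2 ^ (8 * w - 1)"
  define v where "v = horner_sum id x cs mod (2 * H)"
  have "0 < H" by (simp add: H_def)
  then have v: "v < 2 * H" by (simp add: v_def)
  have Q: "2 ^ (8 * w) = 2 * H"
    using assms(2) unfolding H_def by (subst power_Suc[symmetric]) (simp add: Suc_diff_Suc)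
  have "horner_sum id x (shift (2 * H) bs cs) mod (2 * H) = (v + H) mod (2 * H)"
    using assms(3) unfolding horner_shift[OF assms(1)] Q v_def H_def[symmetric]
    by (metis mod_add_eq mod_mod_trivial)
  also have "\<dots> = (if v < H then v + H else v - H)"
    using v by (auto simp: mod_if)
  finally show ?thesis
    unfolding hash_sign_def Q H_def[symmetric] v_def[symmetric] using v by auto
qed

lemma hash_sign_same:
  assumes "length bs = length cs" "horner_sum id x bs mod 2 ^ (8 * w) = 0"
  shows "hash_sign w (shift (2 ^ (8 * w)) bs cs) x = hash_sign w cs x"
proof -
  have "horner_sum id x (shift (2 ^ (8 * w)) bs cs) mod 2 ^ (8 * w) = horner_sum id x cs mod 2 ^ (8 * w)"
    unfolding horner_shift[OF assms(1)] using assms(2) by (metis add_0_right mod_add_right_eq)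
  then show ?thesis by (simp add: hash_sign_def)
qed

text \<open>The polynomial \<open>2 ^ (8 * w - 1 - e) * (\<Prod>x\<in>K. X - x)\<close> vanishes on \<open>K\<close>; at \<open>y\<close> its value modulo
  \<open>2 ^ (8 * w)\<close> is \<open>2 ^ (8 * w - 1)\<close> if \<open>e\<close> is the multiplicity of 2 in \<open>\<Prod>x\<in>K. y - x\<close>, which is at most
  \<open>7 * w\<close>.\<close>

lemma flipping_polynomial:
  fixes K :: "nat set"
  assumes w: "1 \<le> w" and K: "finite K" "K \<subseteq> {..<2 ^ w}" "card K \<le> 7" and y: "y < 2 ^ w" "y \<notin> K"
  shows "\<exists>bs. length bs = 8 \<and> horner_sum id y bs mod 2 ^ (8 * w) = 2 ^ (8 * w - 1)
    \<and> (\<forall>x\<in>K. horner_sum id x bs mod 2 ^ (8 * w) = 0)"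
proof -
  define p :: "int poly" where "p = (\<Prod>x\<in>K. [:- int x, 1:])"
  define v where "v = poly p (int y)"
  define Q :: int where "Q = 2 ^ (8 * w)"
  have deg: "degree p \<le> 7"
  proof -
    have "degree p \<le> (\<Sum>x\<in>K. degree [:- int x, 1:])"
      unfolding p_def using degree_prod_sum_le[OF K(1), of "\<lambda>x. [:- int x, 1:]"] by (simp add: o_def)
    then show ?thesis using K(3) by simp
  qed
  have v: "v = (\<Prod>x\<in>K. int y - int x)" by (simp add: v_def p_def poly_prod)
  have v0: "v \<noteq> 0" using K(1) y(2) by (auto simp: v)
  have "\<bar>v\<bar> \<le> (\<Prod>x\<in>K. 2 ^ w)"
    unfolding v abs_prod
  proof (intro prod_mono conjI)
    fix x assume "x \<in> K"
    then have "x < 2 ^ w" using K by auto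
    then have "int x < 2 ^ w" "int y < 2 ^ w" using y(1) by (metis of_nat_less_iff of_nat_numeral of_nat_power)+
    then show "\<bar>int y - int x\<bar> \<le> 2 ^ w" by linarith
  qed simp
  also have "\<dots> = 2 ^ (w * card K)" by (simp add: power_mult)
  also have "\<dots> \<le> 2 ^ (7 * w)" using K(3) by (intro power_increasing) auto
  finally have v_le: "\<bar>v\<bar> \<le> 2 ^ (7 * w)" .
  define e where "e = multiplicity 2 v"
  obtain u where u: "v = 2 ^ e * u" "odd u"
    using multiplicity_decompose'[of v 2] v0 unfolding e_def by auto
  have "2 ^ e \<le> \<bar>v\<bar>" using u v0 by (simp add: abs_mult mult_le_cancel_left1)
  then have "(2::int) ^ e \<le> 2 ^ (7 * w)" using v_le by linarith
  then have "e \<le> 7 * w" by simp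
  then have e: "e \<le> 8 * w - 1" using w by linarith
  define c :: int where "c = 2 ^ (8 * w - 1 - e)"
  have cv: "c * v = 2 ^ (8 * w - 1) * u"
  proof -
    have "c * 2 ^ e = 2 ^ (8 * w - 1)"
      using e unfolding c_def power_add[symmetric] by simp
    then show ?thesis unfolding u(1) mult.assoc[symmetric] by simp
  qed
  \<comment> \<open>Residues replace integer coefficients that may be negative; eight of them
    suffice for degree 7.\<close>
  define bs where "bs = map (\<lambda>i. nat ((c * coeff p i) mod Q)) [0..<8]"
  have hs: "int (horner_sum id x bs) mod Q = (c * poly p (int x)) mod Q" for x
  proof -
    have "int (horner_sum id x bs) = (\<Sum>i<8. ((c * coeff p i) mod Q) * int x ^ i)"
      unfolding horner_sum_eq_sum by (simp add: bs_def Q_def lessThan_atLeast0)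
    also have "\<dots> mod Q = (\<Sum>i<8. (c * coeff p i) * int x ^ i) mod Q"
      by (metis (mono_tags, lifting) mod_mult_left_eq mod_sum_eq sum.cong)
    also have "(\<Sum>i<8. (c * coeff p i) * int x ^ i) = c * poly p (int x)"
    proof -
      have "poly p (int x) = (\<Sum>i\<le>7. coeff p i * int x ^ i)"
        unfolding poly_altdef using deg by (intro sum.mono_neutral_left) (auto simp: coeff_eq_0)
      moreover have "{..<8::nat} = {..7}" by auto
      ultimately show ?thesis by (simp add: sum_distrib_left mult.assoc)
    qed
    finally show ?thesis .
  qed
  have nat_mod: "int (h mod 2 ^ (8 * w)) = int h mod Q" for h
    by (simp add: Q_def zmod_int)
  \<comment> \<open>An odd multiple of half the modulus is congruent to half the modulus: the part
    \<open>2 * u'\<close> of \<open>u\<close> contributes a multiple of \<open>Q\<close>.\<close>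
  have "Q = 2 ^ (8 * w - 1) * 2"
    using w unfolding Q_def by (subst power_Suc2[symmetric]) (simp add: Suc_diff_Suc)
  moreover obtain u' where "u = 2 * u' + 1" using u(2) by (elim oddE)
  ultimately have "c * v = 2 ^ (8 * w - 1) + Q * u'" "0 \<le> (2::int) ^ (8 * w - 1)" "2 ^ (8 * w - 1) < Q"
    by (simp_all add: cv algebra_simps)
  then have "(c * v) mod Q = 2 ^ (8 * w - 1)" by simp
  then have "int (horner_sum id y bs mod 2 ^ (8 * w)) = int (2 ^ (8 * w - 1))"
    unfolding nat_mod hs v_def by simp
  then have 1: "horner_sum id y bs mod 2 ^ (8 * w) = 2 ^ (8 * w - 1)"
    unfolding of_nat_eq_iff .
  have 2: "horner_sum id x bs mod 2 ^ (8 * w) = 0" if "x \<in> K" for x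
  proof -
    have "poly p (int x) = 0" using that K(1) by (auto simp: p_def poly_prod intro!: prod_zero)
    then have "int (horner_sum id x bs mod 2 ^ (8 * w)) = int 0" unfolding nat_mod hs by simp
    then show ?thesis unfolding of_nat_eq_iff .
  qed
  show ?thesis using 1 2 by (intro exI[of _ bs]) (simp add: bs_def)
qed

definition coeff_pmf :: "nat \<Rightarrow> nat list pmf" where
  "coeff_pmf w = replicate_pmf 8 (pmf_of_set {..<2 ^ (8 * w)})"

lemma finite_coeff_pmf: "finite (set_pmf (coeff_pmf w))"
  unfolding coeff_pmf_def by (intro finite_set_replicate_pmf) (simp add: lessThan_empty_iff)

text \<open>Shifting by the flipping polynomial of one element of \<open>J\<close> preserves the
  distribution and negates the product, so the mean equals its own negative.\<close>

lemma hash_sign_independent: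
  assumes w: "1 \<le> w" and J: "finite J" "J \<subseteq> {..<2 ^ w}" "J \<noteq> {}" "card J \<le> 8"
  shows "measure_pmf.expectation (coeff_pmf w) (\<lambda>cs. \<Prod>x\<in>J. real_of_int (hash_sign w cs x)) = 0"
    (is "measure_pmf.expectation ?D ?f = 0")
proof -
  obtain y where y: "y \<in> J" using J by auto
  define K where "K = J - {y}"
  have K: "finite K" "K \<subseteq> {..<2 ^ w}" "card K \<le> 7" "y < 2 ^ w" "y \<notin> K" "J = insert y K"
    using J y by (auto simp: K_def)
  obtain bs where bs: "length bs = 8" "horner_sum id y bs mod 2 ^ (8 * w) = 2 ^ (8 * w - 1)"
    "\<And>x. x \<in> K \<Longrightarrow> horner_sum id x bs mod 2 ^ (8 * w) = 0"
    using flipping_polynomial[OF w K(1-5)] by blast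
  let ?s = "shift (2 ^ (8 * w)) bs"
  have shift: "map_pmf ?s ?D = ?D"
    using shift_pmf[of "2 ^ (8 * w)" bs] by (simp add: coeff_pmf_def bs(1))
  have flip: "?f (?s cs) = - ?f cs" if "cs \<in> set_pmf ?D" for cs
  proof -
    have len: "length bs = length cs"
      using that bs(1) by (simp add: coeff_pmf_def set_replicate_pmf del: replicate_pmf.simps)
    show ?thesis
      using K by (simp add: hash_sign_flip[OF len w bs(2)] hash_sign_same[OF len bs(3)])
  qed
  have "measure_pmf.expectation ?D ?f = measure_pmf.expectation (map_pmf ?s ?D) ?f"
    by (simp only: shift)
  also have "\<dots> = measure_pmf.expectation ?D (\<lambda>cs. ?f (?s cs))" by simp
  also have "\<dots> = measure_pmf.expectation ?D (\<lambda>cs. - ?f cs)"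
    by (intro integral_cong_AE) (simp_all add: AE_measure_pmf_iff flip)
  also have "\<dots> = - measure_pmf.expectation ?D ?f" by simp
  finally show ?thesis by simp
qed

text \<open>Rows are independent, so the mean factors into one product of signs per row; any row
  that \<open>J\<close> meets has between one and eight of them and contributes the factor
  0.\<close>

lemma row_signs_independent:
  assumes w: "1 \<le> w" and n: "n \<le> 2 ^ w"
    and J: "J \<subseteq> {..<k} \<times> {1..n}" "J \<noteq> {}" "card J \<le> 8"
  shows "measure_pmf.expectation (replicate_pmf k (coeff_pmf w))
    (\<lambda>\<omega>. \<Prod>(i, j)\<in>J. real_of_int (hash_sign w (\<omega> ! i) (j - 1))) = 0"
proof -
  define R where "R i = {j. (i, j) \<in> J}" for i
  have R: "R i \<subseteq> {1..n}" for i using J by (auto simp: R_def)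
  then have finR: "finite (R i)" for i using finite_subset by blast
  have Jeq: "J = Sigma {..<k} R" using J by (auto simp: R_def)
  have finJ: "finite J" using J by (auto intro: finite_subset)
  obtain i0 where i0: "i0 < k" "R i0 \<noteq> {}" using J by (force simp: R_def)
  have "measure_pmf.expectation (replicate_pmf k (coeff_pmf w))
      (\<lambda>\<omega>. \<Prod>(i, j)\<in>J. real_of_int (hash_sign w (\<omega> ! i) (j - 1)))
    = measure_pmf.expectation (replicate_pmf k (coeff_pmf w))
      (\<lambda>\<omega>. \<Prod>i<k. \<Prod>j\<in>R i. real_of_int (hash_sign w (\<omega> ! i) (j - 1)))"
    unfolding Jeq using finR by (subst prod.Sigma) auto
  also have "\<dots> = (\<Prod>i<k. measure_pmf.expectation (coeff_pmf w)
      (\<lambda>cs. \<Prod>j\<in>R i. real_of_int (hash_sign w cs (j - 1))))"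
    by (rule expectation_replicate_prod[OF finite_coeff_pmf])
  also have "\<dots> = 0"
  proof (rule prod_zero)
    \<comment> \<open>Items start at 1; truncated subtraction would identify 0 and 1.\<close>
    have inj: "inj_on (\<lambda>j. j - 1) (R i0)" 
    proof (rule inj_onI)
      fix a b assume "a \<in> R i0" "b \<in> R i0" "a - 1 = b - 1"
      moreover from this have "1 \<le> a" "1 \<le> b" using R[of i0] by auto
      ultimately show "a = b" by simp
    qed
    have "card (R i0) \<le> card J"
      using finJ by (intro card_inj_on_le[of "\<lambda>j. (i0, j)"]) (auto simp: inj_on_def R_def)
    then have "measure_pmf.expectation (coeff_pmf w)
        (\<lambda>cs. \<Prod>x\<in>(\<lambda>j. j - 1) ` R i0. real_of_int (hash_sign w cs x)) = 0"
      using i0 R[of i0] finR J n inj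
      by (intro hash_sign_independent[OF w]) (auto simp: card_image, fastforce)
    then show "\<exists>i\<in>{..<k}. measure_pmf.expectation (coeff_pmf w)
        (\<lambda>cs. \<Prod>j\<in>R i. real_of_int (hash_sign w cs (j - 1))) = 0"
      using i0 inj by (intro bexI[of _ i0]) (simp_all add: prod.reindex)
  qed simp
  finally show ?thesis .
qed

section \<open>Programs on eight-word registers\<close>

primrec loop_free :: "com \<Rightarrow> bool" where
  "loop_free Skip = True"
| "loop_free (Set d e) = True"
| "loop_free (Seq c1 c2) = (loop_free c1 \<and> loop_free c2)"
| "loop_free (If b c1 c2) = (loop_free c1 \<and> loop_free c2)"
| "loop_free (While b c) = False"

primrec run :: "nat \<Rightarrow> com \<Rightarrow> mem \<Rightarrow> mem" where
  "run w Skip M = M"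
| "run w (Set d e) M = M[addr M d := rhs_val w M e]"
| "run w (Seq c1 c2) M = run w c2 (run w c1 M)"
| "run w (If b c1 c2) M = (if val w M b \<noteq> 0 then run w c1 M else run w c2 M)"
| "run w (While b c) M = M"

text \<open>Without loops each command runs at most once, so the code length bounds the time on
  every memory. As storage includes the code, one bound serves for space and time.\<close>

lemma exec_run: "loop_free c \<Longrightarrow> \<exists>k \<le> code_len c. exec w c M k (run w c M)"
proof (induction c arbitrary: M)
  case Skip
  then show ?case by (auto intro: exec.Skip[unfolded One_nat_def])
next
  case (Set d e)
  then show ?case by (auto intro: exec.Set[unfolded One_nat_def])
next
  case (Seq c1 c2)
  from Seq.IH(1)[of M] Seq.prems obtain k1 where k1: "k1 \<le> code_len c1" "exec w c1 M k1 (run w c1 M)" by auto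
  from Seq.IH(2)[of "run w c1 M"] Seq.prems obtain k2
    where "k2 \<le> code_len c2" "exec w c2 (run w c1 M) k2 (run w c2 (run w c1 M))" by auto
  with k1 show ?case by (intro exI[of _ "k1 + k2"]) (auto intro: exec.Seq)
next
  case (If b c1 c2)
  show ?case
  proof (cases "val w M b = 0")
    case True
    from If.IH(2)[of M] If.prems obtain k where "k \<le> code_len c2" "exec w c2 M k (run w c2 M)" by auto
    with True show ?thesis by (intro exI[of _ "Suc k"]) (auto intro: exec.If_False)
  next
    case False
    from If.IH(1)[of M] If.prems obtain k where "k \<le> code_len c1" "exec w c1 M k (run w c1 M)" by auto
    with False show ?thesis by (intro exI[of _ "Suc k"]) (auto intro: exec.If_True)
  qed
qed simp

lemma length_run [simp]: "length (run w c M) = length M"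
  by (induction c arbitrary: M) auto

definition words :: "nat \<Rightarrow> mem \<Rightarrow> bool" where
  "words w M \<longleftrightarrow> (\<forall>x\<in>set M. x < 2 ^ w)"

lemma rd_less: "words w M \<Longrightarrow> rd M a < 2 ^ w"
  by (auto simp: words_def rd_def)

lemma val_less: "words w M \<Longrightarrow> val w M x < 2 ^ w"
  by (cases x) (auto simp: rd_less)

lemma rhs_val_less:
  assumes "words w M" "1 \<le> w"
  shows "rhs_val w M e < 2 ^ w"
proof (cases e)
  case (Shr x y)
  have "drop_bit (val w M y) (val w M x) \<le> val w M x" by (simp add: drop_bit_eq_div)
  then show ?thesis using val_less[OF assms(1), of x] Shr by simp
next
  case (And x y)
  then show ?thesis using val_less[OF assms(1)] by (simp flip: take_bit_nat_eq_self_iff)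
next
  case (Or x y)
  then show ?thesis using val_less[OF assms(1)] by (simp flip: take_bit_nat_eq_self_iff)
next
  case (Xor x y)
  then show ?thesis using val_less[OF assms(1)] by (simp flip: take_bit_nat_eq_self_iff)
qed (use assms(2) val_less[OF assms(1)] one_less_power[of "2::nat" w] in \<open>auto simp: of_bool_def\<close>)

lemma words_update: "words w M \<Longrightarrow> v < 2 ^ w \<Longrightarrow> words w (M[a := v])"
  unfolding words_def using set_update_subset_insert[of M a v] by auto

lemma words_run: "1 \<le> w \<Longrightarrow> words w M \<Longrightarrow> words w (run w c M)"
  by (induction c arbitrary: M) (simp_all add: words_update rhs_val_less del: One_nat_def)

lemma rd_update: "rd (M[a := v]) b = (if a = b \<and> a < length M then v else rd M b)"
  by (simp add: rd_def)

definition seqs :: "com list \<Rightarrow> com" where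
  "seqs cs = foldr Seq cs Skip"

lemma run_seqs [simp]: "run w (seqs []) M = M" "run w (seqs (c # cs)) M = run w (seqs cs) (run w c M)"
  by (simp_all add: seqs_def)

lemma run_seqs_append: "run w (seqs (cs @ ds)) M = run w (seqs ds) (run w (seqs cs) M)"
  by (induction cs arbitrary: M) auto

lemma loop_free_seqs [simp]: "loop_free (seqs cs) \<longleftrightarrow> (\<forall>c\<in>set cs. loop_free c)"
  by (induction cs) (auto simp: seqs_def)

lemma code_len_seqs [simp]: "code_len (seqs cs) = Suc (sum_list (map code_len cs))"
  by (induction cs) (auto simp: seqs_def)

text \<open>Cell 0 holds the item and cells 1 to 3 are scratch; register \<open>r \<ge> 1\<close> is the eight-word number in
  the cells \<open>8 * r, \<dots>, 8 * r + 7\<close>. Register 0 stands for the item.\<close>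

datatype factor = Zero | One | Item
datatype summand = Const nat | Reg nat
datatype prog =
    Nop
  | Then prog prog
  | Mul_Add nat factor summand
  | If_Less nat nat prog prog
  | If_Item nat prog prog

fun factor_val :: "(nat \<Rightarrow> nat) \<Rightarrow> factor \<Rightarrow> nat" where
  "factor_val G Zero = 0"
| "factor_val G One = 1"
| "factor_val G Item = G 0"

fun summand_val :: "(nat \<Rightarrow> nat) \<Rightarrow> summand \<Rightarrow> nat" where
  "summand_val G (Const c) = c"
| "summand_val G (Reg r) = G r"

primrec sem :: "nat \<Rightarrow> prog \<Rightarrow> (nat \<Rightarrow> nat) \<Rightarrow> nat \<Rightarrow> nat" where
  "sem w Nop G = G"
| "sem w (Then p q) G = sem w q (sem w p G)"
| "sem w (Mul_Add r f s) G = G(r := (G r * factor_val G f + summand_val G s) mod 2 ^ (8 * w))"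
| "sem w (If_Less a b p q) G = (if G a < G b then sem w p G else sem w q G)"
| "sem w (If_Item j p q) G = (if G 0 = j mod 2 ^ w then sem w p G else sem w q G)"

text \<open>A source register must differ from the target, whose digits are overwritten before the
  addend is read. Register 0 is excluded because its cells hold the item and the scratch
  words.\<close>

primrec valid :: "nat \<Rightarrow> prog \<Rightarrow> bool" where
  "valid N Nop = True"
| "valid N (Then p q) = (valid N p \<and> valid N q)"
| "valid N (Mul_Add r f s) = (1 \<le> r \<and> r \<le> N \<and> (\<forall>r'. s = Reg r' \<longrightarrow> 1 \<le> r' \<and> r' \<noteq> r))"
| "valid N (If_Less a b p q) = (1 \<le> a \<and> 1 \<le> b \<and> valid N p \<and> valid N q)"
| "valid N (If_Item j p q) = (valid N p \<and> valid N q)"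

primrec prog_len :: "prog \<Rightarrow> nat" where
  "prog_len Nop = 1"
| "prog_len (Then p q) = prog_len p + prog_len q"
| "prog_len (Mul_Add r f s) = 1"
| "prog_len (If_Less a b p q) = Suc (prog_len p + prog_len q)"
| "prog_len (If_Item j p q) = Suc (prog_len p + prog_len q)"

fun factor_opnd :: "factor \<Rightarrow> opnd" where
  "factor_opnd Zero = Imm 0"
| "factor_opnd One = Imm 1"
| "factor_opnd Item = Cell 0"

fun summand_opnd :: "nat \<Rightarrow> summand \<Rightarrow> nat \<Rightarrow> opnd" where
  "summand_opnd w (Const c) i = Imm (c div 2 ^ (w * i) mod 2 ^ w)"
| "summand_opnd w (Reg r) i = Cell (8 * r + i)"

text \<open>Cell 1 is the carry; \<open>d * x + a + carry\<close> fits into two words.\<close>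

definition mul_add_digit :: "nat \<Rightarrow> opnd \<Rightarrow> opnd \<Rightarrow> com" where
  "mul_add_digit d x a = seqs
    [Set (To_Cell 2) (Mul_Hi (Cell d) x), Set (To_Cell d) (Mul (Cell d) x),
     Set (To_Cell d) (Add (Cell d) (Cell 1)), Set (To_Cell 3) (Less (Cell d) (Cell 1)),
     Set (To_Cell 2) (Add (Cell 2) (Cell 3)),
     Set (To_Cell d) (Add (Cell d) a), Set (To_Cell 3) (Less (Cell d) a),
     Set (To_Cell 1) (Add (Cell 2) (Cell 3))]"

text \<open>Digits are visited from the least significant one; a differing pair overrides the
  verdict in cell 1 and an equal pair keeps it, so the highest difference decides.\<close>

definition less_digit :: "nat \<Rightarrow> nat \<Rightarrow> com" where
  "less_digit a b = seqs
    [Set (To_Cell 2) (Equal (Cell a) (Cell b)), If (Cell 2) Skip (Set (To_Cell 1) (Less (Cell a) (Cell b)))]"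

primrec compile :: "nat \<Rightarrow> prog \<Rightarrow> com" where
  "compile w Nop = Skip"
| "compile w (Then p q) = Seq (compile w p) (compile w q)"
| "compile w (Mul_Add r f s) = Seq (Set (To_Cell 1) (Val (Imm 0)))
    (seqs (map (\<lambda>i. mul_add_digit (8 * r + i) (factor_opnd f) (summand_opnd w s i)) [0..<8]))"
| "compile w (If_Less a b p q) = Seq (Set (To_Cell 1) (Val (Imm 0)))
    (Seq (seqs (map (\<lambda>i. less_digit (8 * a + i) (8 * b + i)) [0..<8]))
      (If (Cell 1) (compile w p) (compile w q)))"
| "compile w (If_Item j p q) = Seq (Set (To_Cell 1) (Equal (Cell 0) (Imm j)))
    (If (Cell 1) (compile w p) (compile w q))"

lemma loop_free_compile: "loop_free (compile w p)"
  by (induction p) (auto simp: mul_add_digit_def less_digit_def)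

text \<open>The largest overhead is that of \<open>Mul_Add\<close>, 74 commands: eight digits of
  nine each, a final \<open>Skip\<close>, and the clearing of the carry.\<close>

lemma code_len_compile: "code_len (compile w p) \<le> 80 * prog_len p"
  by (induction p) (auto simp: mul_add_digit_def less_digit_def o_def sum_list_triv)

section \<open>Correctness of the eight-word arithmetic\<close>

definition reg :: "nat \<Rightarrow> mem \<Rightarrow> nat \<Rightarrow> nat" where
  "reg w M r = (\<Sum>i<8. rd M (8 * r + i) * (2 ^ w) ^ i)"

definition regs :: "nat \<Rightarrow> mem \<Rightarrow> nat \<Rightarrow> nat" where
  "regs w M r = (if r = 0 then rd M 0 else reg w M r)"

lemma digits_less:
  assumes "\<And>i. i < n \<Longrightarrow> f i < (B::nat)"
  shows "(\<Sum>i<n. f i * B ^ i) < B ^ n"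
  using assms
proof (induction n)
  case (Suc n)
  have "(\<Sum>i<n. f i * B ^ i) < B ^ n" using Suc by simp
  moreover have "Suc (f n) * B ^ n \<le> B * B ^ n" using Suc.prems[of n] by (intro mult_le_mono1) simp
  ultimately show ?case by simp
qed simp

lemma reg_less: "words w M \<Longrightarrow> reg w M r < 2 ^ (8 * w)"
  using digits_less[of 8 "\<lambda>i. rd M (8 * r + i)" "2 ^ w"] rd_less[of w M]
  by (simp add: reg_def power_mult[symmetric] mult.commute)

text \<open>A modular sum of two words has wrapped exactly if it is below a summand; hence
  \<open>Less\<close> yields the carry.\<close>

lemma add_carry:
  fixes a c B :: nat
  assumes "a < B" "c < B"
  shows "(a + c) mod B + B * of_bool ((a + c) mod B < c) = a + c"
  using assms by (auto simp: mod_if)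

text \<open>Operands that survive the writing of the digit \<open>d\<close> (at least 8) and of the
  scratch cells.\<close>

definition plain :: "nat \<Rightarrow> opnd \<Rightarrow> bool" where
  "plain d a \<longleftrightarrow> (\<exists>k. a = Imm k) \<or> a = Cell 0 \<or> (\<exists>e. a = Cell e \<and> 8 \<le> e \<and> e \<noteq> d)"

lemma mul_add_digit:
  assumes M: "words w M" "1 \<le> w" and d: "8 \<le> d" "d < length M"
    and x: "plain d x" and a: "plain d a"
  defines "M' \<equiv> run w (mul_add_digit d x a) M"
  shows "rd M' d + 2 ^ w * rd M' 1 = rd M d * val w M x + val w M a + rd M 1"
    and "\<And>e. e \<notin> {1, 2, 3, d} \<Longrightarrow> rd M' e = rd M e"
proof -
  define B :: nat where "B = 2 ^ w"
  define r c u v where "r = rd M d" and "c = rd M 1" and "u = val w M x" and "v = val w M a"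
  have lt: "r < B" "c < B" "u < B" "v < B"
    using rd_less[OF M(1)] val_less[OF M(1)] by (auto simp: B_def r_def c_def u_def v_def)
  define hi lo where "hi = r * u div B" and "lo = r * u mod B"
  define s1 where "s1 = (lo + c) mod B"
  define f1 :: nat where "f1 = of_bool (s1 < c)"
  define s2 where "s2 = (s1 + v) mod B"
  define f2 :: nat where "f2 = of_bool (s2 < v)"
  have B0: "0 < B" by (simp add: B_def)
  have hl: "r * u = lo + B * hi" by (simp add: hi_def lo_def)
  have "lo < B" "s1 < B" using B0 by (simp_all add: lo_def s1_def)
  then have e1: "s1 + B * f1 = lo + c" and e2: "s2 + B * f2 = s1 + v"
    unfolding s1_def f1_def s2_def f2_def using lt add_carry by auto
  have total: "s2 + B * (hi + f1 + f2) = r * u + v + c"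
    using hl e1 e2 by (simp add: algebra_simps)
  \<comment> \<open>Since \<open>(B - 1)\<^sup>2 + 2 * (B - 1) = B\<^sup>2 - 1\<close>, the new
    carry is a single word, and the additions that form it do not wrap.\<close>
  have "r * u \<le> (B - 1) * (B - 1)" using lt by (intro mult_le_mono) auto
  moreover have "(B - 1) * (B - 1) + (B - 1) + (B - 1) < B * B"
    using B0 by (cases B) auto
  ultimately have "r * u + v + c < B * B" using lt by linarith
  then have "B * (hi + f1 + f2) < B * B" using total by linarith
  then have hi_lt: "hi + f1 + f2 < B" by simp
  have "val w (M[i := z]) x = val w M x" "val w (M[i := z]) a = val w M a" if "i \<in> {1, 2, 3, d}" for i z M
    using that x a d by (auto simp: plain_def rd_update)
  then have upd: "val w (M[i := z]) x = val w M x" "val w (M[i := z]) a = val w M a"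
    if "i = Suc 0 \<or> i = 2 \<or> i = 3 \<or> i = d" for i z M
    using that by auto
  have len: "Suc 0 < length M" "2 < length M" "3 < length M" using d by auto
  have tb: "take_bit w y = y mod B" "drop_bit w y = y div B" for y :: nat
    by (simp_all add: take_bit_eq_mod drop_bit_eq_div B_def)
  have M': "M' = M[2 := hi, d := lo, d := s1, 3 := f1, 2 := hi + f1, d := s2, 3 := f2, 1 := hi + f1 + f2]"
  proof -
    have 1: "run w (Set (To_Cell 2) (Mul_Hi (Cell d) x)) M = M[2 := hi]"
      using hi_lt by (simp add: tb hi_def r_def u_def)
    define M1 where "M1 = M[2 := hi]"
    have 2: "run w (Set (To_Cell d) (Mul (Cell d) x)) M1 = M1[d := lo]"
      using d by (simp add: M1_def tb rd_update upd lo_def r_def u_def)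
    define M2 where "M2 = M1[d := lo]"
    have 3: "run w (Set (To_Cell d) (Add (Cell d) (Cell 1))) M2 = M2[d := s1]"
      using d by (simp add: M1_def M2_def tb rd_update s1_def c_def)
    define M3 where "M3 = M2[d := s1]"
    have 4: "run w (Set (To_Cell 3) (Less (Cell d) (Cell 1))) M3 = M3[3 := f1]"
      using d by (simp add: M1_def M2_def M3_def rd_update f1_def c_def)
    define M4 where "M4 = M3[3 := f1]"
    have 5: "run w (Set (To_Cell 2) (Add (Cell 2) (Cell 3))) M4 = M4[2 := hi + f1]"
      using d len hi_lt by (simp add: M1_def M2_def M3_def M4_def tb rd_update)
    define M5 where "M5 = M4[2 := hi + f1]"
    have 6: "run w (Set (To_Cell d) (Add (Cell d) a)) M5 = M5[d := s2]"
      using d by (simp add: M1_def M2_def M3_def M4_def M5_def tb rd_update upd s2_def v_def)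
    define M6 where "M6 = M5[d := s2]"
    have 7: "run w (Set (To_Cell 3) (Less (Cell d) a)) M6 = M6[3 := f2]"
      using d by (simp add: M1_def M2_def M3_def M4_def M5_def M6_def rd_update upd f2_def v_def)
    define M7 where "M7 = M6[3 := f2]"
    have 8: "run w (Set (To_Cell 1) (Add (Cell 2) (Cell 3))) M7 = M7[1 := hi + f1 + f2]"
      using d len hi_lt by (simp add: M1_def M2_def M3_def M4_def M5_def M6_def M7_def tb rd_update)
    show ?thesis
      unfolding M'_def mul_add_digit_def run_seqs 1 M1_def[symmetric] 2 M2_def[symmetric]
        3 M3_def[symmetric] 4 M4_def[symmetric] 5 M5_def[symmetric] 6 M6_def[symmetric]
        7 M7_def[symmetric] 8 ..
  qed
  have "rd M' d = s2" "rd M' 1 = hi + f1 + f2"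
    unfolding M' using d len by (simp_all add: rd_update)
  then show "rd M' d + 2 ^ w * rd M' 1 = rd M d * val w M x + val w M a + rd M 1"
    using total by (simp add: B_def r_def u_def v_def c_def)
  show "rd M' e = rd M e" if "e \<notin> {1, 2, 3, d}" for e
    unfolding M' using that by (simp add: rd_update)
qed

text \<open>Schoolbook multiplication by one word. The invariant is exact: the pending carry stands
  at weight \<open>(2 ^ w) ^ n\<close>, and nothing is reduced before all eight digits are
  done.\<close>

lemma mul_add_digits:
  assumes M: "words w M" "1 \<le> w" and r: "1 \<le> r" "8 * r + 7 < length M" and n: "n \<le> 8"
    and x: "plain 0 x" "\<nexists>e. x = Cell (Suc e)" and a: "\<And>i. plain 0 (a i)"
    and ar: "\<And>i j. i < 8 \<Longrightarrow> j < 8 \<Longrightarrow> a i \<noteq> Cell (8 * r + j)"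
  defines "M' \<equiv> run w (seqs (map (\<lambda>i. mul_add_digit (8 * r + i) x (a i)) [0..<n])) M"
  shows "(\<Sum>i<n. rd M' (8 * r + i) * (2 ^ w) ^ i) + (2 ^ w) ^ n * rd M' 1
      = (\<Sum>i<n. rd M (8 * r + i) * (2 ^ w) ^ i) * val w M x + (\<Sum>i<n. val w M (a i) * (2 ^ w) ^ i) + rd M 1
    \<and> (\<forall>e. e \<notin> {1, 2, 3} \<union> {8 * r..<8 * r + n} \<longrightarrow> rd M' e = rd M e)"
  using n unfolding M'_def
proof (induction n)
  case (Suc n)
  let ?B = "2 ^ w :: nat"
  define M1 where "M1 = run w (seqs (map (\<lambda>i. mul_add_digit (8 * r + i) x (a i)) [0..<n])) M"
  define M2 where "M2 = run w (mul_add_digit (8 * r + n) x (a n)) M1"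
  have IH: "(\<Sum>i<n. rd M1 (8 * r + i) * ?B ^ i) + ?B ^ n * rd M1 1
      = (\<Sum>i<n. rd M (8 * r + i) * ?B ^ i) * val w M x + (\<Sum>i<n. val w M (a i) * ?B ^ i) + rd M 1"
    and keep: "\<And>e. e \<notin> {1, 2, 3} \<union> {8 * r..<8 * r + n} \<Longrightarrow> rd M1 e = rd M e"
    using Suc unfolding M1_def by auto
  have px: "plain (8 * r + n) x" using x(1) unfolding plain_def using x(2) by (metis Suc_le_D numeral_eq_Suc)
  have pa: "plain (8 * r + n) (a n)" using a[of n] ar[of n n] Suc.prems unfolding plain_def by auto
  have M1: "words w M1" "8 * r + n < length M1"
    using r Suc.prems words_run[OF M(2,1)] by (auto simp: M1_def)
  have step: "rd M2 (8 * r + n) + ?B * rd M2 1 = rd M1 (8 * r + n) * val w M1 x + val w M1 (a n) + rd M1 1"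
    and keep2: "\<And>e. e \<notin> {1, 2, 3, 8 * r + n} \<Longrightarrow> rd M2 e = rd M1 e"
    unfolding M2_def using mul_add_digit[OF M1(1) M(2) _ M1(2) px pa] r by auto
  have vx: "val w M1 x = val w M x"
  proof -
    have "(\<exists>k. x = Imm k) \<or> x = Cell 0" using x unfolding plain_def by (metis Suc_le_D numeral_eq_Suc)
    then show ?thesis using keep[of 0] r by auto
  qed
  have va: "val w M1 (a n) = val w M (a n)"
  proof -
    consider k where "a n = Imm k" | "a n = Cell 0" | e where "a n = Cell e" "8 \<le> e"
      using a[of n] unfolding plain_def by blast
    then show ?thesis
    proof cases
      case 3
      have "e \<notin> {8 * r..<8 * r + n}"
      proof
        assume "e \<in> {8 * r..<8 * r + n}"
        then have "a n = Cell (8 * r + (e - 8 * r))" "e - 8 * r < 8" using 3 Suc.prems by auto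
        then show False using ar[of n] Suc.prems by auto
      qed
      then show ?thesis using 3 by (simp add: keep)
    qed (use keep[of 0] r in auto)
  qed
  have rn: "rd M1 (8 * r + n) = rd M (8 * r + n)" using r by (intro keep) auto
  have low: "(\<Sum>i<n. rd M2 (8 * r + i) * ?B ^ i) = (\<Sum>i<n. rd M1 (8 * r + i) * ?B ^ i)"
    using r by (intro sum.cong refl arg_cong2[where f = "(*)"] keep2) auto
  have "(\<Sum>i<Suc n. rd M2 (8 * r + i) * ?B ^ i) + ?B ^ Suc n * rd M2 1
      = (\<Sum>i<n. rd M1 (8 * r + i) * ?B ^ i) + ?B ^ n * (rd M2 (8 * r + n) + ?B * rd M2 1)"
    unfolding sum.lessThan_Suc low by (simp add: algebra_simps)
  also have "\<dots> = ((\<Sum>i<n. rd M1 (8 * r + i) * ?B ^ i) + ?B ^ n * rd M1 1)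
      + ?B ^ n * (rd M (8 * r + n) * val w M x + val w M (a n))"
    unfolding step vx va rn by (simp add: algebra_simps)
  also have "\<dots> = (\<Sum>i<Suc n. rd M (8 * r + i) * ?B ^ i) * val w M x
      + (\<Sum>i<Suc n. val w M (a i) * ?B ^ i) + rd M 1"
    unfolding IH by (simp add: algebra_simps)
  finally have "(\<Sum>i<Suc n. rd M2 (8 * r + i) * ?B ^ i) + ?B ^ Suc n * rd M2 1 = \<dots>" .
  moreover have "rd M2 e = rd M e" if "e \<notin> {1, 2, 3} \<union> {8 * r..<8 * r + Suc n}" for e
    using that keep2[of e] keep[of e] by auto
  moreover have "run w (seqs (map (\<lambda>i. mul_add_digit (8 * r + i) x (a i)) [0..<Suc n])) M = M2"
    by (simp add: run_seqs_append M1_def M2_def)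
  ultimately show ?case by simp
qed simp

lemma less_digits:
  fixes n :: nat
  assumes M: "words w M" and len: "2 < length M" and a: "1 \<le> a" and b: "1 \<le> b"
    and one: "rd M 1 = 0"
  defines "M' \<equiv> run w (seqs (map (\<lambda>i. less_digit (8 * a + i) (8 * b + i)) [0..<n])) M"
  shows "rd M' 1 = of_bool ((\<Sum>i<n. rd M (8 * a + i) * (2 ^ w) ^ i) < (\<Sum>i<n. rd M (8 * b + i) * (2 ^ w) ^ i))
    \<and> (\<forall>e. e \<notin> {1, 2} \<longrightarrow> rd M' e = rd M e)"
  unfolding M'_def
proof (induction n)
  case 0
  then show ?case using one by simp
next
  case (Suc n)
  let ?B = "2 ^ w :: nat"
  define M1 where "M1 = run w (seqs (map (\<lambda>i. less_digit (8 * a + i) (8 * b + i)) [0..<n])) M"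
  define M2 where "M2 = run w (less_digit (8 * a + n) (8 * b + n)) M1"
  define x y where "x = rd M (8 * a + n)" and "y = rd M (8 * b + n)"
  define u v where "u = (\<Sum>i<n. rd M (8 * a + i) * ?B ^ i)" and "v = (\<Sum>i<n. rd M (8 * b + i) * ?B ^ i)"
  have uv: "u < ?B ^ n" "v < ?B ^ n"
    unfolding u_def v_def by (intro digits_less rd_less M)+
  have IH: "rd M1 1 = of_bool (u < v)" and keep: "\<And>e. e \<notin> {1, 2} \<Longrightarrow> rd M1 e = rd M e"
    using Suc unfolding M1_def u_def v_def by auto
  have len1: "2 < length M1" using len by (simp add: M1_def)
  have xy: "rd M1 (8 * a + n) = x" "rd M1 (8 * b + n) = y"
    using a b by (simp_all add: keep x_def y_def)
  have M2: "M2 = (if x = y then M1[2 := 1] else M1[2 := 0, 1 := of_bool (x < y)])"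
    unfolding M2_def less_digit_def using a b len1 by (simp add: rd_update xy)
  have "rd M2 1 = (if x = y then of_bool (u < v) else of_bool (x < y))"
    using len1 IH by (simp add: M2 rd_update)
  also have "\<dots> = of_bool (u + x * ?B ^ n < v + y * ?B ^ n)"
  proof -
    consider "x = y" | "x < y" | "y < x" by linarith
    then show ?thesis
    proof cases
      case 2
      then have "Suc x * ?B ^ n \<le> y * ?B ^ n" by (intro mult_le_mono1) simp
      then have "u + x * ?B ^ n < v + y * ?B ^ n" using uv by simp
      then show ?thesis using 2 by simp
    next
      case 3
      then have "Suc y * ?B ^ n \<le> x * ?B ^ n" by (intro mult_le_mono1) simp
      then have "\<not> u + x * ?B ^ n < v + y * ?B ^ n" using uv by simp
      then show ?thesis using 3 by simp
    qed simp
  qed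
  finally have "rd M2 1 = of_bool ((\<Sum>i<Suc n. rd M (8 * a + i) * ?B ^ i) < (\<Sum>i<Suc n. rd M (8 * b + i) * ?B ^ i))"
    by (simp add: u_def v_def x_def y_def)
  moreover have "rd M2 e = rd M e" if "e \<notin> {1, 2}" for e
    using that keep by (simp add: M2 rd_update)
  moreover have "run w (seqs (map (\<lambda>i. less_digit (8 * a + i) (8 * b + i)) [0..<Suc n])) M = M2"
    by (simp add: run_seqs_append M1_def M2_def)
  ultimately show ?case by simp
qed

lemma regs_cong:
  assumes "\<And>e. e \<notin> {1, 2, 3} \<Longrightarrow> rd M' e = rd M e"
  shows "regs w M' = regs w M"
  using assms by (intro ext) (simp add: regs_def reg_def)

lemma const_digits: "(\<Sum>i<n. (c div (2 ^ w) ^ i mod 2 ^ w) * (2 ^ w) ^ i) = c mod (2 ^ w) ^ n" for c :: nat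
proof (induction n)
  case (Suc n)
  have "c mod ((2 ^ w) ^ n * 2 ^ w) = (2 ^ w) ^ n * (c div (2 ^ w) ^ n mod 2 ^ w) + c mod (2 ^ w) ^ n"
    by (rule mod_mult2_eq)
  then show ?case using Suc by (simp add: mult.commute)
qed simp

lemma compile_correct:
  assumes "1 \<le> w"
  shows "valid N p \<Longrightarrow> words w M \<Longrightarrow> length M = 8 * Suc N \<Longrightarrow> regs w (run w (compile w p) M) = sem w p (regs w M)"
proof (induction p arbitrary: M)
  case (Then p q)
  then show ?case using words_run[OF assms] by simp
next
  case (Mul_Add r f s)
  let ?B = "2 ^ w :: nat"
  define M0 where "M0 = M[1 := 0]"
  define M' where "M' = run w (compile w (Mul_Add r f s)) M"
  have M': "M' = run w (seqs (map (\<lambda>i. mul_add_digit (8 * r + i) (factor_opnd f) (summand_opnd w s i)) [0..<8])) M0"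
    by (simp add: M'_def M0_def)
  have M0: "words w M0" "length M0 = length M"
    using Mul_Add by (auto simp: M0_def intro: words_update)
  have rd0: "rd M0 e = (if e = 1 then 0 else rd M e)" for e
    using Mul_Add.prems by (auto simp: M0_def rd_update)
  have r: "1 \<le> r" "8 * r + 7 < length M0" using Mul_Add.prems M0 by auto
  have x: "plain 0 (factor_opnd f)" "\<nexists>e. factor_opnd f = Cell (Suc e)"
    by (cases f; simp add: plain_def)+
  have a: "plain 0 (summand_opnd w s i)" for i
    using Mul_Add.prems(1) by (cases s) (auto simp: plain_def)
  have ar: "summand_opnd w s i \<noteq> Cell (8 * r + j)" if "i < 8" "j < 8" for i j
  proof (cases s)
    case (Reg r')
    have "8 * r' + i \<noteq> 8 * r + j"
    proof
      assume "8 * r' + i = 8 * r + j"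
      then have "(8 * r' + i) div 8 = (8 * r + j) div 8" by simp
      then show False using that Mul_Add.prems(1) Reg by simp
    qed
    then show ?thesis using Reg by simp
  qed simp
  have eq: "(\<Sum>i<8. rd M' (8 * r + i) * ?B ^ i) + ?B ^ 8 * rd M' 1
      = (\<Sum>i<8. rd M0 (8 * r + i) * ?B ^ i) * val w M0 (factor_opnd f)
        + (\<Sum>i<8. val w M0 (summand_opnd w s i) * ?B ^ i) + rd M0 1"
    and keep: "\<And>e. e \<notin> {1, 2, 3} \<union> {8 * r..<8 * r + 8} \<Longrightarrow> rd M' e = rd M0 e"
    using mul_add_digits[OF M0(1) assms r order_refl x a ar] unfolding M' by auto
  have fv: "val w M0 (factor_opnd f) = factor_val (regs w M) f"
    using assms by (cases f) (auto simp: rd0 regs_def take_bit_eq_mod)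
  have Q: "?B ^ 8 = 2 ^ (8 * w)" by (simp add: power_mult[symmetric] mult.commute)
  have sv: "(\<Sum>i<8. val w M0 (summand_opnd w s i) * ?B ^ i) mod ?B ^ 8 = summand_val (regs w M) s mod ?B ^ 8"
  proof (cases s)
    case (Const c)
    then show ?thesis using const_digits[of c w 8] by (simp add: take_bit_eq_mod power_mult)
  next
    case (Reg r')
    then show ?thesis using Mul_Add.prems(1) by (simp add: rd0 regs_def reg_def)
  qed
  have regs_r: "(\<Sum>i<8. rd M0 (8 * r + i) * ?B ^ i) = regs w M r"
    using r by (simp add: rd0 regs_def reg_def)
  \<comment> \<open>The last carry has weight \<open>?B ^ 8\<close>; dropping it is the reduction
    modulo \<open>2 ^ (8 * w)\<close>, so no division is executed.\<close>
  have "regs w M' r = regs w M' r mod ?B ^ 8"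
    using r reg_less[OF words_run[OF assms M0(1)]] by (simp add: regs_def M' Q)
  also have "\<dots> = ((\<Sum>i<8. rd M' (8 * r + i) * ?B ^ i) + ?B ^ 8 * rd M' 1) mod ?B ^ 8"
    using r by (simp add: regs_def reg_def)
  also have "\<dots> = (regs w M r * factor_val (regs w M) f + summand_val (regs w M) s) mod ?B ^ 8"
  proof -
    have "rd M0 1 = 0" by (simp add: rd0)
    then show ?thesis unfolding eq fv regs_r by (simp only: add_0_right mod_add_cong[OF refl sv])
  qed
  finally have rr: "regs w M' r = sem w (Mul_Add r f s) (regs w M) r" by (simp add: Q)
  have "regs w M' r' = sem w (Mul_Add r f s) (regs w M) r'" if "r' \<noteq> r" for r'
  proof (cases "r' = 0")
    case True
    then show ?thesis using r that keep[of 0] by (simp add: regs_def rd0)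
  next
    case False
    have "rd M' (8 * r' + i) = rd M (8 * r' + i)" if "i < 8" for i
    proof -
      have "8 * r' + i \<notin> {8 * r..<8 * r + 8}"
        using \<open>r' \<noteq> r\<close> that unfolding atLeastLessThan_iff by presburger
      then show ?thesis using False by (subst keep) (auto simp: rd0)
    qed
    then show ?thesis using False that by (simp add: regs_def reg_def)
  qed
  with rr show ?case unfolding M'_def by (intro ext) metis
next
  case (If_Less a b p q)
  define M0 where "M0 = M[1 := 0]"
  define M1 where "M1 = run w (seqs (map (\<lambda>i. less_digit (8 * a + i) (8 * b + i)) [0..<8])) M0"
  have M0: "words w M0" "2 < length M0" "rd M0 1 = 0"
    using If_Less.prems by (auto simp: M0_def rd_update intro: words_update)
  have rd0: "rd M0 e = (if e = 1 then 0 else rd M e)" for e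
    using If_Less.prems by (auto simp: M0_def rd_update)
  have cmp: "rd M1 1 = of_bool (reg w M0 a < reg w M0 b)" and keep: "\<And>e. e \<notin> {1, 2} \<Longrightarrow> rd M1 e = rd M0 e"
    using less_digits[OF M0(1,2) _ _ M0(3), of a b 8] If_Less.prems unfolding M1_def reg_def by auto
  have r1: "regs w M1 = regs w M" by (intro regs_cong) (auto simp: keep rd0)
  have r0: "regs w M0 = regs w M" by (intro regs_cong) (auto simp: rd0)
  have ab: "regs w M a = reg w M0 a" "regs w M b = reg w M0 b"
    using If_Less.prems by (auto simp: r0[symmetric] regs_def)
  have M1: "words w M1" "length M1 = 8 * Suc N"
    using words_run[OF assms M0(1)] If_Less.prems by (auto simp: M1_def M0_def)
  have "run w (compile w (If_Less a b p q)) M = (if rd M1 1 \<noteq> 0 then run w (compile w p) M1 else run w (compile w q) M1)"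
    by (simp add: M1_def M0_def)
  then show ?case using If_Less M1 by (simp add: cmp ab r1 del: One_nat_def)
next
  case (If_Item j p q)
  define M1 where "M1 = M[1 := of_bool (rd M 0 = j mod 2 ^ w)]"
  have M1: "words w M1" "length M1 = 8 * Suc N" "regs w M1 = regs w M"
    using If_Item.prems assms one_less_power[of "2::nat" w]
    by (auto simp: M1_def rd_update intro!: words_update regs_cong)
  have "rd M1 1 = of_bool (regs w M 0 = j mod 2 ^ w)"
    using If_Item.prems by (simp add: M1_def rd_update regs_def)
  moreover have "run w (compile w (If_Item j p q)) M = (if rd M1 1 \<noteq> 0 then run w (compile w p) M1 else run w (compile w q) M1)"
    by (simp add: M1_def take_bit_eq_mod)
  ultimately show ?case using If_Item M1 by (simp del: One_nat_def)
qed simp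

section \<open>The sketch program\<close>

definition thens :: "prog list \<Rightarrow> prog" where
  "thens ps = foldr Then ps Nop"

lemma sem_thens [simp]:
  "sem w (thens []) G = G" "sem w (thens (p # ps)) G = sem w (thens ps) (sem w p G)"
  by (simp_all add: thens_def)

lemma sem_thens_append: "sem w (thens (ps @ qs)) G = sem w (thens qs) (sem w (thens ps) G)"
  by (induction ps arbitrary: G) auto

lemma valid_thens [simp]: "valid N (thens ps) \<longleftrightarrow> (\<forall>p\<in>set ps. valid N p)"
  by (induction ps) (auto simp: thens_def)

lemma prog_len_thens [simp]: "prog_len (thens ps) = Suc (sum_list (map prog_len ps))"
  by (induction ps) (auto simp: thens_def)

definition assign :: "(nat \<times> nat) list \<Rightarrow> prog" where
  "assign xs = thens (map (\<lambda>(r, c). Mul_Add r Zero (Const c)) xs)"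

lemma sem_assign_other: "r \<notin> fst ` set xs \<Longrightarrow> sem w (assign xs) G r = G r"
  by (induction xs arbitrary: G) (auto simp: assign_def)

lemma sem_assign:
  assumes "(r, c) \<in> set xs" "\<And>c'. (r, c') \<in> set xs \<Longrightarrow> c' = c"
  shows "sem w (assign xs) G r = c mod 2 ^ (8 * w)"
  using assms
proof (induction xs arbitrary: G)
  case (Cons x xs)
  obtain r' c' where x: "x = (r', c')" by fastforce
  show ?case
  proof (cases "r \<in> fst ` set xs")
    case True
    then obtain c'' where "(r, c'') \<in> set xs" by auto
    then have "(r, c) \<in> set xs" using Cons.prems(2)[of c''] by auto
    then have "sem w (assign xs) G' r = c mod 2 ^ (8 * w)" for G'
      by (rule Cons.IH) (intro Cons.prems(2), simp)
    then show ?thesis by (simp add: assign_def x)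
  next
    case False
    then have "x = (r, c)" using Cons.prems(1) by (auto simp: image_iff)
    then show ?thesis
      using sem_assign_other[OF False] by (simp add: assign_def)
  qed
qed simp

lemma valid_assign: "(\<And>r c. (r, c) \<in> set xs \<Longrightarrow> 1 \<le> r \<and> r \<le> N) \<Longrightarrow> valid N (assign xs)"
  by (auto simp: assign_def)

lemma prog_len_assign: "prog_len (assign xs) = Suc (length xs)"
  by (induction xs) (auto simp: assign_def thens_def)

text \<open>Coefficients are listed from the lowest degree up while Horner's rule starts at the
  highest, hence \<open>rev\<close>.\<close>

definition horner_prog :: "nat list \<Rightarrow> prog" where
  "horner_prog rs = Then (Mul_Add 1 Zero (Const 0)) (thens (map (\<lambda>r. Mul_Add 1 Item (Reg r)) (rev rs)))"

lemma sem_horner_prog: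
  assumes "1 \<notin> set rs"
  shows "sem w (horner_prog rs) G = G(1 := horner_sum G (G 0) rs mod 2 ^ (8 * w))"
proof -
  have "sem w (thens (map (\<lambda>r. Mul_Add 1 Item (Reg r)) (rev rs))) G = G(1 := horner_sum G (G 0) rs mod 2 ^ (8 * w))"
    if "G 1 = 0" for G
    using assms
  proof (induction rs)
    case Nil
    then show ?case using that by auto
  next
    case (Cons r rs)
    let ?Q = "2 ^ (8 * w) :: nat"
    let ?H = "horner_sum G (G 0) rs mod ?Q"
    have "1 \<notin> set rs" "r \<noteq> 1" using Cons.prems by auto
    then have "sem w (thens (map (\<lambda>r. Mul_Add 1 Item (Reg r)) (rev (r # rs)))) G
        = sem w (Mul_Add 1 Item (Reg r)) (G(1 := ?H))"
      by (simp only: rev.simps map_append list.map sem_thens_append Cons.IH[OF \<open>1 \<notin> set rs\<close>] sem_thens)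
    also have "\<dots> = G(1 := (?H * G 0 + G r) mod ?Q)"
      using \<open>r \<noteq> 1\<close> by simp
    also have "(?H * G 0 + G r) mod ?Q = (horner_sum G (G 0) rs * G 0 + G r) mod ?Q"
      by (rule mod_add_cong) (simp_all add: mod_mult_left_eq)
    also have "horner_sum G (G 0) rs * G 0 + G r = horner_sum G (G 0) (r # rs)" by simp
    finally show ?case .
  qed
  from this[of "G(1 := 0)"] have "sem w (horner_prog rs) G = G(1 := horner_sum (G(1 := 0)) (G 0) rs mod 2 ^ (8 * w))"
    by (simp add: horner_prog_def)
  also have "horner_sum (G(1 := 0)) (G 0) rs = horner_sum G (G 0) rs"
    using assms by (induction rs) auto
  finally show ?thesis .
qed

text \<open>These bounds let eight words hold every quantity that must be exact. Where they fail for
  \<open>k\<close> or \<open>R\<close>, the budget already pays for one register per item.\<close>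

locale sketch =
  fixes w k R S :: nat
  assumes w: "1 \<le> w" and k: "1 \<le> k" and R: "1 \<le> R" and S: "1 \<le> S"
    and B: "16 \<le> (2::nat) ^ w" and k_le: "k \<le> 2 ^ w" and R_le: "R \<le> 2 ^ w" and S_le: "S \<le> 2 ^ w"
begin

abbreviation Q :: nat where "Q \<equiv> 2 ^ (8 * w)"

definition Y_reg :: "nat \<Rightarrow> nat" where "Y_reg g = 9 + g"
definition P_reg :: "nat \<Rightarrow> nat" where "P_reg q = 9 + R + 2 * q"
definition N_reg :: "nat \<Rightarrow> nat" where "N_reg q = 10 + R + 2 * q"
text \<open>The coefficients fill the end of the memory and are never written: the hash functions
  are the initial random words themselves.\<close>

definition C_reg :: "nat \<Rightarrow> nat \<Rightarrow> nat" where "C_reg q c = 9 + R + 2 * (R * k) + 8 * q + c"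
definition last_reg :: nat where "last_reg = 8 + R + 2 * (R * k) + 8 * (R * k)"

lemmas reg_defs = Y_reg_def P_reg_def N_reg_def C_reg_def last_reg_def

text \<open>Row \<open>q\<close> belongs to group \<open>q div k\<close>. If \<open>Z\<close> is its signed counter, then \<open>P_reg q\<close> and \<open>N_reg q\<close>
  hold \<open>S\<^sup>2 * (1 + 2 * Z)\<close> and \<open>S\<^sup>2 * (1 - 2 * Z)\<close> modulo \<open>Q\<close>: the increments of \<open>S\<^sup>2 * Z\<^sup>2\<close> when \<open>Z\<close>
  changes by 1 or by -1.\<close>

definition row :: "nat \<Rightarrow> prog" where
  "row q = Then (horner_prog (map (C_reg q) [0..<8])) (If_Less 1 2
    (thens [Mul_Add (Y_reg (q div k)) One (Reg (P_reg q)),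
      Mul_Add (P_reg q) One (Const (2 * S\<^sup>2)), Mul_Add (N_reg q) One (Const (Q - 2 * S\<^sup>2))])
    (thens [Mul_Add (Y_reg (q div k)) One (Reg (N_reg q)),
      Mul_Add (N_reg q) One (Const (2 * S\<^sup>2)), Mul_Add (P_reg q) One (Const (Q - 2 * S\<^sup>2))]))"

definition count :: prog where
  "count = Then (Mul_Add 3 Zero (Const 0))
    (thens (map (\<lambda>g. If_Less (Y_reg g) 6 Nop (Mul_Add 3 One (Const 1))) [0..<R]))"

text \<open>Registers 5, 6, 7 hold \<open>k * v\<^sup>2\<close>, \<open>k * (v + 1)\<^sup>2\<close> and \<open>k * (2 * v + 1)\<close>, where \<open>v / S\<close> is the current
  estimate of the root of the second moment.\<close>

definition test :: prog where
  "test = Then count (If_Less 4 3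
    (thens [Mul_Add 5 One (Reg 7), Mul_Add 7 One (Const (2 * k)), Mul_Add 6 One (Reg 7)]) Nop)"

definition update_prog :: prog where
  "update_prog = Then (thens (map row [0..<R * k])) (thens (replicate (2 * S) test))"

definition init_list :: "(nat \<times> nat) list" where
  "init_list = [(2, 2 ^ (8 * w - 1)), (4, R div 2), (5, 0), (6, k), (7, k), (8, S\<^sup>2 * k)]
    @ map (\<lambda>g. (Y_reg g, 0)) [0..<R] @ map (\<lambda>q. (P_reg q, S\<^sup>2)) [0..<R * k]
    @ map (\<lambda>q. (N_reg q, S\<^sup>2)) [0..<R * k]"

lemma group_less: "q < R * k \<Longrightarrow> q div k < R"
  using k by (simp add: less_mult_imp_div_less)

lemma Q_eq: "Q = 2 ^ w * 2 ^ w * 2 ^ w * 2 ^ w * 2 ^ w * 2 ^ w * 2 ^ w * 2 ^ w"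
  by (simp add: power_add[symmetric])

text \<open>All numbers that have to be exact are at most \<open>9 * 2 ^ (5 * w)\<close>.\<close>

lemma bound_Q: "x \<le> 9 * ((2 ^ w) * (2 ^ w)\<^sup>2 * (2 ^ w)\<^sup>2) \<Longrightarrow> x < Q"
proof -
  assume x: "x \<le> 9 * ((2 ^ w) * (2 ^ w)\<^sup>2 * (2 ^ w)\<^sup>2)"
  define b :: nat where "b = 2 ^ w"
  have b: "16 \<le> b" using B by (simp add: b_def)
  define c where "c = b * b\<^sup>2 * b\<^sup>2"
  have c: "0 < c" using b by (simp add: c_def)
  have "9 < b * b * b" using mult_le_mono[OF mult_le_mono[OF b b] b] by simp
  then have "c * 9 < c * (b * b * b)" using c by simp
  moreover have "c * (b * b * b) = Q" unfolding Q_eq b_def[symmetric] by (simp add: c_def power2_eq_square)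
  moreover have "x \<le> c * 9" using x by (simp add: c_def b_def)
  ultimately show ?thesis by linarith
qed

lemma valid_update: "valid last_reg update_prog"
proof -
  have "valid last_reg (row q)" if "q < R * k" for q
    using group_less[OF that] that by (auto simp: row_def horner_prog_def reg_defs)
  moreover have "valid last_reg test"
    by (auto simp: test_def count_def reg_defs)
  ultimately show ?thesis by (auto simp: update_prog_def)
qed

lemma valid_init: "valid last_reg (assign init_list)"
  by (rule valid_assign) (auto simp: init_list_def reg_defs)

definition S2 :: int where "S2 = int (S\<^sup>2)"

definition group :: "nat \<Rightarrow> nat set" where
  "group g = {q. q < R * k \<and> q div k = g}"

text \<open>Whatever derives from the signed counters is kept only modulo \<open>Q\<close>;
  \<open>Y_reg_value\<close> recovers the sums of squares, which are nonnegative and below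
  \<open>Q\<close>.\<close>

definition rows_inv :: "(nat \<Rightarrow> nat \<Rightarrow> nat) \<Rightarrow> (nat \<Rightarrow> int) \<Rightarrow> (nat \<Rightarrow> nat) \<Rightarrow> bool" where
  "rows_inv cs z G \<longleftrightarrow> G 2 = 2 ^ (8 * w - 1) \<and> G 4 = R div 2 \<and> G 8 = S\<^sup>2 * k
    \<and> (\<forall>q<R * k. \<forall>c<8. G (C_reg q c) = cs q c)
    \<and> (\<forall>q<R * k. int (G (P_reg q)) = (S2 * (1 + 2 * z q)) mod int Q)
    \<and> (\<forall>q<R * k. int (G (N_reg q)) = (S2 * (1 - 2 * z q)) mod int Q)
    \<and> (\<forall>g<R. int (G (Y_reg g)) = (S2 * (\<Sum>q\<in>group g. (z q)\<^sup>2)) mod int Q)"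

definition sgn_of :: "(nat \<Rightarrow> nat \<Rightarrow> nat) \<Rightarrow> nat \<Rightarrow> nat \<Rightarrow> int" where
  "sgn_of cs q x = hash_sign w (map (cs q) [0..<8]) x"

lemma S2_le: "2 * S\<^sup>2 \<le> Q"
proof -
  have "S\<^sup>2 \<le> (2 ^ w)\<^sup>2" using S_le by (intro power_mono) auto
  also have "\<dots> \<le> (2 ^ w)\<^sup>2 * (2 ^ w * (2 ^ w)\<^sup>2)" by simp
  finally have "2 * S\<^sup>2 \<le> 9 * ((2 ^ w) * (2 ^ w)\<^sup>2 * (2 ^ w)\<^sup>2)" by (simp add: algebra_simps)
  then have "2 * S\<^sup>2 < Q" by (rule bound_Q)
  then show ?thesis by simp
qed

lemma sum_group_upd:
  fixes z :: "nat \<Rightarrow> int"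
  assumes "q < R * k"
  shows "(\<Sum>r\<in>group g. ((z(q := x)) r)\<^sup>2) = (\<Sum>r\<in>group g. (z r)\<^sup>2) + (if q div k = g then x\<^sup>2 - (z q)\<^sup>2 else 0)"
proof -
  have fin: "finite (group g)" by (simp add: group_def)
  show ?thesis
  proof (cases "q \<in> group g")
    case True
    then have "q div k = g" by (simp add: group_def)
    moreover have "(\<Sum>r\<in>group g - {q}. ((z(q := x)) r)\<^sup>2) = (\<Sum>r\<in>group g - {q}. (z r)\<^sup>2)"
      by (intro sum.cong) auto
    ultimately show ?thesis
      using sum.remove[OF fin True, of "\<lambda>r. ((z(q := x)) r)\<^sup>2"] sum.remove[OF fin True, of "\<lambda>r. (z r)\<^sup>2"]
      by (simp del: fun_upd_apply add: fun_upd_same)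
  next
    case False
    then have "q div k \<noteq> g" using assms by (simp add: group_def)
    moreover have "(\<Sum>r\<in>group g. ((z(q := x)) r)\<^sup>2) = (\<Sum>r\<in>group g. (z r)\<^sup>2)"
      using False by (intro sum.cong) auto
    ultimately show ?thesis by simp
  qed
qed

lemma int_add_mod: "int ((a * Suc 0 + b) mod Q) = (int a + int b) mod int Q"
  by (simp add: zmod_int)

text \<open>Registers are unsigned; adding the complement modulo \<open>Q\<close> subtracts.\<close>

lemma int_sub_mod: "int ((a * Suc 0 + (Q - 2 * S\<^sup>2)) mod Q) = (int a - 2 * S2) mod int Q"
proof -
  have "int (a * Suc 0 + (Q - 2 * S\<^sup>2)) = (int a - 2 * S2) + int Q"
    using S2_le by (simp add: of_nat_diff S2_def)
  then show ?thesis unfolding zmod_int by (metis mod_add_self2)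
qed

lemma reg_inj:
  "P_reg a = P_reg b \<longleftrightarrow> a = b" "N_reg a = N_reg b \<longleftrightarrow> a = b" "Y_reg a = Y_reg b \<longleftrightarrow> a = b"
  "P_reg a \<noteq> N_reg b" "N_reg b \<noteq> P_reg a"
  by (simp_all add: reg_defs) presburger+

lemma reg_neq:
  "a < R \<Longrightarrow> Y_reg a \<noteq> P_reg b" "a < R \<Longrightarrow> Y_reg a \<noteq> N_reg b"
  "a < R \<Longrightarrow> P_reg b \<noteq> Y_reg a" "a < R \<Longrightarrow> N_reg b \<noteq> Y_reg a"
  "q < R * k \<Longrightarrow> C_reg b c \<noteq> P_reg q" "q < R * k \<Longrightarrow> C_reg b c \<noteq> N_reg q"
  "q < R * k \<Longrightarrow> P_reg q \<noteq> C_reg b c" "q < R * k \<Longrightarrow> N_reg q \<noteq> C_reg b c"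
  "a < R \<Longrightarrow> Y_reg a \<noteq> C_reg b c" "a < R \<Longrightarrow> C_reg b c \<noteq> Y_reg a"
  by (simp_all add: reg_defs)

lemma reg_neq_small:
  "r < 9 \<Longrightarrow> P_reg a \<noteq> r \<and> N_reg a \<noteq> r \<and> Y_reg a \<noteq> r \<and> C_reg a c \<noteq> r
    \<and> r \<noteq> P_reg a \<and> r \<noteq> N_reg a \<and> r \<noteq> Y_reg a \<and> r \<noteq> C_reg a c"
  by (auto simp: reg_defs)

lemmas reg_simps = reg_inj reg_neq reg_neq_small

text \<open>Shared by the two signs, which change the same three registers besides the
  accumulator.\<close>

lemma rows_inv_update:
  assumes inv: "rows_inv cs z G" and q: "q < R * k"
    and same: "\<And>r. r \<notin> {1, Y_reg (q div k), P_reg q, N_reg q} \<Longrightarrow> G' r = G r"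
    and P: "int (G' (P_reg q)) = (S2 * (1 + 2 * x)) mod int Q"
    and N: "int (G' (N_reg q)) = (S2 * (1 - 2 * x)) mod int Q"
    and Y: "int (G' (Y_reg (q div k))) = (int (G (Y_reg (q div k))) + S2 * (x\<^sup>2 - (z q)\<^sup>2)) mod int Q"
  shows "rows_inv cs (z(q := x)) G'"
proof -
  have g: "q div k < R" using group_less[OF q] .
  have P': "int (G' (P_reg a)) = (S2 * (1 + 2 * (z(q := x)) a)) mod int Q" if "a < R * k" for a
    using that inv P g by (cases "a = q") (auto simp: rows_inv_def same reg_simps)
  have N': "int (G' (N_reg a)) = (S2 * (1 - 2 * (z(q := x)) a)) mod int Q" if "a < R * k" for a
    using that inv N g by (cases "a = q") (auto simp: rows_inv_def same reg_simps)
  have Y': "int (G' (Y_reg a)) = (S2 * (\<Sum>r\<in>group a. ((z(q := x)) r)\<^sup>2)) mod int Q" if "a < R" for a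
  proof (cases "a = q div k")
    case True
    have "int (G (Y_reg a)) = (S2 * (\<Sum>r\<in>group a. (z r)\<^sup>2)) mod int Q"
      using inv that by (simp add: rows_inv_def)
    then show ?thesis
      unfolding sum_group_upd[OF q] True using Y
      by (simp only: True mod_add_left_eq distrib_left if_True simp_thms)
  next
    case False
    then have "G' (Y_reg a) = G (Y_reg a)" using that by (intro same) (auto simp: reg_simps)
    then show ?thesis
      unfolding sum_group_upd[OF q] using inv that False by (simp add: rows_inv_def)
  qed
  have C': "G' (C_reg a c) = cs a c" if "a < R * k" "c < 8" for a c
    using that inv q g by (subst same) (auto simp: rows_inv_def reg_simps)
  have "G' 2 = 2 ^ (8 * w - 1)" "G' 4 = R div 2" "G' 8 = S\<^sup>2 * k"
    using inv by (auto simp: rows_inv_def same reg_simps)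
  then show ?thesis unfolding rows_inv_def using P' N' Y' C' by blast
qed

lemma row_step:
  assumes inv: "rows_inv cs z G" and q: "q < R * k"
  defines "G' \<equiv> sem w (row q) G"
  shows "rows_inv cs (z(q := z q + sgn_of cs q (G 0))) G' \<and> (\<forall>r\<in>{0, 5, 6, 7}. G' r = G r)"
proof -
  let ?g = "q div k"
  define H where "H = horner_sum id (G 0) (map (cs q) [0..<8]) mod Q"
  define G1 where "G1 = G(1 := H)"
  have g: "?g < R" using group_less[OF q] .
  have C1: "1 \<notin> set (map (C_reg q) [0..<8])" by (auto simp: C_reg_def)
  have "horner_sum G (G 0) (map (C_reg q) [0..<8]) = horner_sum id (G 0) (map (cs q) [0..<8])"
    using inv q unfolding rows_inv_def horner_sum_eq_sum by (intro sum.cong) auto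
  then have G1: "sem w (horner_prog (map (C_reg q) [0..<8])) G = G1"
    unfolding sem_horner_prog[OF C1] G1_def H_def by simp
  have G2: "G1 2 = 2 ^ (8 * w - 1)" using inv by (simp add: G1_def rows_inv_def)
  have sgn: "sgn_of cs q (G 0) = (if H < 2 ^ (8 * w - 1) then 1 else - 1)"
    by (simp add: sgn_of_def hash_sign_def H_def)
  have P: "int (G (P_reg q)) = (S2 * (1 + 2 * z q)) mod int Q"
    and N: "int (G (N_reg q)) = (S2 * (1 - 2 * z q)) mod int Q"
    using inv q g by (auto simp: rows_inv_def)
  show ?thesis
  proof (cases "H < 2 ^ (8 * w - 1)")
    case True
    define G3 where "G3 = G1(Y_reg ?g := (G (Y_reg ?g) * Suc 0 + G (P_reg q)) mod Q,
      P_reg q := (G (P_reg q) * Suc 0 + 2 * S\<^sup>2) mod Q,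
      N_reg q := (G (N_reg q) * Suc 0 + (Q - 2 * S\<^sup>2)) mod Q)"
    have G': "G' = G3"
      unfolding G'_def row_def using True g q
      by (simp add: G1 G2 G3_def reg_simps) (simp add: G1_def reg_simps)
    have s: "sgn_of cs q (G 0) = 1" using True by (simp add: sgn)
    have "int ((G (P_reg q) * Suc 0 + 2 * S\<^sup>2) mod Q) = (S2 * (1 + 2 * (z q + 1))) mod int Q"
      unfolding int_add_mod P mod_add_left_eq by (simp add: S2_def algebra_simps)
    moreover have "int ((G (N_reg q) * Suc 0 + (Q - 2 * S\<^sup>2)) mod Q) = (S2 * (1 - 2 * (z q + 1))) mod int Q"
      unfolding int_sub_mod N mod_diff_left_eq by (simp add: algebra_simps)
    moreover have "int ((G (Y_reg ?g) * Suc 0 + G (P_reg q)) mod Q)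
        = (int (G (Y_reg ?g)) + S2 * ((z q + 1)\<^sup>2 - (z q)\<^sup>2)) mod int Q"
      unfolding int_add_mod P mod_add_right_eq by (simp add: power2_eq_square algebra_simps)
    ultimately have "rows_inv cs (z(q := z q + 1)) G3"
      using g q by (intro rows_inv_update[OF inv q]) (simp_all add: G3_def G1_def reg_simps del: mult_Suc_right)
    then show ?thesis
      using g q unfolding G' s by (simp add: G3_def G1_def reg_simps)
  next
    case False
    define G3 where "G3 = G1(Y_reg ?g := (G (Y_reg ?g) * Suc 0 + G (N_reg q)) mod Q,
      N_reg q := (G (N_reg q) * Suc 0 + 2 * S\<^sup>2) mod Q,
      P_reg q := (G (P_reg q) * Suc 0 + (Q - 2 * S\<^sup>2)) mod Q)"
    have G': "G' = G3"
      unfolding G'_def row_def using False g q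
      by (simp add: G1 G2 G3_def reg_simps) (simp add: G1_def reg_simps)
    have s: "sgn_of cs q (G 0) = - 1" using False by (simp add: sgn)
    have "int ((G (N_reg q) * Suc 0 + 2 * S\<^sup>2) mod Q) = (S2 * (1 - 2 * (z q - 1))) mod int Q"
      unfolding int_add_mod N mod_add_left_eq by (simp add: S2_def algebra_simps)
    moreover have "int ((G (P_reg q) * Suc 0 + (Q - 2 * S\<^sup>2)) mod Q) = (S2 * (1 + 2 * (z q - 1))) mod int Q"
      unfolding int_sub_mod P mod_diff_left_eq by (simp add: algebra_simps)
    moreover have "int ((G (Y_reg ?g) * Suc 0 + G (N_reg q)) mod Q)
        = (int (G (Y_reg ?g)) + S2 * ((z q - 1)\<^sup>2 - (z q)\<^sup>2)) mod int Q"
      unfolding int_add_mod N mod_add_right_eq by (simp add: power2_eq_square algebra_simps)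
    ultimately have "rows_inv cs (z(q := z q - 1)) G3"
      using g q by (intro rows_inv_update[OF inv q]) (simp_all add: G3_def G1_def reg_simps del: mult_Suc_right)
    then show ?thesis
      using g q unfolding G' s by (simp add: G3_def G1_def reg_simps)
  qed
qed

lemma rows_step:
  assumes inv: "rows_inv cs z G"
  defines "G' \<equiv> sem w (thens (map row [0..<R * k])) G"
  shows "rows_inv cs (\<lambda>q. z q + sgn_of cs q (G 0)) G'" and "r \<in> {0, 5, 6, 7} \<Longrightarrow> G' r = G r"
proof -
  have "rows_inv cs (\<lambda>q. z q + (if q < l then sgn_of cs q (G 0) else 0)) (sem w (thens (map row [0..<l])) G)
    \<and> (\<forall>r\<in>{0, 5, 6, 7}. sem w (thens (map row [0..<l])) G r = G r)" if "l \<le> R * k" for l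
    using that
  proof (induction l)
    case 0
    then show ?case using inv by simp
  next
    case (Suc l)
    define G1 where "G1 = sem w (thens (map row [0..<l])) G"
    define z1 where "z1 = (\<lambda>q. z q + (if q < l then sgn_of cs q (G 0) else 0))"
    have 1: "rows_inv cs z1 G1" "\<forall>r\<in>{0, 5, 6, 7}. G1 r = G r"
      using Suc unfolding G1_def z1_def by auto
    have "z1(l := z1 l + sgn_of cs l (G1 0)) = (\<lambda>q. z q + (if q < Suc l then sgn_of cs q (G 0) else 0))"
      using 1 by (auto simp: z1_def fun_eq_iff)
    then show ?case
      using row_step[OF 1(1), of l] Suc.prems 1(2) by (simp add: sem_thens_append G1_def[symmetric])
  qed
  from this[of "R * k"] have fin: "rows_inv cs (\<lambda>q. z q + (if q < R * k then sgn_of cs q (G 0) else 0)) G'"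
    "\<forall>r\<in>{0, 5, 6, 7}. G' r = G r" unfolding G'_def by auto
  have "(\<Sum>q\<in>group g. (z q + (if q < R * k then sgn_of cs q (G 0) else 0))\<^sup>2)
      = (\<Sum>q\<in>group g. (z q + sgn_of cs q (G 0))\<^sup>2)" for g
    by (intro sum.cong) (auto simp: group_def)
  with fin(1) show "rows_inv cs (\<lambda>q. z q + sgn_of cs q (G 0)) G'"
    unfolding rows_inv_def by (simp cong: conj_cong imp_cong)
  show "r \<in> {0, 5, 6, 7} \<Longrightarrow> G' r = G r" using fin(2) by blast
qed

definition level :: "(nat \<Rightarrow> nat) \<Rightarrow> nat \<Rightarrow> bool" where
  "level G v \<longleftrightarrow> G 5 = k * v\<^sup>2 \<and> G 6 = k * (v + 1)\<^sup>2 \<and> G 7 = k * (2 * v + 1)"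

text \<open>The majority is strict: when it fails, at least half of the groups lie below the
  threshold, and as fewer than half are bad, an accurate one is among them.\<close>

definition raise :: "(nat \<Rightarrow> nat) \<Rightarrow> nat \<Rightarrow> nat" where
  "raise y v = (if R < 2 * card {g. g < R \<and> k * (v + 1)\<^sup>2 \<le> y g} then v + 1 else v)"

lemma R_less: "R < Q"
  using R_le by (intro bound_Q) (auto intro: order_trans)

lemma sem_count: "sem w count G = G(3 := card {g. g < R \<and> G 6 \<le> G (Y_reg g)})"
proof -
  have "sem w (thens (map (\<lambda>g. If_Less (Y_reg g) 6 Nop (Mul_Add 3 One (Const 1))) [0..<l])) (G(3 := 0))
      = G(3 := card {g. g < l \<and> G 6 \<le> G (Y_reg g)})" if "l \<le> R" for l
    using that
  proof (induction l)
    case (Suc l)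
    have eq: "{g. g < Suc l \<and> G 6 \<le> G (Y_reg g)}
      = (if G 6 \<le> G (Y_reg l) then insert l {g. g < l \<and> G 6 \<le> G (Y_reg g)} else {g. g < l \<and> G 6 \<le> G (Y_reg g)})"
      by (auto simp: less_Suc_eq)
    have "card {g. g < l \<and> G 6 \<le> G (Y_reg g)} \<le> card {..<l}" by (intro card_mono) auto
    then have "Suc (card {g. g < l \<and> G 6 \<le> G (Y_reg g)}) < Q" using Suc.prems R_less by simp
    then show ?case using Suc unfolding eq by (simp add: sem_thens_append reg_simps fun_eq_iff)
  qed simp
  from this[of R] show ?thesis by (simp add: count_def)
qed

lemma test_step:
  assumes lev: "level G v" and G4: "G 4 = R div 2" and v: "k * (v + 2)\<^sup>2 < Q"
  defines "G' \<equiv> sem w test G"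
  shows "level G' (raise (\<lambda>g. G (Y_reg g)) v) \<and> (\<forall>r. r \<notin> {3, 5, 6, 7} \<longrightarrow> G' r = G r)"
proof -
  define c where "c = card {g. g < R \<and> k * (v + 1)\<^sup>2 \<le> G (Y_reg g)}"
  have c: "sem w count G = G(3 := c)"
    using lev by (simp add: sem_count c_def level_def)
  have maj: "R div 2 < c \<longleftrightarrow> R < 2 * c" by linarith
  have "k * (v + 1)\<^sup>2 \<le> k * (v + 2)\<^sup>2" by (intro mult_left_mono power_mono) auto
  then have 1: "k * v\<^sup>2 + k * (2 * v + 1) < Q" using v by (simp add: power2_eq_square algebra_simps)
  have 2: "k * (v + 1)\<^sup>2 + k * (2 * v + 3) < Q" using v by (simp add: power2_eq_square algebra_simps)
  then have 3: "k * (2 * v + 1) + 2 * k < Q" by (simp add: algebra_simps)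
  show ?thesis
  proof (cases "R < 2 * c")
    case True
    \<comment> \<open>Consecutive squares differ by odd numbers: register 5 grows by the old
      register 7 and register 6 by the new one. The latter reaches
      \<open>k * (v + 2)\<^sup>2\<close>, hence the bound assumed for \<open>v\<close>.\<close>
    define G3 where "G3 = G(3 := c, 5 := k * v\<^sup>2 + k * (2 * v + 1), 7 := k * (2 * v + 1) + 2 * k,
      6 := k * (v + 1)\<^sup>2 + (k * (2 * v + 1) + 2 * k))"
    have "k * (v + 1)\<^sup>2 + (k * (2 * v + 1) + 2 * k) < Q" using 2 by (simp add: algebra_simps)
    then have "G' = G3"
      unfolding G'_def test_def using True maj G4 lev 1 3 by (simp add: c level_def G3_def)
    moreover have "raise (\<lambda>g. G (Y_reg g)) v = v + 1" using True by (simp add: raise_def c_def)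
    ultimately show ?thesis by (simp add: G3_def level_def power2_eq_square algebra_simps)
  next
    case False
    then have "G' = G(3 := c)"
      unfolding G'_def test_def using maj G4 by (simp add: c)
    moreover have "raise (\<lambda>g. G (Y_reg g)) v = v" using False by (simp add: raise_def c_def)
    ultimately show ?thesis using lev by (simp add: level_def)
  qed
qed

lemma raise_le: "raise y v \<le> v + 1"
  by (simp add: raise_def)

lemma raises_le: "(raise y ^^ j) v \<le> v + j"
proof (induction j)
  case (Suc j)
  then show ?case using raise_le[of y "(raise y ^^ j) v"] by simp
qed simp

lemma tests_step:
  assumes lev: "level G v" and G4: "G 4 = R div 2" and v: "k * (v + j + 1)\<^sup>2 < Q"
  shows "level (sem w (thens (replicate j test)) G) ((raise (\<lambda>g. G (Y_reg g)) ^^ j) v)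
    \<and> (\<forall>r. r \<notin> {3, 5, 6, 7} \<longrightarrow> sem w (thens (replicate j test)) G r = G r)"
  using v
proof (induction j)
  case (Suc j)
  let ?y = "\<lambda>g. G (Y_reg g)"
  define G1 where "G1 = sem w (thens (replicate j test)) G"
  define v1 where "v1 = (raise ?y ^^ j) v"
  have "k * (v + j + 1)\<^sup>2 \<le> k * (v + Suc j + 1)\<^sup>2" by (intro mult_left_mono power_mono) auto
  then have "k * (v + j + 1)\<^sup>2 < Q" using Suc.prems by (rule le_less_trans)
  then have 1: "level G1 v1" "\<forall>r. r \<notin> {3, 5, 6, 7} \<longrightarrow> G1 r = G r"
    using Suc.IH unfolding G1_def v1_def by auto
  have "v1 \<le> v + j" unfolding v1_def by (rule raises_le)
  then have "k * (v1 + 2)\<^sup>2 \<le> k * (v + Suc j + 1)\<^sup>2" by (intro mult_left_mono power_mono) auto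
  then have 2: "k * (v1 + 2)\<^sup>2 < Q" using Suc.prems by (rule le_less_trans)
  have y: "(\<lambda>g. G1 (Y_reg g)) = ?y" using 1(2) by (auto simp: fun_eq_iff reg_simps)
  have "replicate (Suc j) test = replicate j test @ [test]" by (simp add: replicate_append_same)
  then have "sem w (thens (replicate (Suc j) test)) G = sem w test G1"
    by (simp only: sem_thens_append G1_def sem_thens)
  then show ?case
    using test_step[OF 1(1) _ 2] 1(2) G4 unfolding y by (simp add: v1_def)
qed (use lev in simp)

end

section \<open>The estimate of the sketch\<close>

text \<open>\<open>A - 2 * s\<close> is the level before \<open>s\<close> steps in which the level
  rose by 2 and the root by at most 1. The cross term \<open>2 * s * sqrt e\<close> is absorbed by
  the reserve \<open>3 * s\<^sup>2\<close> in the square of \<open>A\<close>, at the price of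
  \<open>e / 3\<close>. At equal speeds there would be no reserve and this bound would grow with
  \<open>s\<close>.\<close>

lemma catch_up_bound:
  fixes A s e x :: real
  assumes "0 \<le> s" "2 * s \<le> A" "0 \<le> e" "0 \<le> x" "sqrt x \<le> sqrt ((A - 2 * s)\<^sup>2 + e) + s"
  shows "x \<le> A\<^sup>2 + 3 / 2 * e"
proof -
  define b r q where "b = A - 2 * s" and "r = sqrt (b\<^sup>2 + e)" and "q = sqrt e"
  have b: "0 \<le> b" and q: "0 \<le> q" "q\<^sup>2 = e" using assms by (auto simp: b_def q_def)
  have r2: "r\<^sup>2 = b\<^sup>2 + e" using assms by (simp add: r_def)
  have r_le: "r \<le> b + q"
    unfolding r_def using b q by (intro real_le_lsqrt) (auto simp: power2_sum)
  have "x = (sqrt x)\<^sup>2" using assms by simp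
  also have "\<dots> \<le> (r + s)\<^sup>2" using assms by (intro power_mono) (auto simp: r_def b_def)
  also have "\<dots> = b\<^sup>2 + e + s\<^sup>2 + 2 * s * r" by (simp add: power2_sum r2)
  also have "2 * s * r \<le> 2 * s * (b + q)" using assms r_le by (intro mult_left_mono) auto
  also have "2 * s * (b + q) \<le> 2 * s * b + (3 * s\<^sup>2 + e / 3)"
  proof -
    have "0 \<le> (3 * s - q)\<^sup>2 / 3" by simp
    also have "\<dots> = 3 * s\<^sup>2 + e / 3 - 2 * s * q"
      using q(2) by (simp add: power2_diff power_mult_distrib field_simps)
    finally show ?thesis by (simp add: algebra_simps)
  qed
  also have "b\<^sup>2 + e + s\<^sup>2 + (2 * s * b + (3 * s\<^sup>2 + e / 3)) \<le> (b + 2 * s)\<^sup>2 + 3 / 2 * e"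
    using assms mult_nonneg_nonneg[OF b assms(1)] by (simp add: power2_sum power_mult_distrib)
  finally show ?thesis by (simp add: b_def)
qed

primrec prog_trace :: "nat \<Rightarrow> prog \<Rightarrow> prog \<Rightarrow> (nat \<Rightarrow> nat) \<Rightarrow> (nat \<Rightarrow> nat) \<Rightarrow> nat \<Rightarrow> nat \<Rightarrow> nat" where
  "prog_trace w ini upd p G 0 = sem w ini G"
| "prog_trace w ini upd p G (Suc t) = sem w upd ((prog_trace w ini upd p G t)(0 := p (Suc t) - 1))"

context sketch
begin

abbreviation trace :: "(nat \<Rightarrow> nat) \<Rightarrow> (nat \<Rightarrow> nat) \<Rightarrow> nat \<Rightarrow> nat \<Rightarrow> nat" where
  "trace p G \<equiv> prog_trace w (assign init_list) update_prog p G"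

definition zz :: "(nat \<Rightarrow> nat \<Rightarrow> nat) \<Rightarrow> (nat \<Rightarrow> nat) \<Rightarrow> nat \<Rightarrow> nat \<Rightarrow> int" where
  "zz cs p t q = (\<Sum>i\<in>{1..t}. sgn_of cs q (p i - 1))"

definition moment :: "(nat \<Rightarrow> nat \<Rightarrow> nat) \<Rightarrow> (nat \<Rightarrow> nat) \<Rightarrow> nat \<Rightarrow> nat \<Rightarrow> nat" where
  "moment cs p t g = (\<Sum>q\<in>group g. nat ((zz cs p t q)\<^sup>2))"

primrec vv :: "(nat \<Rightarrow> nat \<Rightarrow> nat) \<Rightarrow> (nat \<Rightarrow> nat) \<Rightarrow> nat \<Rightarrow> nat" where
  "vv cs p 0 = 0"
| "vv cs p (Suc t) = (raise (\<lambda>g. S\<^sup>2 * moment cs p (Suc t) g) ^^ (2 * S)) (vv cs p t)"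

lemma zz_bound: "\<bar>zz cs p t q\<bar> \<le> int t"
proof -
  have "\<bar>zz cs p t q\<bar> \<le> (\<Sum>i\<in>{1..t}. \<bar>sgn_of cs q (p i - 1)\<bar>)" unfolding zz_def by (rule sum_abs)
  also have "\<dots> \<le> (\<Sum>i\<in>{1..t}. 1)" by (intro sum_mono) (simp add: sgn_of_def hash_sign_def)
  finally show ?thesis by simp
qed

lemma group_eq: "g < R \<Longrightarrow> group g = (\<lambda>i. g * k + i) ` {..<k}"
proof (intro equalityI subsetI)
  fix q assume "g < R" "q \<in> group g"
  then have "q = g * k + q mod k" "q mod k < k" using k by (auto simp: group_def)
  then show "q \<in> (\<lambda>i. g * k + i) ` {..<k}" by blast
next
  fix q assume "g < R" "q \<in> (\<lambda>i. g * k + i) ` {..<k}"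
  then obtain i where i: "q = g * k + i" "i < k" by auto
  have "Suc g * k \<le> R * k" using \<open>g < R\<close> by (intro mult_le_mono1) simp
  then show "q \<in> group g" using i by (simp add: group_def)
qed

lemma sum_group: "g < R \<Longrightarrow> (\<Sum>q\<in>group g. f q) = (\<Sum>i<k. f (g * k + i))"
  by (subst group_eq) (auto simp: sum.reindex inj_on_def)

lemma moment_bound:
  assumes "g < R"
  shows "moment cs p t g \<le> k * t\<^sup>2"
proof -
  have "nat ((zz cs p t q)\<^sup>2) \<le> t\<^sup>2" for q
  proof -
    have "(zz cs p t q)\<^sup>2 \<le> (int t)\<^sup>2" using zz_bound[of cs p t q] by (simp add: abs_le_square_iff[symmetric])
    then show ?thesis by (simp add: nat_le_iff)
  qed
  then have "moment cs p t g \<le> (\<Sum>q\<in>group g. t\<^sup>2)" unfolding moment_def by (rule sum_mono)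
  also have "\<dots> = k * t\<^sup>2" unfolding sum_group[OF assms] by simp
  finally show ?thesis .
qed

lemma Y_reg_value:
  assumes inv: "rows_inv cs (zz cs p t) G" and t: "t \<le> 2 ^ w" and g: "g < R"
  shows "G (Y_reg g) = S\<^sup>2 * moment cs p t g"
proof -
  have "S\<^sup>2 * moment cs p t g \<le> (2 ^ w)\<^sup>2 * (2 ^ w * (2 ^ w)\<^sup>2)"
  proof -
    have "k * t\<^sup>2 \<le> 2 ^ w * (2 ^ w)\<^sup>2" using k_le t by (intro mult_le_mono power_mono) auto
    then have "moment cs p t g \<le> 2 ^ w * (2 ^ w)\<^sup>2" using moment_bound[OF g] order_trans by blast
    then show ?thesis using S_le by (intro mult_le_mono power_mono) auto
  qed
  also have "\<dots> \<le> 9 * ((2 ^ w) * (2 ^ w)\<^sup>2 * (2 ^ w)\<^sup>2)" by simp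
  finally have lt: "S\<^sup>2 * moment cs p t g < Q" by (rule bound_Q)
  have "S2 * (\<Sum>q\<in>group g. (zz cs p t q)\<^sup>2) = int (S\<^sup>2 * moment cs p t g)"
    by (simp add: S2_def moment_def)
  then have "int (G (Y_reg g)) = int (S\<^sup>2 * moment cs p t g) mod int Q"
    using inv g by (simp add: rows_inv_def)
  also have "\<dots> = int (S\<^sup>2 * moment cs p t g)" unfolding zmod_int[symmetric] using lt by simp
  finally show ?thesis by (simp only: of_nat_eq_iff)
qed

lemma raise_cong: "(\<And>g. g < R \<Longrightarrow> y g = y' g) \<Longrightarrow> raise y = raise y'"
  unfolding raise_def by (intro ext) (metis (mono_tags, lifting) Collect_cong)

lemma vv_bound: "vv cs p t \<le> 2 * S * t"
proof (induction t)
  case (Suc t)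
  show ?case
    using Suc raises_le[where y = "\<lambda>g. S\<^sup>2 * moment cs p (Suc t) g" and j = "2 * S" and v = "vv cs p t"] by simp
qed simp

lemma init_inv:
  assumes "\<And>q c. q < R * k \<Longrightarrow> c < 8 \<Longrightarrow> G (C_reg q c) = cs q c"
  defines "G' \<equiv> sem w (assign init_list) G"
  shows "rows_inv cs (\<lambda>q. 0) G'" "level G' 0"
proof -
  have val: "G' r = c" if "(r, c) \<in> set init_list" "\<And>c'. (r, c') \<in> set init_list \<Longrightarrow> c' = c" "c < Q" for r c
    unfolding G'_def using sem_assign[OF that(1,2), of w G] that(3) by simp
  have "S\<^sup>2 * k \<le> (2 ^ w)\<^sup>2 * 2 ^ w" using S_le k_le by (intro mult_le_mono power_mono) auto
  also have "\<dots> \<le> 9 * ((2 ^ w) * (2 ^ w)\<^sup>2 * (2 ^ w)\<^sup>2)" by simp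
  finally have S2k: "S\<^sup>2 * k < Q" by (rule bound_Q)
  have kQ: "k < Q" using k_le by (intro bound_Q) (auto intro: order_trans)
  have S2: "S\<^sup>2 < Q" using S2_le S by (auto intro: less_le_trans[of _ "2 * S\<^sup>2"])
  have 2: "G' 2 = 2 ^ (8 * w - 1)" using w by (intro val) (auto simp: init_list_def reg_defs)
  have 4: "G' 4 = R div 2" using R_less by (intro val) (auto simp: init_list_def reg_defs)
  have 5: "G' 5 = 0" by (intro val) (auto simp: init_list_def reg_defs)
  have 6: "G' 6 = k" using kQ by (intro val) (auto simp: init_list_def reg_defs)
  have 7: "G' 7 = k" using kQ by (intro val) (auto simp: init_list_def reg_defs)
  have 8: "G' 8 = S\<^sup>2 * k" using S2k by (intro val) (auto simp: init_list_def reg_defs)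
  have P: "G' (P_reg q) = S\<^sup>2" if "q < R * k" for q
    using that S2 by (intro val) (auto simp: init_list_def reg_simps)
  have N: "G' (N_reg q) = S\<^sup>2" if "q < R * k" for q
    using that S2 by (intro val) (auto simp: init_list_def reg_simps)
  have Y: "G' (Y_reg g) = 0" if "g < R" for g
    using that by (intro val) (auto simp: init_list_def reg_defs)
  have C: "G' (C_reg q c) = cs q c" if "q < R * k" "c < 8" for q c
    unfolding G'_def assms(1)[OF that, symmetric]
    by (rule sem_assign_other) (auto simp: init_list_def reg_defs)
  have "int (S\<^sup>2) mod int Q = int (S\<^sup>2)" unfolding zmod_int[symmetric] using S2 by simp
  then show "rows_inv cs (\<lambda>q. 0) G'"
    unfolding rows_inv_def using 2 4 8 P N Y C by (simp add: S2_def)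
  show "level G' 0" using 5 6 7 by (simp add: level_def)
qed

lemma trace_inv:
  assumes cs: "\<And>q c. q < R * k \<Longrightarrow> c < 8 \<Longrightarrow> G (C_reg q c) = cs q c" and t: "t \<le> 2 ^ w"
  shows "rows_inv cs (zz cs p t) (trace p G t) \<and> level (trace p G t) (vv cs p t)"
  using t
proof (induction t)
  case 0
  have "zz cs p 0 = (\<lambda>q. 0)" by (simp add: zz_def fun_eq_iff)
  then show ?case using init_inv[of G cs, OF cs] by simp
next
  case (Suc t)
  let ?x = "p (Suc t) - 1"
  define G1 where "G1 = (trace p G t)(0 := ?x)"
  define G2 where "G2 = sem w (thens (map row [0..<R * k])) G1"
  define G3 where "G3 = sem w (thens (replicate (2 * S) test)) G2"
  have IH: "rows_inv cs (zz cs p t) (trace p G t)" "level (trace p G t) (vv cs p t)" using Suc by auto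
  have 1: "rows_inv cs (zz cs p t) G1" "level G1 (vv cs p t)"
    using IH unfolding G1_def rows_inv_def level_def by (auto simp: reg_simps)
  have "(\<lambda>q. zz cs p t q + sgn_of cs q (G1 0)) = zz cs p (Suc t)"
    by (simp add: zz_def G1_def fun_eq_iff)
  then have 2: "rows_inv cs (zz cs p (Suc t)) G2" "level G2 (vv cs p t)"
    using rows_step[OF 1(1)] 1(2) unfolding G2_def level_def by auto
  have "raise (\<lambda>g. G2 (Y_reg g)) = raise (\<lambda>g. S\<^sup>2 * moment cs p (Suc t) g)"
    using Y_reg_value[OF 2(1) Suc.prems] by (intro raise_cong)
  then have vv: "(raise (\<lambda>g. G2 (Y_reg g)) ^^ (2 * S)) (vv cs p t) = vv cs p (Suc t)" by simp
  \<comment> \<open>The counter is at most \<open>2 * S * t\<close>, the tests add at most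
    \<open>2 * S\<close>, and the threshold looks one further; the square of the factor 3 is the
    constant 9 in \<open>bound_Q\<close>.\<close>
  have "vv cs p t + 2 * S + 1 \<le> 3 * (S * Suc t)"
  proof -
    have "1 \<le> S * Suc t" using S by simp
    then show ?thesis using vv_bound[of cs p t] by simp
  qed
  also have "\<dots> \<le> 3 * (2 ^ w * 2 ^ w)" using S_le Suc.prems by (intro mult_le_mono) auto
  finally have "k * (vv cs p t + 2 * S + 1)\<^sup>2 \<le> 2 ^ w * (3 * (2 ^ w * 2 ^ w))\<^sup>2"
    using k_le by (intro mult_le_mono power_mono) auto
  also have "\<dots> = 9 * ((2 ^ w) * (2 ^ w)\<^sup>2 * (2 ^ w)\<^sup>2)" by (simp add: power_mult_distrib)
  finally have "k * (vv cs p t + 2 * S + 1)\<^sup>2 < Q" by (rule bound_Q)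
  moreover have "G2 4 = R div 2" using 2(1) by (simp add: rows_inv_def)
  ultimately have 3: "level G3 (vv cs p (Suc t))" "\<forall>r. r \<notin> {3, 5, 6, 7} \<longrightarrow> G3 r = G2 r"
    using tests_step[OF 2(2)] unfolding vv[symmetric] G3_def by blast+
  have "rows_inv cs (zz cs p (Suc t)) G3"
    using 2(1) 3(2) unfolding rows_inv_def by (simp add: reg_simps)
  moreover have "trace p G (Suc t) = G3"
    by (simp add: update_prog_def G1_def G2_def G3_def)
  ultimately show ?case using 3(1) by simp
qed

lemma raise_cases: "raise y v = v \<or> raise y v = v + 1"
  by (simp add: raise_def)

text \<open>All tests of a step see the same group sums, so the first refusal is final; otherwise
  every test has raised the counter.\<close>

lemma raises_cases: "(raise y ^^ j) v = v + j \<or> raise y ((raise y ^^ j) v) = (raise y ^^ j) v"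
proof (induction j)
  case (Suc j)
  then show ?case using raise_cases[of y "v + j"] by auto
qed simp

text \<open>Replaces the median of the group estimates: \<open>v\<close> is raised only if a majority, hence some accurate
  group, exceeds \<open>((v + 1) / S)\<^sup>2\<close>, and stops only if some accurate group does not. If it never stops
  in a step, then \<open>v / S\<close> grows by 2, twice as fast as the root of the second moment can; \<open>s\<close> counts
  these steps.\<close>

lemma follow:
  fixes Fm :: "nat \<Rightarrow> real" and e :: real
  assumes F0: "Fm 0 = 0" and Fmono: "\<And>t. Fm t \<le> Fm (Suc t)"
    and Fstep: "\<And>t. sqrt (Fm (Suc t)) \<le> sqrt (Fm t) + 1" and e: "0 \<le> e"
    and good: "2 * card {g. g < R \<and> (\<exists>t\<le>m. e < \<bar>real (moment cs p t g) / real k - Fm t\<bar>)} < R"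
    and t: "t \<le> m"
  shows "(real (vv cs p t) / real S)\<^sup>2 \<le> Fm t + e
    \<and> (\<exists>s\<ge>0. 2 * s \<le> real (vv cs p t + 1) / real S
        \<and> sqrt (Fm t) \<le> sqrt ((real (vv cs p t + 1) / real S - 2 * s)\<^sup>2 + e) + s)"
proof -
  define Bad where "Bad = {g. g < R \<and> (\<exists>t\<le>m. e < \<bar>real (moment cs p t g) / real k - Fm t\<bar>)}"
  have finB: "finite Bad" by (simp add: Bad_def)
  \<comment> \<open>Bad groups are fewer than half, so any half of the groups contains an accurate
    one.\<close>
  have hit: "\<exists>g\<in>H. g < R \<and> g \<notin> Bad" if "H \<subseteq> {..<R}" "R \<le> 2 * card H" for H
  proof (rule ccontr)
    assume "\<not> ?thesis"
    then have "H \<subseteq> Bad" using that by auto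
    then have "card H \<le> card Bad" by (rule card_mono[OF finB])
    then show False using good that by (simp add: Bad_def)
  qed
  have cmp: "k * (v + 1)\<^sup>2 \<le> S\<^sup>2 * x \<longleftrightarrow> (real (v + 1) / real S)\<^sup>2 \<le> real x / real k" for v x
  proof -
    have "k * (v + 1)\<^sup>2 \<le> S\<^sup>2 * x \<longleftrightarrow> real (k * (v + 1)\<^sup>2) \<le> real (S\<^sup>2 * x)" by (simp only: of_nat_le_iff)
    also have "\<dots> \<longleftrightarrow> (real (v + 1) / real S)\<^sup>2 \<le> real x / real k"
      using k S by (simp add: power_divide divide_simps mult.commute)
    finally show ?thesis .
  qed
  have acc: "\<bar>real (moment cs p t g) / real k - Fm t\<bar> \<le> e" if "g < R" "g \<notin> Bad" "t \<le> m" for g t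
    using that unfolding Bad_def by force
  have up: "(real (v + 1) / real S)\<^sup>2 \<le> Fm t + e"
    if "raise (\<lambda>g. S\<^sup>2 * moment cs p t g) v \<noteq> v" "t \<le> m" for v t
  proof -
    have "R < 2 * card {g. g < R \<and> k * (v + 1)\<^sup>2 \<le> S\<^sup>2 * moment cs p t g}"
      using that(1) by (auto simp: raise_def split: if_splits)
    then obtain g where "g < R" "g \<notin> Bad" "k * (v + 1)\<^sup>2 \<le> S\<^sup>2 * moment cs p t g"
      using hit[of "{g. g < R \<and> k * (v + 1)\<^sup>2 \<le> S\<^sup>2 * moment cs p t g}"] by auto
    then show ?thesis using acc[of g t] that(2) unfolding cmp by linarith
  qed
  have stop: "Fm t \<le> (real (v + 1) / real S)\<^sup>2 + e"
    if "raise (\<lambda>g. S\<^sup>2 * moment cs p t g) v = v" "t \<le> m" for v t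
  proof -
    let ?H = "{g. g < R \<and> k * (v + 1)\<^sup>2 \<le> S\<^sup>2 * moment cs p t g}"
    have le: "2 * card ?H \<le> R" using that(1) by (auto simp: raise_def split: if_splits)
    have "card ({..<R} - ?H) = card {..<R} - card ?H" by (intro card_Diff_subset) auto
    then have "R \<le> 2 * card ({..<R} - ?H)" using le by simp
    then obtain g where "g < R" "g \<notin> Bad" "\<not> k * (v + 1)\<^sup>2 \<le> S\<^sup>2 * moment cs p t g"
      using hit[of "{..<R} - ?H"] by auto
    then show ?thesis using acc[of g t] that(2) unfolding cmp by linarith
  qed
  show ?thesis
    using t
  proof (induction t)
    case 0
    then show ?case using e by (intro conjI exI[of _ 0]) (auto simp: F0)
  next
    case (Suc t)
    let ?y = "\<lambda>g. S\<^sup>2 * moment cs p (Suc t) g"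
    define v where "v = vv cs p t"
    define v' where "v' = vv cs p (Suc t)"
    have v': "v' = (raise ?y ^^ (2 * S)) v" by (simp add: v'_def v_def)
    from Suc obtain s where low: "(real v / real S)\<^sup>2 \<le> Fm t + e"
      and s: "0 \<le> s" "2 * s \<le> real (v + 1) / real S"
        "sqrt (Fm t) \<le> sqrt ((real (v + 1) / real S - 2 * s)\<^sup>2 + e) + s"
      unfolding v_def by auto
    have "(real ((raise ?y ^^ j) v) / real S)\<^sup>2 \<le> Fm (Suc t) + e" for j
    proof (induction j)
      case 0
      then show ?case using low Fmono[of t] by simp
    next
      case (Suc j)
      let ?u = "(raise ?y ^^ j) v"
      have step: "(raise ?y ^^ Suc j) v = raise ?y ?u" by (simp only: funpow.simps o_apply)
      show ?case
      proof (cases "raise ?y ?u = ?u")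
        case True
        show ?thesis unfolding step True by (rule Suc)
      next
        case False
        then have u: "raise ?y ?u = ?u + 1" using raise_cases[of ?y ?u] by blast
        show ?thesis unfolding step u by (rule up[OF False \<open>Suc t \<le> m\<close>])
      qed
    qed
    then have low': "(real v' / real S)\<^sup>2 \<le> Fm (Suc t) + e" unfolding v' .
    have "\<exists>s\<ge>0. 2 * s \<le> real (v' + 1) / real S
        \<and> sqrt (Fm (Suc t)) \<le> sqrt ((real (v' + 1) / real S - 2 * s)\<^sup>2 + e) + s"
    proof (cases "raise ?y v' = v'")
      case True
      \<comment> \<open>A refusal bounds the moment directly and resets the lag to 0.\<close>
      then show ?thesis using stop[OF True Suc.prems] by (intro exI[of _ 0]) simp
    next
      case False
      \<comment> \<open>Every test raised \<open>v\<close>, so the level gained 2. With lag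
        \<open>s + 1\<close> the level minus twice the lag is unchanged, and the additional 1 covers
        the growth of the root.\<close>
      then have "v' = v + 2 * S" using raises_cases[where y = ?y and j = "2 * S" and v = v] unfolding v' by auto
      then have "real (v' + 1) / real S = real (v + 1) / real S + 2"
        using S by (simp add: field_simps)
      then show ?thesis using s Fstep[of t] by (intro exI[of _ "s + 1"]) (simp add: algebra_simps)
    qed
    with low' show ?case unfolding v'_def by blast
  qed
qed

text \<open>The error budget: the group error \<open>\<epsilon> / 3\<close>, inflated by the factor
  3/2 of \<open>catch_up_bound\<close>, takes half of \<open>\<epsilon>\<close>, and the granularity
  \<open>1 / S\<close> of the level takes the other half.\<close>

lemma estimate_error:
  fixes Fm :: "nat \<Rightarrow> real" and \<epsilon> :: real
  assumes F0: "Fm 0 = 0" and Fmono: "\<And>s t. s \<le> t \<Longrightarrow> Fm s \<le> Fm t"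
    and Fstep: "\<And>t. sqrt (Fm (Suc t)) \<le> sqrt (Fm t) + 1" and \<epsilon>: "0 < \<epsilon>" "\<epsilon> < 1"
    and F1: "1 \<le> m \<Longrightarrow> 1 \<le> Fm m" and S8: "8 / \<epsilon> \<le> real S"
    and good: "2 * card {g. g < R \<and> (\<exists>t\<le>m. \<epsilon> / 3 * Fm m < \<bar>real (moment cs p t g) / real k - Fm t\<bar>)} < R"
    and t: "t \<le> m"
  shows "\<bar>(real (vv cs p t) / real S)\<^sup>2 - Fm t\<bar> \<le> \<epsilon> * Fm m"
proof (cases "m = 0")
  case True
  then show ?thesis using t by (simp add: F0)
next
  case False
  then have Fm: "1 \<le> Fm m" using F1 by simp
  define e where "e = \<epsilon> / 3 * Fm m"
  have e: "0 \<le> e" "e \<le> Fm m / 3" using Fm \<epsilon> by (auto simp: e_def)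
  define v where "v = real (vv cs p t) / real S"
  have S0: "0 < real S" using S by simp
  have A: "real (vv cs p t + 1) / real S = v + 1 / real S" using S0 by (simp add: v_def field_simps)
  have v0: "0 \<le> v" by (simp add: v_def)
  have Ft: "0 \<le> Fm t" "Fm t \<le> Fm m" using Fmono[of 0 t] Fmono[OF t] F0 by auto
  obtain s where low: "v\<^sup>2 \<le> Fm t + e" and s: "0 \<le> s" "2 * s \<le> v + 1 / real S"
    "sqrt (Fm t) \<le> sqrt ((v + 1 / real S - 2 * s)\<^sup>2 + e) + s"
    using follow[OF F0 Fmono Fstep e(1) good[folded e_def] t] unfolding A v_def[symmetric] by auto
  have high: "Fm t \<le> (v + 1 / real S)\<^sup>2 + 3 / 2 * e"
    by (rule catch_up_bound[OF s(1,2) e(1) Ft(1) s(3)])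
  have "v\<^sup>2 \<le> 2 * Fm m" using low Ft e by linarith
  \<comment> \<open>A moment of at least 1 is at most its square. The coarse bound on
    \<open>v\<close> suffices because the error is measured against \<open>Fm m\<close>.\<close>
  also have "\<dots> \<le> (3 / 2 * Fm m)\<^sup>2" using Fm by (simp add: power2_eq_square)
  finally have v: "v \<le> 3 / 2 * Fm m" by (rule power2_le_imp_le) (use Fm in simp)
  have "1 / real S \<le> 1" using S by simp
  then have "2 * v + 1 / real S \<le> 4 * Fm m" using v Fm by linarith
  then have "(2 * v + 1 / real S) / real S \<le> 4 * Fm m / real S"
    using S0 by (intro divide_right_mono) auto
  also have "\<dots> \<le> \<epsilon> / 2 * Fm m"
  proof -
    have "4 / real S \<le> \<epsilon> / 2" using S8 S0 \<epsilon> by (simp add: field_simps)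
    then have "4 / real S * Fm m \<le> \<epsilon> / 2 * Fm m" using Fm by (intro mult_right_mono) auto
    then show ?thesis by simp
  qed
  finally have "(v + 1 / real S)\<^sup>2 \<le> v\<^sup>2 + \<epsilon> / 2 * Fm m"
    by (simp add: power2_eq_square algebra_simps add_divide_distrib)
  then have "Fm t - v\<^sup>2 \<le> \<epsilon> * Fm m" using high by (simp add: e_def)
  moreover have "v\<^sup>2 - Fm t \<le> \<epsilon> * Fm m"
  proof -
    have "e \<le> \<epsilon> * Fm m" using Fm \<epsilon> by (simp add: e_def)
    then show ?thesis using low by linarith
  qed
  ultimately show ?thesis unfolding v_def[symmetric] by linarith
qed

end

section \<open>From programs to streaming algorithms\<close>

definition reg_cells :: "nat \<Rightarrow> nat list" where
  "reg_cells r = map (\<lambda>i. 8 * r + i) [0..<8]"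

definition prog_alg :: "nat \<Rightarrow> nat \<Rightarrow> prog \<Rightarrow> prog \<Rightarrow> nat \<Rightarrow> nat \<Rightarrow> stream_alg" where
  "prog_alg w N ini upd a b = \<lparr>mem_size = 8 * Suc N, init = compile w ini, update = compile w upd,
    out_num = reg_cells a, out_den = reg_cells b\<rparr>"

lemma storage_prog_alg:
  "storage (prog_alg w N ini upd a b) \<le> 8 * Suc N + 80 * (prog_len ini + prog_len upd) + 16"
  using code_len_compile[of w ini] code_len_compile[of w upd]
  by (simp add: storage_def prog_alg_def reg_cells_def)

lemma out_val_prog_alg:
  assumes "1 \<le> a" "1 \<le> b"
  shows "out_val w (prog_alg w N ini upd a b) M = real (regs w M a) / real (regs w M b)"
proof -
  have "horner_sum (rd M) (2 ^ w) (reg_cells r) = reg w M r" for r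
    unfolding horner_sum_eq_sum by (simp add: reg_cells_def reg_def lessThan_atLeast0)
  then show ?thesis using assms by (simp add: out_val_def prog_alg_def regs_def)
qed

lemma random_mem_words:
  assumes "M \<in> set_pmf (random_mem w (prog_alg w N ini upd a b))"
  shows "words w M" "length M = 8 * Suc N"
proof -
  have "set_pmf (pmf_of_set {..<2 ^ w}) = {..<2 ^ w :: nat}" by (simp add: lessThan_empty_iff)
  then show "words w M" "length M = 8 * Suc N"
    using assms unfolding random_mem_def set_replicate_pmf words_def by (auto simp: prog_alg_def)
qed

lemma feed_regs:
  assumes "words w M" "length M = 8 * Suc N" "j - 1 < 2 ^ w"
  shows "words w (feed j M)" "length (feed j M) = 8 * Suc N" "regs w (feed j M) = (regs w M)(0 := j - 1)"
  using assms by (auto simp: feed_def words_update regs_def reg_def rd_update fun_eq_iff)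

lemma prog_alg_state:
  assumes w: "1 \<le> w" and valid: "valid N ini" "valid N upd"
    and items: "\<And>i. i \<in> {1..m} \<Longrightarrow> p i - 1 < 2 ^ w"
    and M0: "words w M0" "length M0 = 8 * Suc N" and t: "t \<le> m"
  shows "\<exists>M. state_at w (prog_alg w N ini upd a b) p M0 t M \<and> words w M \<and> length M = 8 * Suc N
    \<and> regs w M = prog_trace w ini upd p (regs w M0) t"
  using t
proof (induction t)
  case 0
  let ?M = "run w (compile w ini) M0"
  obtain k where "exec w (compile w ini) M0 k ?M" using exec_run[OF loop_free_compile] by blast
  then have "state_at w (prog_alg w N ini upd a b) p M0 0 ?M"
    by (intro state_at.start) (simp add: prog_alg_def)
  then show ?case
    using words_run[OF w M0(1)] M0(2) compile_correct[OF w valid(1) M0] by (intro exI[of _ ?M]) simp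
next
  case (Suc t)
  then obtain M where M: "state_at w (prog_alg w N ini upd a b) p M0 t M" "words w M" "length M = 8 * Suc N"
    "regs w M = prog_trace w ini upd p (regs w M0) t" by auto
  have item: "p (Suc t) - 1 < 2 ^ w" using Suc.prems by (intro items) auto
  note f = feed_regs[OF M(2,3) item]
  let ?M = "run w (compile w upd) (feed (p (Suc t)) M)"
  obtain k where "exec w (compile w upd) (feed (p (Suc t)) M) k ?M" using exec_run[OF loop_free_compile] by blast
  then have "state_at w (prog_alg w N ini upd a b) p M0 (Suc t) ?M"
    by (intro state_at.step[OF M(1)]) (simp add: prog_alg_def)
  then show ?case
    using words_run[OF w f(1)] f(2) compile_correct[OF w valid(2) f(1,2)] f(3) M(4)
    by (intro exI[of _ ?M]) simp
qed

lemma prog_alg_time: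
  "update_time_le w (prog_alg w N ini upd a b) p m (real (storage (prog_alg w N ini upd a b)))"
  unfolding update_time_le_def
proof (intro ballI conjI allI impI)
  fix M0
  obtain k where "exec w (compile w ini) M0 k (run w (compile w ini) M0)"
    using exec_run[OF loop_free_compile] by blast
  then show "\<exists>M. state_at w (prog_alg w N ini upd a b) p M0 0 M"
    by (intro exI state_at.start) (simp add: prog_alg_def)
next
  fix M0 t M
  let ?f = "feed (p (Suc t)) M"
  obtain k where "k \<le> code_len (compile w upd)" "exec w (compile w upd) ?f k (run w (compile w upd) ?f)"
    using exec_run[OF loop_free_compile] by blast
  then show "\<exists>k M'. exec w (update (prog_alg w N ini upd a b)) ?f k M'
      \<and> real k \<le> real (storage (prog_alg w N ini upd a b))"
    by (intro exI[of _ k] exI[of _ "run w (compile w upd) ?f"]) (simp add: prog_alg_def storage_def)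
qed

lemma update_time_le_mono: "update_time_le w A p m T \<Longrightarrow> T \<le> T' \<Longrightarrow> update_time_le w A p m T'"
  unfolding update_time_le_def by (meson order_trans)

section \<open>Growth of the frequencies and of the second moment\<close>

lemma freq_0: "freq p 0 j = 0"
  by (simp add: freq_def)

lemma freq_Suc: "freq p (Suc t) j = freq p t j + of_bool (p (Suc t) = j)"
proof -
  have "{i \<in> {1..Suc t}. p i = j} = {i \<in> {1..t}. p i = j} \<union> (if p (Suc t) = j then {Suc t} else {})"
    by (auto simp: le_Suc_eq)
  then show ?thesis by (simp add: freq_def card_insert_if)
qed

lemma freq_mono: "s \<le> t \<Longrightarrow> freq p s j \<le> freq p t j"
  by (rule lift_Suc_mono_le[of "\<lambda>t. freq p t j"]) (simp_all add: freq_Suc)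

lemma freq_le: "freq p t j \<le> t"
  by (induction t) (auto simp: freq_0 freq_Suc)

lemma F2_0: "F2 n p 0 = 0"
  by (simp add: F2_def freq_0)

lemma F2_Suc:
  "F2 n p (Suc t) = F2 n p t + (if p (Suc t) \<in> {1..n} then 2 * freq p t (p (Suc t)) + 1 else 0)"
proof -
  have "F2 n p (Suc t) = (\<Sum>j\<in>{1..n}. (freq p t j)\<^sup>2 + (if j = p (Suc t) then 2 * freq p t j + 1 else 0))"
    unfolding F2_def by (intro sum.cong) (auto simp: freq_Suc power2_eq_square)
  then show ?thesis by (simp add: sum.distrib F2_def)
qed

lemma F2_mono: "s \<le> t \<Longrightarrow> F2 n p s \<le> F2 n p t"
  by (rule lift_Suc_mono_le[of "F2 n p"]) (simp_all add: F2_Suc)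

lemma F2_le: "F2 n p t \<le> t\<^sup>2"
proof (induction t)
  case (Suc t)
  then show ?case using freq_le[of p t "p (Suc t)"] by (simp add: F2_Suc power2_eq_square)
qed (simp add: F2_0)

lemma freq_le_F2: "j \<in> {1..n} \<Longrightarrow> (freq p t j)\<^sup>2 \<le> F2 n p t"
  unfolding F2_def by (rule member_le_sum) auto

text \<open>An arrival adds \<open>2 * f + 1\<close>, and no frequency exceeds the root of the
  second moment. The \<open>2 * S\<close> tests per item, worth 2 units of level, outrun this
  speed.\<close>

lemma sqrt_F2_Suc: "sqrt (real (F2 n p (Suc t))) \<le> sqrt (real (F2 n p t)) + 1"
proof (rule real_le_lsqrt)
  let ?r = "sqrt (real (F2 n p t))"
  have "2 * freq p t (p (Suc t)) + 1 \<le> 2 * ?r + 1" if "p (Suc t) \<in> {1..n}"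
  proof -
    have "real (freq p t (p (Suc t))) \<le> ?r"
      using freq_le_F2[OF that, of p t] by (intro real_le_rsqrt) (simp flip: of_nat_power)
    then show ?thesis by simp
  qed
  then have "real (F2 n p (Suc t)) \<le> real (F2 n p t) + (2 * ?r + 1)"
    by (simp add: F2_Suc)
  also have "\<dots> = (?r + 1)\<^sup>2" by (simp add: power2_sum)
  finally show "real (F2 n p (Suc t)) \<le> (?r + 1)\<^sup>2" .
qed simp_all

text \<open>Links a counter fed item by item to the linear form in the frequencies on which
  \<open>ams\<close> rests.\<close>

lemma sum_stream:
  assumes "\<And>i. i \<in> {1..t} \<Longrightarrow> p i \<in> {1..n}"
  shows "(\<Sum>i\<in>{1..t}. h (p i)) = (\<Sum>j\<in>{1..n}. real (freq p t j) * h j)"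
  using assms
proof (induction t)
  case (Suc t)
  have "p (Suc t) \<in> {1..n}" using Suc.prems[of "Suc t"] by simp
  then have "(\<Sum>j\<in>{1..n}. real (freq p (Suc t) j) * h j) = (\<Sum>j\<in>{1..n}. real (freq p t j) * h j) + h (p (Suc t))"
  proof -
    have "(\<Sum>j\<in>{1..n}. real (freq p (Suc t) j) * h j)
        = (\<Sum>j\<in>{1..n}. real (freq p t j) * h j + (if j = p (Suc t) then h j else 0))"
      by (intro sum.cong) (auto simp: freq_Suc distrib_right)
    then show ?thesis using \<open>p (Suc t) \<in> {1..n}\<close> by (simp add: sum.distrib)
  qed
  then show ?case using Suc by simp
qed (simp add: freq_0)

section \<open>Exact counting\<close>

text \<open>Register \<open>3 + j\<close> holds \<open>2 * f + 1\<close> for the item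
  \<open>j + 1\<close>, the increment of the second moment at its next arrival; it starts at 1.
  Register 2 is the constant denominator.\<close>

definition exact_init :: "nat \<Rightarrow> prog" where
  "exact_init n = assign ([(1, 0), (2, 1)] @ map (\<lambda>j. (3 + j, 1)) [0..<n])"

definition exact_update :: "nat \<Rightarrow> prog" where
  "exact_update n = thens (map (\<lambda>j. If_Item j
    (thens [Mul_Add 1 One (Reg (3 + j)), Mul_Add (3 + j) One (Const 2)]) Nop) [0..<n])"

lemma valid_exact: "valid (2 + n) (exact_init n)" "valid (2 + n) (exact_update n)"
  unfolding exact_init_def by (rule valid_assign) (auto simp: exact_update_def)

lemma exact_step:
  assumes "n \<le> 2 ^ w" "G 0 < n"
  shows "sem w (exact_update n) G = G(1 := (G 1 + G (3 + G 0)) mod 2 ^ (8 * w), 3 + G 0 := (G (3 + G 0) + 2) mod 2 ^ (8 * w))"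
proof -
  let ?G' = "G(1 := (G 1 + G (3 + G 0)) mod 2 ^ (8 * w), 3 + G 0 := (G (3 + G 0) + 2) mod 2 ^ (8 * w))"
  have "sem w (thens (map (\<lambda>j. If_Item j
      (thens [Mul_Add 1 One (Reg (3 + j)), Mul_Add (3 + j) One (Const 2)]) Nop) [0..<l])) G
    = (if G 0 < l then ?G' else G)" if "l \<le> n" for l
    using that
  proof (induction l)
    case (Suc l)
    then have "l mod 2 ^ w = l" using assms(1) by simp
    then show ?case using Suc by (auto simp: sem_thens_append less_Suc_eq)
  qed simp
  from this[of n] show ?thesis using assms(2) by (simp add: exact_update_def)
qed

lemma exact_trace:
  fixes G :: "nat \<Rightarrow> nat"
  assumes w: "1 \<le> w" and n: "n \<le> 2 ^ w" and t: "t \<le> 2 ^ w" and p: "\<And>i. i \<in> {1..t} \<Longrightarrow> p i \<in> {1..n}"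
  defines "tr \<equiv> prog_trace w (exact_init n) (exact_update n) p G"
  shows "tr t 1 = F2 n p t \<and> tr t 2 = 1 \<and> (\<forall>j<n. tr t (3 + j) = 2 * freq p t (j + 1) + 1)"
  using t p
proof (induction t)
  case 0
  let ?xs = "[(1, 0), (2, 1)] @ map (\<lambda>j. (3 + j, 1)) [0..<n]"
  have val: "sem w (assign ?xs) G r = c" if "(r, c) \<in> set ?xs" "\<And>c'. (r, c') \<in> set ?xs \<Longrightarrow> c' = c" "c \<le> 1" for r c
  proof -
    have "c < 2 ^ (8 * w)" using that(3) w one_less_power[of "2::nat" "8 * w"] by linarith
    then show ?thesis using sem_assign[OF that(1,2), of w G] by simp
  qed
  have "sem w (assign ?xs) G 1 = 0" by (rule val) auto
  moreover have "sem w (assign ?xs) G 2 = 1" by (rule val) auto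
  moreover have "sem w (assign ?xs) G (3 + j) = 1" if "j < n" for j using that by (intro val) auto
  ultimately show ?case by (simp add: tr_def exact_init_def F2_0 freq_0)
next
  case (Suc t)
  let ?Q = "2 ^ (8 * w) :: nat"
  let ?i = "p (Suc t)"
  have i: "?i \<in> {1..n}" using Suc.prems(2)[of "Suc t"] by simp
  then have i_less: "?i - 1 < n" by auto
  have IH: "tr t 1 = F2 n p t" "tr t 2 = 1" "\<And>j. j < n \<Longrightarrow> tr t (3 + j) = 2 * freq p t (j + 1) + 1"
    using Suc by auto
  define b :: nat where "b = 2 ^ w"
  have b: "2 \<le> b" using self_le_power[of "2::nat" w] w by (simp add: b_def)
  have "b * b < b * b * (b * b * b * b * b * b)"
    using b by (intro n_less_m_mult_n[of "b * b", unfolded mult.commute[of _ "b * b"]]) (auto intro!: one_less_mult)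
  also have "\<dots> = ?Q" unfolding b_def by (simp add: power_add[symmetric] mult.assoc)
  finally have bQ: "b * b < ?Q" .
  have "F2 n p (Suc t) \<le> (Suc t)\<^sup>2" by (rule F2_le)
  also have "\<dots> \<le> b\<^sup>2" using Suc.prems(1) unfolding b_def by (intro power_mono) auto
  also have "\<dots> < ?Q" using bQ by (simp add: power2_eq_square)
  finally have F_lt: "F2 n p (Suc t) < ?Q" .
  have "2 * freq p t ?i + 1 + 2 \<le> 2 * b + 1"
    using freq_le[of p t ?i] Suc.prems(1) by (simp add: b_def)
  also have "\<dots> < ?Q"
  proof -
    have "2 * b \<le> b * b" using b by simp
    \<comment> \<open>From \<open>2 * b < ?Q\<close> with both sides even there is room for the
      additional 1.\<close>
    moreover have "even ?Q" "even (2 * b)" using w by auto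
    ultimately show ?thesis using bQ by presburger
  qed
  finally have f_lt: "2 * freq p t ?i + 1 + 2 < ?Q" .
  let ?G = "(tr t)(0 := ?i - 1)"
  have ti: "tr t (3 + (?i - 1)) = 2 * freq p t ?i + 1"
  proof -
    have "?i - 1 + 1 = ?i" using i by auto
    then show ?thesis using IH(3)[OF i_less] by simp
  qed
  have "tr (Suc t) = sem w (exact_update n) ?G" by (simp add: tr_def)
  also have "\<dots> = ?G(1 := (tr t 1 + tr t (3 + (?i - 1))) mod ?Q, 3 + (?i - 1) := (tr t (3 + (?i - 1)) + 2) mod ?Q)"
    using exact_step[OF n, of ?G] i_less by simp
  also have "\<dots> = ?G(1 := F2 n p (Suc t), 3 + (?i - 1) := 2 * freq p (Suc t) ?i + 1)"
    using F_lt f_lt i unfolding ti IH(1) by (simp add: F2_Suc freq_Suc)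
  finally have tr: "tr (Suc t) = ?G(1 := F2 n p (Suc t), 3 + (?i - 1) := 2 * freq p (Suc t) ?i + 1)" .
  have "tr (Suc t) (3 + j) = 2 * freq p (Suc t) (j + 1) + 1" if "j < n" for j
  proof (cases "j = ?i - 1")
    case True
    then show ?thesis using i unfolding tr by simp
  next
    case False
    then have "?i \<noteq> j + 1" by auto
    then show ?thesis using False IH(3)[OF that] unfolding tr by (simp add: freq_Suc)
  qed
  then show ?case using IH(2) unfolding tr by simp
qed

lemma exact_tracks:
  assumes w: "1 \<le> w" and n: "n \<le> 2 ^ w" and m: "m \<le> 2 ^ w" and p: "\<And>i. i \<in> {1..m} \<Longrightarrow> p i \<in> {1..n}"
    and \<epsilon>: "0 < \<epsilon>"
  defines "A \<equiv> prog_alg w (2 + n) (exact_init n) (exact_update n) 1 2"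
  shows "measure_pmf.prob (random_mem w A) {M0. tracks_F2 w A n p m \<epsilon> M0} = 1"
proof -
  have "tracks_F2 w A n p m \<epsilon> M0" if M0: "M0 \<in> set_pmf (random_mem w A)" for M0
    unfolding tracks_F2_def
  proof (intro allI impI)
    fix t assume t: "t \<le> m"
    note M0 = random_mem_words[OF M0[unfolded A_def]]
    have items: "p i - 1 < 2 ^ w" if "i \<in> {1..m}" for i using p[OF that] n by auto
    obtain M where M: "state_at w A p M0 t M" "regs w M = prog_trace w (exact_init n) (exact_update n) p (regs w M0) t"
      using prog_alg_state[where p = p, OF w valid_exact items M0 t] unfolding A_def by blast
    have "t \<le> 2 ^ w" "\<And>i. i \<in> {1..t} \<Longrightarrow> p i \<in> {1..n}" using t m p by auto
    then have "out_val w A M = real (F2 n p t)"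
      using exact_trace[OF w n, of t p "regs w M0"] M(2) unfolding A_def by (simp add: out_val_prog_alg)
    then show "\<exists>M. state_at w A p M0 t M \<and> \<bar>out_val w A M - real (F2 n p t)\<bar> \<le> \<epsilon> * real (F2 n p m)"
      using M(1) \<epsilon> by (intro exI[of _ M]) simp
  qed
  then show ?thesis
    by (intro measure_pmf.prob_eq_1[THEN iffD2]) (auto simp: AE_measure_pmf_iff)
qed

lemma exact_storage: "storage (prog_alg w (2 + n) (exact_init n) (exact_update n) 1 2) \<le> 488 * n + 360"
proof -
  have "prog_len (exact_init n) = n + 3" "prog_len (exact_update n) = 5 * n + 1"
    by (simp_all add: exact_init_def prog_len_assign exact_update_def o_def sum_list_triv)
  then show ?thesis using storage_prog_alg[of w "2 + n" "exact_init n" "exact_update n" 1 2] by simp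
qed

section \<open>Accuracy and cost of the sketch\<close>

lemma ams_rows:
  assumes w: "1 \<le> w" and n: "n \<le> 2 ^ w" and k: "0 < k"
  shows "ams (replicate_pmf k (coeff_pmf w)) (\<lambda>\<omega> (i, j). real_of_int (hash_sign w (\<omega> ! i) (j - 1))) k {1..n}
    (\<lambda>t j. real (freq p t j))"
proof
  show "finite (set_pmf (replicate_pmf k (coeff_pmf w)))"
    by (intro finite_set_replicate_pmf finite_coeff_pmf)
  show "(case v of (i, j) \<Rightarrow> real_of_int (hash_sign w (\<omega> ! i) (j - 1)))
      * (case v of (i, j) \<Rightarrow> real_of_int (hash_sign w (\<omega> ! i) (j - 1))) = 1" for \<omega> v
    by (auto simp: of_int_mult[symmetric] hash_sign_sq split: prod.split simp del: of_int_mult)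
  show "measure_pmf.expectation (replicate_pmf k (coeff_pmf w))
      (\<lambda>\<omega>. \<Prod>v\<in>J. case v of (i, j) \<Rightarrow> real_of_int (hash_sign w (\<omega> ! i) (j - 1))) = 0"
    if "J \<subseteq> {..<k} \<times> {1..n}" "finite J" "J \<noteq> {}" "card J \<le> 8" for J
    using row_signs_independent[OF w n that(1,3,4)] by simp
  show "real (freq p s j) \<le> real (freq p t j)" if "s \<le> t" for s t j
    using freq_mono[OF that] by simp
qed (use k in \<open>simp_all add: freq_0\<close>)

context sketch
begin

text \<open>The quotient of registers 5 and 8 is \<open>k * v\<^sup>2 / (S\<^sup>2 * k)\<close>, the
  square of the level.\<close>

definition alg :: stream_alg where
  "alg = prog_alg w last_reg (assign init_list) update_prog 5 8"

text \<open>The random suffix of the memory, from the first coefficient register on, read as groups,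
  rows and eight-digit coefficients.\<close>

definition decode :: "mem \<Rightarrow> nat list list list" where
  "decode M = map (\<lambda>G. map (\<lambda>r. map (horner_sum id (2 ^ w)) (chunks 8 8 r)) (chunks k (8 * 8) G))
    (chunks R (k * (8 * 8)) (drop (8 * (9 + R + 2 * (R * k))) M))"

lemma decode_pmf: "map_pmf decode (random_mem w alg) = replicate_pmf R (replicate_pmf k (coeff_pmf w))"
proof -
  let ?u = "pmf_of_set {..<2 ^ w} :: nat pmf"
  let ?a = "8 * (9 + R + 2 * (R * k))"
  have "8 * Suc last_reg = ?a + R * (k * (8 * 8))" by (simp add: last_reg_def algebra_simps)
  then have rm: "random_mem w alg = replicate_pmf (?a + R * (k * (8 * 8))) ?u"
    by (simp only: random_mem_def alg_def prog_alg_def stream_alg.simps)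
  have "map_pmf (drop ?a) (random_mem w alg)
      = map_pmf (\<lambda>(xs, ys). drop ?a (xs @ ys)) (pair_pmf (replicate_pmf ?a ?u) (replicate_pmf (R * (k * (8 * 8))) ?u))"
    unfolding rm replicate_pmf_add_pair by (simp add: pmf.map_comp o_def case_prod_unfold)
  also have "\<dots> = map_pmf snd (pair_pmf (replicate_pmf ?a ?u) (replicate_pmf (R * (k * (8 * 8))) ?u))"
    by (intro map_pmf_cong refl) (auto simp: set_replicate_pmf simp del: replicate_pmf.simps)
  finally have drop: "map_pmf (drop ?a) (random_mem w alg) = replicate_pmf (R * (k * (8 * 8))) ?u"
    by (simp only: map_snd_pair_pmf)
  have "map_pmf decode (random_mem w alg)
      = map_pmf (map (map (map (horner_sum id (2 ^ w))))) (map_pmf (map (map (chunks 8 8)))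
          (map_pmf (map (chunks k (8 * 8))) (map_pmf (chunks R (k * (8 * 8))) (map_pmf (drop ?a) (random_mem w alg)))))"
    by (simp add: pmf.map_comp o_def decode_def[abs_def])
  also have "\<dots> = replicate_pmf R (replicate_pmf k (replicate_pmf 8 (map_pmf (horner_sum id (2 ^ w)) (replicate_pmf 8 ?u))))"
    unfolding drop chunks_pmf replicate_pmf_map[symmetric] ..
  also have "map_pmf (horner_sum id (2 ^ w)) (replicate_pmf 8 ?u) = pmf_of_set {..<2 ^ (8 * w)}"
    by (subst horner_pmf) (simp_all add: power_mult[symmetric] mult.commute)
  finally show ?thesis by (simp only: coeff_pmf_def)
qed

text \<open>The nested block offsets add up to the address that \<open>C_reg\<close> assigns to the
  flat row number \<open>g * k + i\<close>.\<close>

lemma decode_nth: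
  assumes M: "length M = 8 * Suc last_reg" and g: "g < R" and i: "i < k"
  shows "decode M ! g ! i = map (\<lambda>c. regs w M (C_reg (g * k + i) c)) [0..<8]"
proof (rule nth_equalityI)
  let ?a = "8 * (9 + R + 2 * (R * k))"
  let ?D = "drop ?a M"
  have len: "length ?D = R * (k * (8 * 8))" using M by (simp add: last_reg_def algebra_simps)
  let ?G = "chunks R (k * (8 * 8)) ?D ! g"
  have lenG: "length ?G = k * (8 * 8)" by (rule length_chunks_nth[OF len g])
  let ?r = "chunks k (8 * 8) ?G ! i"
  have lenr: "length ?r = 8 * 8" by (rule length_chunks_nth[OF lenG i])
  have row: "decode M ! g ! i = map (horner_sum id (2 ^ w)) (chunks 8 8 ?r)"
    using g i by (simp add: decode_def)
  show "length (decode M ! g ! i) = length (map (\<lambda>c. regs w M (C_reg (g * k + i) c)) [0..<8])"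
    by (simp add: row)
  fix c assume "c < length (decode M ! g ! i)"
  then have c: "c < 8" by (simp add: row)
  let ?d = "chunks 8 8 ?r ! c"
  have lend: "length ?d = 8" by (rule length_chunks_nth[OF lenr c])
  have "?d ! d = rd M (8 * C_reg (g * k + i) c + d)" if d: "d < 8" for d
  proof -
    have cd: "c * 8 + d < 8 * 8" using c d by simp
    have gi: "g * k + i < R * k"
      using i mult_le_mono1[of "Suc g" R k] g by simp
    have icd: "i * (8 * 8) + (c * 8 + d) < k * (8 * 8)"
      using cd mult_le_mono1[of "Suc i" k "8 * 8"] i by simp
    have "?d ! d = ?D ! (g * (k * (8 * 8)) + (i * (8 * 8) + (c * 8 + d)))"
      by (simp only: chunks_nth[OF lenr c d] chunks_nth[OF lenG i cd] chunks_nth[OF len g icd])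
    also have "\<dots> = M ! (?a + (g * (k * (8 * 8)) + (i * (8 * 8) + (c * 8 + d))))"
      using M by (intro nth_drop) (simp add: last_reg_def)
    also have "?a + (g * (k * (8 * 8)) + (i * (8 * 8) + (c * 8 + d))) = 8 * C_reg (g * k + i) c + d"
      by (simp add: C_reg_def algebra_simps)
    finally show ?thesis
      using M gi c d by (simp add: rd_def C_reg_def last_reg_def)
  qed
  then have "horner_sum id (2 ^ w) ?d = reg w M (C_reg (g * k + i) c)"
    unfolding horner_sum_eq_sum reg_def lend by (simp add: lessThan_atLeast0)
  then show "decode M ! g ! i ! c = map (\<lambda>c. regs w M (C_reg (g * k + i) c)) [0..<8] ! c"
    using c by (simp add: row regs_def C_reg_def)
qed

lemma tracking_probability:
  assumes n: "n \<le> 2 ^ w" and m: "m \<le> 2 ^ w" and p: "\<And>i. i \<in> {1..m} \<Longrightarrow> p i \<in> {1..n}"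
    and \<epsilon>: "0 < \<epsilon>" "\<epsilon> < 1" and k_ge: "13100 / \<epsilon>\<^sup>2 \<le> real k" and S_ge: "8 / \<epsilon> \<le> real S"
  shows "1 - 1 / 2 ^ R \<le> measure_pmf.prob (random_mem w alg) {M0. tracks_F2 w alg n p m \<epsilon> M0}"
proof -
  let ?D = "replicate_pmf k (coeff_pmf w)"
  let ?\<sigma> = "\<lambda>\<omega> (i, j). real_of_int (hash_sign w (\<omega> ! i) (j - 1))"
  interpret ams ?D ?\<sigma> k "{1..n}" "\<lambda>t j. real (freq p t j)"
    using w n k by (intro ams_rows) auto
  have F_eq: "F t = real (F2 n p t)" for t unfolding F_def F2_def by simp
  define Bad where "Bad = {\<omega>. \<exists>t\<le>m. \<epsilon> / 3 * F m < \<bar>X t \<omega>\<bar>}"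
  have Bad: "measure_pmf.prob ?D Bad \<le> 1 / 16"
  proof (cases "F m = 0")
    case True
    \<comment> \<open>With threshold 0 Markov's inequality says nothing, but here all frequencies
      vanish and no group errs.\<close>
    have "F t = 0" if "t \<le> m" for t using F2_mono[OF that, of n p] True unfolding F_eq by simp
    moreover have "X t \<omega> = 0" if "F t = 0" for t \<omega>
    proof -
      have "\<And>j. j \<in> {1..n} \<Longrightarrow> freq p t j = 0" using that unfolding F_def by (simp add: sum_nonneg_eq_0_iff)
      then show ?thesis using that unfolding X_def by simp
    qed
    ultimately have "Bad = {}" using True by (auto simp: Bad_def)
    then show ?thesis by simp
  next
    case False
    then have "0 < F m" unfolding F_eq by simp
    then have "measure_pmf.prob ?D Bad \<le> 132192 / ((\<epsilon> / 3) ^ 4 * (real k)\<^sup>2)"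
      unfolding Bad_def using \<epsilon> by (intro tracking) auto
    also have "(\<epsilon> / 3) ^ 4 * (real k)\<^sup>2 = (\<epsilon>\<^sup>2 * real k)\<^sup>2 / 81"
      by (simp add: power_divide power_mult_distrib power_mult[symmetric])
    also have "132192 / ((\<epsilon>\<^sup>2 * real k)\<^sup>2 / 81) \<le> 132192 / (13100\<^sup>2 / 81)"
    proof -
      \<comment> \<open>The bound 1/16 requires \<open>(\<epsilon>\<^sup>2 * k)\<^sup>2\<close> to
        be at least \<open>16 * 81 * 132192\<close>, whose root is just below 13089; the 81 stems
        from the accuracy \<open>\<epsilon> / 3\<close>.\<close>
      have "13100 \<le> \<epsilon>\<^sup>2 * real k" using k_ge \<epsilon> by (simp add: field_simps)
      then have "(13100::real)\<^sup>2 \<le> (\<epsilon>\<^sup>2 * real k)\<^sup>2" by (intro power_mono) auto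
      then show ?thesis by (intro divide_left_mono divide_right_mono) (use k \<epsilon> in auto)
    qed
    also have "\<dots> \<le> 1 / 16" by simp
    finally show ?thesis .
  qed
  define Fail where "Fail = {xs. R \<le> 2 * card {g. g < R \<and> xs ! g \<in> Bad}}"
  have Fail: "measure_pmf.prob (random_mem w alg) (decode -` Fail) \<le> 1 / 2 ^ R"
    using majority_tail[OF finD Bad, of R] unfolding Fail_def[symmetric] decode_pmf[symmetric]
    by (simp add: measure_map_pmf)
  \<comment> \<open>From here the argument is deterministic: one memory with few bad groups is
    fixed.\<close>
  have ok: "tracks_F2 w alg n p m \<epsilon> M0" if M0: "M0 \<in> set_pmf (random_mem w alg)" "decode M0 \<notin> Fail" for M0
  proof -
    note len = random_mem_words[OF M0(1)[unfolded alg_def]]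
    define G0 where "G0 = regs w M0"
    define cs where "cs q c = G0 (C_reg q c)" for q c
    have est: "real (moment cs p t g) / real k - F t = X t (decode M0 ! g)" if "g < R" "t \<le> m" for g t
    proof -
      have "real_of_int (zz cs p t (g * k + i)) = (\<Sum>j\<in>{1..n}. real (freq p t j) * ?\<sigma> (decode M0 ! g) (i, j))"
        if "i < k" for i
      proof -
        have "decode M0 ! g ! i = map (cs (g * k + i)) [0..<8]"
          unfolding decode_nth[OF len(2) \<open>g < R\<close> \<open>i < k\<close>] by (simp add: cs_def G0_def)
        then have "real_of_int (zz cs p t (g * k + i))
            = (\<Sum>\<tau>\<in>{1..t}. real_of_int (hash_sign w (decode M0 ! g ! i) (p \<tau> - 1)))"
          by (simp add: zz_def sgn_of_def)
        also have "\<dots> = (\<Sum>j\<in>{1..n}. real (freq p t j) * real_of_int (hash_sign w (decode M0 ! g ! i) (j - 1)))"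
          using p \<open>t \<le> m\<close> by (intro sum_stream) auto
        finally show ?thesis by simp
      qed
      then have "real (moment cs p t g) = (\<Sum>i<k. (\<Sum>j\<in>{1..n}. real (freq p t j) * ?\<sigma> (decode M0 ! g) (i, j))\<^sup>2)"
        unfolding moment_def sum_group[OF \<open>g < R\<close>] by simp
      then show ?thesis unfolding X_def by simp
    qed
    have eq: "{g. g < R \<and> (\<exists>t\<le>m. \<epsilon> / 3 * F m < \<bar>real (moment cs p t g) / real k - F t\<bar>)}
        = {g. g < R \<and> decode M0 ! g \<in> Bad}"
      unfolding Bad_def using est by auto
    have good: "2 * card {g. g < R \<and> (\<exists>t\<le>m. \<epsilon> / 3 * F m < \<bar>real (moment cs p t g) / real k - F t\<bar>)} < R"
      unfolding eq using M0(2) by (simp add: Fail_def)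
    show ?thesis
      unfolding tracks_F2_def
    proof (intro allI impI)
      fix t assume t: "t \<le> m"
      have items: "p i - 1 < 2 ^ w" if "i \<in> {1..m}" for i using p[OF that] n by auto
      obtain M where M: "state_at w alg p M0 t M" "regs w M = trace p G0 t"
        using prog_alg_state[where p = p, OF w valid_init valid_update items len t] unfolding alg_def G0_def by blast
      have inv: "rows_inv cs (zz cs p t) (trace p G0 t)" "level (trace p G0 t) (vv cs p t)"
        using trace_inv[of G0 cs t p] t m by (auto simp: cs_def)
      have "out_val w alg M = real (k * (vv cs p t)\<^sup>2) / real (S\<^sup>2 * k)"
        using inv M(2) by (simp add: alg_def out_val_prog_alg rows_inv_def level_def)
      also have "\<dots> = (real (vv cs p t) / real S)\<^sup>2"
        using k by (simp add: power_divide)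
      finally have out: "out_val w alg M = (real (vv cs p t) / real S)\<^sup>2" .
      have "\<bar>(real (vv cs p t) / real S)\<^sup>2 - F t\<bar> \<le> \<epsilon> * F m"
      proof (rule estimate_error[OF _ _ _ \<epsilon> _ S_ge good t])
        show "1 \<le> F m" if "1 \<le> m"
        proof -
          have "1 \<le> F2 n p (Suc 0)" using p[of 1] that by (simp add: F2_Suc)
          also have "\<dots> \<le> F2 n p m" using that by (intro F2_mono) simp
          finally show ?thesis unfolding F_eq by simp
        qed
      qed (unfold F_eq, simp_all add: F2_0 F2_mono sqrt_F2_Suc)
      then show "\<exists>M. state_at w alg p M0 t M \<and> \<bar>out_val w alg M - real (F2 n p t)\<bar> \<le> \<epsilon> * real (F2 n p m)"
        using M(1) out unfolding F_eq by (intro exI[of _ M]) simp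
    qed
  qed
  have "1 - 1 / 2 ^ R \<le> 1 - measure_pmf.prob (random_mem w alg) (decode -` Fail)"
    using Fail by simp
  also have "\<dots> = measure_pmf.prob (random_mem w alg) (- (decode -` Fail))"
    using measure_pmf.prob_compl[of "decode -` Fail" "random_mem w alg"] by (simp add: Compl_eq_Diff_UNIV)
  also have "\<dots> = measure_pmf.prob (random_mem w alg) (- (decode -` Fail) \<inter> set_pmf (random_mem w alg))"
    by (simp add: measure_Int_set_pmf)
  also have "\<dots> \<le> measure_pmf.prob (random_mem w alg) {M0. tracks_F2 w alg n p m \<epsilon> M0}"
    using ok by (intro measure_pmf.finite_measure_mono) auto
  finally show ?thesis .
qed

text \<open>The \<open>2 * S\<close> unrolled tests cost \<open>O(S * R)\<close>, which the
  \<open>k * R\<close> rows dominate since \<open>S \<le> k\<close>.\<close>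

lemma storage_alg:
  assumes "S \<le> k"
  shows "storage alg \<le> 4500 * (k * R)"
proof -
  have row: "prog_len (row q) = 19" for q by (simp add: row_def horner_prog_def o_def sum_list_triv)
  have test: "prog_len test = 3 * R + 8" by (simp add: test_def count_def o_def sum_list_triv)
  have upd: "prog_len update_prog = 2 + 19 * (k * R) + 2 * S * (3 * R + 8)"
    by (simp add: update_prog_def o_def row test sum_list_triv sum_list_replicate mult.commute)
  have ini: "prog_len (assign init_list) = 7 + R + 2 * (k * R)"
    by (simp add: prog_len_assign init_list_def mult.commute)
  have 1: "1 \<le> k * R" "R \<le> k * R" "S \<le> k * R" "S * R \<le> k * R"
    using k R assms mult_le_mono[of 1 k R R] mult_le_mono[of S k 1 R] mult_le_mono[of S k R R] mult_le_mono[of 1 k 1 R]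
    by auto
  have "storage alg \<le> 8 * Suc (8 + R + 10 * (k * R)) + 80 * (9 + R + 21 * (k * R) + 6 * (S * R) + 16 * S) + 16"
    using storage_prog_alg[of w last_reg "assign init_list" update_prog 5 8]
    unfolding alg_def[symmetric] upd ini by (simp add: last_reg_def algebra_simps)
  moreover have "s \<le> 4500 * x"
    if "s \<le> 8 * Suc (8 + R + 10 * x) + 80 * (9 + R + 21 * x + 6 * y + 16 * S) + 16"
      "1 \<le> x" "R \<le> x" "S \<le> x" "y \<le> x" for s x y :: nat
    using that by simp
  ultimately show ?thesis using 1 by blast
qed

end

theorem theorem7:
  shows "\<exists>C::real. C > 0 \<and>
    (\<forall>(\<epsilon>::real) (\<delta>::real) (n::nat) (w::nat).
       0 < \<epsilon> \<and> \<epsilon> < 1 \<and> 0 < \<delta> \<and> \<delta> < 1 \<and> 1 \<le> w \<and> n \<le> 2 ^ w \<longrightarrow>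
       (\<exists>A::stream_alg.
          real (storage A) \<le> C * cost \<epsilon> \<delta> \<and>
          (\<forall>(m::nat) (p::nat \<Rightarrow> nat).
             m \<le> 2 ^ w \<and> (\<forall>i\<in>{1..m}. p i \<in> {1..n}) \<longrightarrow>
             update_time_le w A p m (C * cost \<epsilon> \<delta>) \<and>
             measure_pmf.prob (random_mem w A) {M0. tracks_F2 w A n p m \<epsilon> M0} \<ge> 1 - \<delta>)))"
proof (rule exI[of _ 117909000], intro conjI allI impI)
  fix \<epsilon> \<delta> :: real and n w :: nat
  assume "0 < \<epsilon> \<and> \<epsilon> < 1 \<and> 0 < \<delta> \<and> \<delta> < 1 \<and> 1 \<le> w \<and> n \<le> 2 ^ w"
  then have \<epsilon>: "0 < \<epsilon>" "\<epsilon> < 1" and \<delta>: "0 < \<delta>" "\<delta> < 1" and w: "1 \<le> w" and n: "n \<le> 2 ^ w" by auto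
  define L where "L = max 1 (log 2 (1 / \<delta>))"
  define k where "k = nat \<lceil>13100 / \<epsilon>\<^sup>2\<rceil>"
  define S where "S = nat \<lceil>8 / \<epsilon>\<rceil>"
  define R where "R = nat \<lceil>L\<rceil>"
  have e2: "1 \<le> 1 / \<epsilon>\<^sup>2" using \<epsilon> by (simp add: power_le_one)
  have L: "1 \<le> L" by (simp add: L_def)
  \<comment> \<open>Rounding up costs less than 1, which is at most
    \<open>1 / \<epsilon>\<^sup>2\<close>.\<close>
  have k_ge: "13100 / \<epsilon>\<^sup>2 \<le> real k" and k_le: "real k \<le> 13101 / \<epsilon>\<^sup>2"
    unfolding k_def using e2 by linarith+
  have S_ge: "8 / \<epsilon> \<le> real S" unfolding S_def by linarith
  have R_ge: "L \<le> real R" and R_le: "real R \<le> 2 * L" unfolding R_def using L by linarith+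
  have k16: "16 \<le> k" using k_ge e2 by linarith
  have R1: "1 \<le> R" using R_ge L by linarith
  have "8 / \<epsilon> \<le> 8 / \<epsilon>\<^sup>2" using \<epsilon> by (intro divide_left_mono) (auto simp: power2_eq_square mult_le_one)
  also have "\<dots> \<le> 13100 / \<epsilon>\<^sup>2" by (intro divide_right_mono) auto
  finally have Sk: "S \<le> k" unfolding S_def k_def by (intro nat_mono ceiling_mono)
  have S1: "1 \<le> S"
  proof -
    have "0 < 8 / \<epsilon>" using \<epsilon> by simp
    then have "0 < real S" using S_ge by linarith
    then show ?thesis by simp
  qed
  \<comment> \<open>\<open>117909000 = 4500 * 13101 * 2\<close>: the storage per row, the rounded
    \<open>k\<close>, and the rounding of \<open>R\<close> to at most \<open>2 * L\<close>.\<close>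
  have C: "4500 * (real k * real R) \<le> 117909000 * cost \<epsilon> \<delta>"
  proof -
    have "real k * real R \<le> (13101 / \<epsilon>\<^sup>2) * (2 * L)"
      using k_le R_le by (intro mult_mono) auto
    then show ?thesis by (simp add: cost_def L_def)
  qed
  have \<delta>_ge: "1 / 2 ^ R \<le> \<delta>"
  proof -
    have "1 / \<delta> = 2 powr log 2 (1 / \<delta>)" using \<delta> by simp
    also have "\<dots> \<le> 2 powr real R" using R_ge by (intro powr_mono) (auto simp: L_def)
    also have "\<dots> = 2 ^ R" by (simp add: powr_realpow)
    finally show ?thesis using \<delta> by (simp add: field_simps)
  qed
  show "\<exists>A. real (storage A) \<le> 117909000 * cost \<epsilon> \<delta> \<and>
      (\<forall>m p. m \<le> 2 ^ w \<and> (\<forall>i\<in>{1..m}. p i \<in> {1..n}) \<longrightarrow>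
         update_time_le w A p m (117909000 * cost \<epsilon> \<delta>) \<and>
         1 - \<delta> \<le> measure_pmf.prob (random_mem w A) {M0. tracks_F2 w A n p m \<epsilon> M0})"
  proof (cases "k \<le> 2 ^ w \<and> R \<le> 2 ^ w")
    case True
    interpret sketch w k R S
      using w k16 R1 S1 True Sk by unfold_locales auto
    have "real (storage alg) \<le> real (4500 * (k * R))" using storage_alg[OF Sk] by (simp only: of_nat_le_iff)
    then have st: "real (storage alg) \<le> 117909000 * cost \<epsilon> \<delta>" using C by (simp add: mult.commute)
    show ?thesis
    proof (intro exI[of _ alg] conjI allI impI)
      fix m :: nat and p :: "nat \<Rightarrow> nat" assume "m \<le> 2 ^ w \<and> (\<forall>i\<in>{1..m}. p i \<in> {1..n})"
      then have m: "m \<le> 2 ^ w" and p: "\<And>i. i \<in> {1..m} \<Longrightarrow> p i \<in> {1..n}" by auto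
      show "update_time_le w alg p m (117909000 * cost \<epsilon> \<delta>)"
        using prog_alg_time st unfolding alg_def by (rule update_time_le_mono)
      show "1 - \<delta> \<le> measure_pmf.prob (random_mem w alg) {M0. tracks_F2 w alg n p m \<epsilon> M0}"
        using tracking_probability[where p = p, OF n m p \<epsilon> k_ge S_ge] \<delta>_ge by linarith
    qed (rule st)
  next
    case False
    let ?A = "prog_alg w (2 + n) (exact_init n) (exact_update n) 1 2"
    have "k \<le> k * R" "R \<le> k * R" using R1 k16 by simp_all
    \<comment> \<open>For such short words \<open>n \<le> 2 ^ w \<le> k * R\<close>, so a register
      for every item is within the budget.\<close>
    then have "2 ^ w \<le> k * R" using False by linarith
    then have "storage ?A \<le> 4500 * (k * R)" using exact_storage[of w n] n k16 R1 mult_le_mono[of 1 k 1 R] by linarith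
    then have "real (storage ?A) \<le> real (4500 * (k * R))" by (simp only: of_nat_le_iff)
    then have st: "real (storage ?A) \<le> 117909000 * cost \<epsilon> \<delta>" using C by (simp add: mult.commute)
    show ?thesis
    proof (intro exI[of _ ?A] conjI allI impI)
      fix m :: nat and p :: "nat \<Rightarrow> nat" assume "m \<le> 2 ^ w \<and> (\<forall>i\<in>{1..m}. p i \<in> {1..n})"
      then have m: "m \<le> 2 ^ w" and p: "\<And>i. i \<in> {1..m} \<Longrightarrow> p i \<in> {1..n}" by auto
      show "update_time_le w ?A p m (117909000 * cost \<epsilon> \<delta>)"
        using prog_alg_time st by (rule update_time_le_mono)
      show "1 - \<delta> \<le> measure_pmf.prob (random_mem w ?A) {M0. tracks_F2 w ?A n p m \<epsilon> M0}"
        using exact_tracks[where p = p, OF w n m p \<epsilon>(1)] \<delta> by simp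
    qed (rule st)
  qed
qed simp

end
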